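(* Let $m\ge 1$, and for each $1\le j\le m$ let $1\le p_j\le q_j<\infty$ be real numbers and let $X_j$ be a $p_j$-convex Banach lattice (with $p_j$-convexity constant $1$). Define $q$ by $1/q=1/q_1+\cdots+1/q_m$. Let $Y$ be a Banach space and let $T\colon X_1\times\cdots\times X_m\to Y$ be a multilinear operator. Then the following statements are equivalent. (i) $T$ is $(p_1,\ldots,p_m)$-strongly $(q_1,\ldots,q_m)$-concave. (ii) There are a constant $C>0$ and, for each $1\le j\le m$, a regular Borel probability measure $\nu_j$ on the weak$^*$ compact set $B^{+}_{((X_j)_{p_j})^*}$ such that for every $(x_1,\ldots,x_m)\in X_1\times\cdots\times X_m$, $$\|T(x_1,\ldots,x_m)\|_Y\le C\prod_{j=1}^m\Big(\int_{B^{+}_{((X_j)_{p_j})^*}}\big\langle |x_j|^{p_j},x_j^*\big\rangle^{q_j/p_j}\,d\nu_j(x_j^* )\Big)^{1/q_j}.$$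
   Context: A Banach lattice $X$ is $p$-convex with constant $1$ if $\|(\sum_{k=1}^n|x_k|^p)^{1/p}\|_X\le(\sum_{k=1}^n\|x_k\|_X^p)^{1/p}$ for all finite sequences in $X$ (expressions such as $(\sum|x_k|^p)^{1/p}$ are defined by the Krivine functional calculus). For such $X$, the $p$-concavification $X_p$ is the Banach lattice whose underlying ordered set is that of $X$, with addition $x\oplus y=(x^p+y^p)^{1/p}$ and scalar multiplication $a\odot x=a^{1/p}x$ (signed powers, via functional calculus), and with norm $x\mapsto\|x\|_X^p$. For $x\in X$, $|x|^p$ denotes $|x|$ regarded as a (positive) element of $X_p$. If $X$ is a Banach function lattice on a measure space with measure $\mu$, then $X_p=\{f\in L^0(\mu):|f|^{1/p}\in X\}$ with $\|f\|_{X_p}=\||f|^{1/p}\|_X^p$, and $|x|^p$ is the pointwise power. $B^{+}_{(X_p)^*}$ is the set of positive functionals in the closed unit ball of the dual $(X_p)^*$, with the weak$^*$ topology. Let $1/r_j=1/p_j-1/q_j$ (with $r_j=\infty$ if $p_j=q_j$). A multilinear operator $T\colon X_1\times\cdots\times X_m\to Y$ is $(p_1,\ldots,p_m)$-strongly $(q_1,\ldots,q_m)$-concave if there is $C>0$ such that for every $n$ and all finite sequences $(x_k^j)_{k=1}^n$ in $X_j$, $1\le j\le m$, $$\Big(\sum_{k=1}^n\|T(x_k^1,\ldots,x_k^m)\|_Y^q\Big)^{1/q}\le C\prod_{j=1}^m\ \sup_{(\beta_k^j)\in B_{r_j}^n}\Big\|\Big(\sum_{k=1}^n|\beta_k^jx_k^j|^{p_j}\Big)^{1/p_j}\Big\|_{X_j},$$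 where $1/q=1/q_1+\cdots+1/q_m$ and $B_r^n$ is the closed unit ball of $\ell_r^n=(\mathbb R^n,\|\cdot\|_r)$. *)

theory Defs
  imports
    "HOL-Analysis.Analysis"
    "HOL-Probability.Probability_Measure"
    "HOL-Algebra.Lattice"
begin

section \<open>Banach lattices with explicit carriers\<close>

text \<open>Carriers are explicit because the results concern finite families of different Banach
  lattices, indexed by a number, and because the concavification equips one and the same ordered
  set with new linear operations and a new norm.\<close>

record 'a normed_lattice = "'a gorder" +
  vzero :: 'a (\<open>\<zero>\<index>\<close>)
  vadd :: "'a \<Rightarrow> 'a \<Rightarrow> 'a" (infixl \<open>\<oplus>\<index>\<close> 65)
  vscale :: "real \<Rightarrow> 'a \<Rightarrow> 'a" (infixr \<open>\<odot>\<index>\<close> 75)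
  vnorm :: "'a \<Rightarrow> real"

definition vabs :: "'a normed_lattice \<Rightarrow> 'a \<Rightarrow> 'a"
  where "vabs X x = x \<squnion>\<^bsub>X\<^esub> ((-1) \<odot>\<^bsub>X\<^esub> x)"

locale vector_lattice = lattice X for X :: "'a normed_lattice" (structure) +
  assumes zero_closed: "\<zero> \<in> carrier X"
    and add_closed: "\<lbrakk>x \<in> carrier X; y \<in> carrier X\<rbrakk> \<Longrightarrow> x \<oplus> y \<in> carrier X"
    and scale_closed: "x \<in> carrier X \<Longrightarrow> a \<odot> x \<in> carrier X"
    and add_assoc: "\<lbrakk>x \<in> carrier X; y \<in> carrier X; z \<in> carrier X\<rbrakk> \<Longrightarrow> (x \<oplus> y) \<oplus> z = x \<oplus> (y \<oplus> z)"
    and add_commute: "\<lbrakk>x \<in> carrier X; y \<in> carrier X\<rbrakk> \<Longrightarrow> x \<oplus> y = y \<oplus> x"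
    and add_zero: "x \<in> carrier X \<Longrightarrow> x \<oplus> \<zero> = x"
    and add_neg: "x \<in> carrier X \<Longrightarrow> x \<oplus> ((-1) \<odot> x) = \<zero>"
    and scale_add_right: "\<lbrakk>x \<in> carrier X; y \<in> carrier X\<rbrakk> \<Longrightarrow> a \<odot> (x \<oplus> y) = (a \<odot> x) \<oplus> (a \<odot> y)"
    and scale_add_left: "x \<in> carrier X \<Longrightarrow> (a + b) \<odot> x = (a \<odot> x) \<oplus> (b \<odot> x)"
    and scale_scale: "x \<in> carrier X \<Longrightarrow> a \<odot> (b \<odot> x) = (a * b) \<odot> x"
    and scale_one: "x \<in> carrier X \<Longrightarrow> 1 \<odot> x = x"
    and add_mono: "\<lbrakk>x \<sqsubseteq> y; x \<in> carrier X; y \<in> carrier X; z \<in> carrier X\<rbrakk> \<Longrightarrow> x \<oplus> z \<sqsubseteq> y \<oplus> z"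
    and scale_nonneg: "\<lbrakk>0 \<le> a; \<zero> \<sqsubseteq> x; x \<in> carrier X\<rbrakk> \<Longrightarrow> \<zero> \<sqsubseteq> a \<odot> x"

locale banach_lattice = vector_lattice +
  assumes norm_nonneg: "x \<in> carrier X \<Longrightarrow> 0 \<le> vnorm X x"
    and norm_eq_zero: "x \<in> carrier X \<Longrightarrow> vnorm X x = 0 \<longleftrightarrow> x = \<zero>"
    and norm_scale: "x \<in> carrier X \<Longrightarrow> vnorm X (a \<odot> x) = \<bar>a\<bar> * vnorm X x"
    and norm_triangle: "\<lbrakk>x \<in> carrier X; y \<in> carrier X\<rbrakk> \<Longrightarrow> vnorm X (x \<oplus> y) \<le> vnorm X x + vnorm X y"
    and norm_lattice: "\<lbrakk>vabs X x \<sqsubseteq> vabs X y; x \<in> carrier X; y \<in> carrier X\<rbrakk> \<Longrightarrow> vnorm X x \<le> vnorm X y"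
    and norm_complete:
      "\<lbrakk>\<And>n. s n \<in> carrier X;
        \<forall>e>0. \<exists>N. \<forall>k\<ge>N. \<forall>l\<ge>N. vnorm X (s k \<oplus> ((-1) \<odot> s l)) < e\<rbrakk>
       \<Longrightarrow> \<exists>x\<in>carrier X. (\<lambda>n. vnorm X (s n \<oplus> ((-1) \<odot> x))) \<longlonglongrightarrow> 0"


section \<open>Krivine functional calculus\<close>

text \<open>A function of $n$ real variables is represented as a function on real sequences that depends
  only on the entries with index in \<open>{1..n}\<close>; for such functions continuity with respect to the
  product topology on sequences is continuity on $\mathbb{R}^n$.\<close>

definition homogeneous_cont :: "nat \<Rightarrow> ((nat \<Rightarrow> real) \<Rightarrow> real) set"
  where "homogeneous_cont n =
    {h. continuous_on UNIV h
      \<and> (\<forall>s t. (\<forall>i\<in>{1..n}. s i = t i) \<longrightarrow> h s = h t)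
      \<and> (\<forall>c\<ge>0. \<forall>t. h (\<lambda>i. c * t i) = c * h t)}"

definition krivine_hom ::
    "'a normed_lattice \<Rightarrow> nat \<Rightarrow> (nat \<Rightarrow> 'a) \<Rightarrow> (((nat \<Rightarrow> real) \<Rightarrow> real) \<Rightarrow> 'a) \<Rightarrow> bool"
  where "krivine_hom X n x \<tau> \<longleftrightarrow>
      (\<forall>h\<in>homogeneous_cont n. \<tau> h \<in> carrier X)
    \<and> (\<forall>g\<in>homogeneous_cont n. \<forall>h\<in>homogeneous_cont n. \<tau> (\<lambda>t. g t + h t) = \<tau> g \<oplus>\<^bsub>X\<^esub> \<tau> h)
    \<and> (\<forall>h\<in>homogeneous_cont n. \<forall>a. \<tau> (\<lambda>t. a * h t) = a \<odot>\<^bsub>X\<^esub> \<tau> h)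
    \<and> (\<forall>g\<in>homogeneous_cont n. \<forall>h\<in>homogeneous_cont n. \<tau> (\<lambda>t. max (g t) (h t)) = \<tau> g \<squnion>\<^bsub>X\<^esub> \<tau> h)
    \<and> (\<forall>g\<in>homogeneous_cont n. \<forall>h\<in>homogeneous_cont n. \<tau> (\<lambda>t. min (g t) (h t)) = \<tau> g \<sqinter>\<^bsub>X\<^esub> \<tau> h)
    \<and> (\<forall>i\<in>{1..n}. \<tau> (\<lambda>t. t i) = x i)"

text \<open>In a Banach lattice such a lattice homomorphism exists for all $x_1,\ldots,x_n$, and any two
  of them agree on \<open>homogeneous_cont n\<close>. They may differ outside this set, so the description
  operator below ranges over the value $h(x_1,\ldots,x_n)$ and not over the homomorphism.\<close>

definition krivine :: "'a normed_lattice \<Rightarrow> nat \<Rightarrow> (nat \<Rightarrow> 'a) \<Rightarrow> ((nat \<Rightarrow> real) \<Rightarrow> real) \<Rightarrow> 'a"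
  where "krivine X n x h = (THE y. \<exists>\<tau>. krivine_hom X n x \<tau> \<and> y = \<tau> h)"

definition power_mean :: "nat \<Rightarrow> real \<Rightarrow> (nat \<Rightarrow> real) \<Rightarrow> real"
  where "power_mean n p t = (\<Sum>k=1..n. \<bar>t k\<bar> powr p) powr (1 / p)"

text \<open>$(\sum_{k=1}^n |x_k|^p)^{1/p}$ in a Banach lattice.\<close>

definition lattice_power_mean :: "'a normed_lattice \<Rightarrow> nat \<Rightarrow> real \<Rightarrow> (nat \<Rightarrow> 'a) \<Rightarrow> 'a"
  where "lattice_power_mean X n p x = krivine X n x (power_mean n p)"

definition p_convex1 :: "'a normed_lattice \<Rightarrow> real \<Rightarrow> bool"
  where "p_convex1 X p \<longleftrightarrow>
    (\<forall>n\<ge>1. \<forall>x\<in>{1..n} \<rightarrow> carrier X.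
      vnorm X (lattice_power_mean X n p x) \<le> (\<Sum>k=1..n. vnorm X (x k) powr p) powr (1 / p))"


section \<open>The concavification\<close>

definition signed_powr :: "real \<Rightarrow> real \<Rightarrow> real"
  where "signed_powr a s = sgn a * \<bar>a\<bar> powr s"

definition concavification :: "'a normed_lattice \<Rightarrow> real \<Rightarrow> 'a normed_lattice"
  where "concavification X p = X
    \<lparr> vadd := (\<lambda>x y. krivine X 2 (\<lambda>i. if i = 1 then x else y)
        (\<lambda>t. signed_powr (signed_powr (t 1) p + signed_powr (t 2) p) (1 / p))),
      vscale := (\<lambda>a x. signed_powr a (1 / p) \<odot>\<^bsub>X\<^esub> x),
      vnorm := (\<lambda>x. vnorm X x powr p) \<rparr>"


section \<open>The dual and its weak-star topology\<close>

text \<open>Functionals are extensional functions on the carrier, so that they are determined by their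
  values there and the weak-star topology is inherited from the product topology.\<close>

definition dual_space :: "'a normed_lattice \<Rightarrow> ('a \<Rightarrow> real) set"
  where "dual_space X = {\<phi> \<in> extensional (carrier X).
      (\<forall>x\<in>carrier X. \<forall>y\<in>carrier X. \<phi> (x \<oplus>\<^bsub>X\<^esub> y) = \<phi> x + \<phi> y)
    \<and> (\<forall>a. \<forall>x\<in>carrier X. \<phi> (a \<odot>\<^bsub>X\<^esub> x) = a * \<phi> x)
    \<and> (\<exists>c. \<forall>x\<in>carrier X. \<bar>\<phi> x\<bar> \<le> c * vnorm X x)}"

definition dual_norm :: "'a normed_lattice \<Rightarrow> ('a \<Rightarrow> real) \<Rightarrow> real"
  where "dual_norm X \<phi> = (SUP x\<in>{x \<in> carrier X. vnorm X x \<le> 1}. \<bar>\<phi> x\<bar>)"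

definition weak_star_topology :: "'a normed_lattice \<Rightarrow> ('a \<Rightarrow> real) topology"
  where "weak_star_topology X = subtopology (powertop_real (carrier X)) (dual_space X)"

definition positive_dual_ball :: "'a normed_lattice \<Rightarrow> ('a \<Rightarrow> real) set"
  where "positive_dual_ball X = {\<phi> \<in> dual_space X. dual_norm X \<phi> \<le> 1
    \<and> (\<forall>x\<in>carrier X. \<zero>\<^bsub>X\<^esub> \<sqsubseteq>\<^bsub>X\<^esub> x \<longrightarrow> 0 \<le> \<phi> x)}"

definition regular_borel_prob :: "'c topology \<Rightarrow> 'c measure \<Rightarrow> bool"
  where "regular_borel_prob K \<nu> \<longleftrightarrow>
      prob_space \<nu>
    \<and> space \<nu> = topspace K
    \<and> sets \<nu> = sigma_sets (topspace K) {U. openin K U}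
    \<and> (\<forall>A\<in>sets \<nu>.
          emeasure \<nu> A = (INF U\<in>{U. openin K U \<and> A \<subseteq> U}. emeasure \<nu> U)
        \<and> emeasure \<nu> A = (SUP C\<in>{C. compactin K C \<and> C \<subseteq> A}. emeasure \<nu> C))"


section \<open>Multilinear operators and strong concavity\<close>

definition multilinear_op ::
    "nat \<Rightarrow> (nat \<Rightarrow> 'a normed_lattice) \<Rightarrow> ((nat \<Rightarrow> 'a) \<Rightarrow> 'b::real_vector) \<Rightarrow> bool"
  where "multilinear_op m X T \<longleftrightarrow>
    (\<forall>x \<in> (\<Pi>\<^sub>E j\<in>{1..m}. carrier (X j)). \<forall>j\<in>{1..m}.
        (\<forall>y\<in>carrier (X j). \<forall>z\<in>carrier (X j).
          T (x(j := y \<oplus>\<^bsub>X j\<^esub> z)) = T (x(j := y)) + T (x(j := z)))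
      \<and> (\<forall>a. \<forall>y\<in>carrier (X j). T (x(j := a \<odot>\<^bsub>X j\<^esub> y)) = a *\<^sub>R T (x(j := y))))"

text \<open>In \<^typ>\<open>ereal\<close>, $1/0 = \infty$, so the exponent below is infinite for $p = q$.\<close>

definition gap_exponent :: "real \<Rightarrow> real \<Rightarrow> ereal"
  where "gap_exponent p q = 1 / ereal (1 / p - 1 / q)"

definition lr_norm :: "nat \<Rightarrow> ereal \<Rightarrow> (nat \<Rightarrow> real) \<Rightarrow> real"
  where "lr_norm n r \<beta> =
    (if r = \<infinity> then Max ((\<lambda>k. \<bar>\<beta> k\<bar>) ` {1..n}) else power_mean n (real_of_ereal r) \<beta>)"

definition lr_ball :: "nat \<Rightarrow> ereal \<Rightarrow> (nat \<Rightarrow> real) set"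
  where "lr_ball n r = {\<beta> \<in> extensional {1..n}. lr_norm n r \<beta> \<le> 1}"

text \<open>Here \<open>x j k\<close> is the $k$-th member of the sequence chosen in the $j$-th lattice.\<close>

definition strongly_concave ::
    "nat \<Rightarrow> (nat \<Rightarrow> real) \<Rightarrow> (nat \<Rightarrow> real) \<Rightarrow> (nat \<Rightarrow> 'a normed_lattice) \<Rightarrow>
      ((nat \<Rightarrow> 'a) \<Rightarrow> 'b::real_normed_vector) \<Rightarrow> bool"
  where "strongly_concave m p q X T \<longleftrightarrow>
    (let Q = 1 / (\<Sum>j=1..m. 1 / q j) in
      \<exists>C>0. \<forall>n\<ge>1. \<forall>x. (\<forall>j\<in>{1..m}. \<forall>k\<in>{1..n}. x j k \<in> carrier (X j)) \<longrightarrow>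
        (\<Sum>k=1..n. norm (T (\<lambda>j\<in>{1..m}. x j k)) powr Q) powr (1 / Q)
        \<le> C * (\<Prod>j=1..m. SUP \<beta>\<in>lr_ball n (gap_exponent (p j) (q j)).
                 vnorm (X j) (lattice_power_mean (X j) n (p j) (\<lambda>k. \<beta> k \<odot>\<^bsub>X j\<^esub> x j k))))"

end

theory Submission
  imports Defs
begin

text \<open>Weighted AM--GM turns strong concavity into the statement that each function
  $\sum_k \bigl(\|T(x_k)\|^q - C^q\sum_j \frac{q}{q_j}\langle|x_k^j|^{p_j},\cdot\rangle^{q_j/p_j}\bigr)$
  on the product of the dual balls has infimum at most $0$: the supremum over $\beta$ is, by
  $\ell_{r/p}$--$\ell_{q/p}$ duality and Hahn--Banach in the concavification, the supremum of
  $\sum_k\langle|x_k|^p,\cdot\rangle^{q/p}$ over the dual ball. These functions form a convex cone, so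
  Hahn--Banach on the space of all bounded functions gives a positive normalized functional that is
  nonpositive on the cone. It is evaluated on indicators of closed sets, and the finitely additive
  set function on each factor so obtained is replaced by a regular Borel measure with at least as
  large integrals of nonnegative continuous functions. Rescaling the variables turns the resulting
  sum into a product. The converse is Hoelder's inequality.

  Identities and inequalities in a Banach lattice are checked through real lattice homomorphisms on
  principal ideals. These separate points because the gauge of a principal ideal preserves binary
  suprema, and a minimal sublinear functional with this property is a lattice homomorphism.\<close>

section \<open>Dominated extension of linear functionals\<close>

text \<open>The separating functional acts on all bounded functions on the product of the balls, not
  only on continuous ones, so it has a value on indicators of closed sets at once. The price is that
  it is merely finitely additive: it may give a closed set less weight than it gives to every
  neighbourhood. The regularized measures therefore only dominate it, which suffices because the
  integrals stand on the larger side of the estimate. The suprema in the definition of strong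
  concavity need not be attained: each defect function comes below every positive number somewhere,
  and this is all that separation asks for. No minimax theorem and no topology on the product
  enters. The norming functionals must be positive as well as bounded; both properties come from one
  majorant, the p-th power of the norm of the positive part. Its subadditivity for the concavified
  addition is exactly where p-convexity with constant one is spent.\<close>

lemma cINF_add_le:
  fixes a :: "'i \<Rightarrow> real" and b :: "'j \<Rightarrow> real" and c :: "'k \<Rightarrow> real"
  assumes "I \<noteq> {}" "J \<noteq> {}" "bdd_below (c ` K)"
    and dom: "\<And>i j. i \<in> I \<Longrightarrow> j \<in> J \<Longrightarrow> \<exists>k\<in>K. c k \<le> a i + b j"
  shows "(INF k\<in>K. c k) \<le> (INF i\<in>I. a i) + (INF j\<in>J. b j)"
proof -
  have *: "(INF k\<in>K. c k) \<le> a i + b j" if "i \<in> I" "j \<in> J" for i j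
    using dom[OF that] cINF_lower[OF assms(3)] by (meson order_trans)
  have "(INF k\<in>K. c k) - b j \<le> (INF i\<in>I. a i)" if "j \<in> J" for j
    using * that by (intro cINF_greatest assms(1)) (simp add: algebra_simps)
  then have "(INF k\<in>K. c k) - (INF i\<in>I. a i) \<le> (INF j\<in>J. b j)"
    by (intro cINF_greatest assms(2)) (simp add: algebra_simps)
  then show ?thesis by simp
qed

text \<open>Near-minimizers of the two families sit at different indices; directedness replaces them
  by one index that is good for both, which is what an infimum needs in order to pass through a
  maximum.\<close>

lemma cINF_max_directed:
  fixes a b :: "'i \<Rightarrow> real"
  assumes "I \<noteq> {}" "bdd_below (a ` I)" "bdd_below (b ` I)"
    and dir: "\<And>i j. i \<in> I \<Longrightarrow> j \<in> I \<Longrightarrow> \<exists>k\<in>I. a k \<le> a i \<and> b k \<le> b j"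
  shows "(INF i\<in>I. max (a i) (b i)) = max (INF i\<in>I. a i) (INF i\<in>I. b i)"
proof (rule antisym)
  show "max (INF i\<in>I. a i) (INF i\<in>I. b i) \<le> (INF i\<in>I. max (a i) (b i))"
    using assms by (intro cINF_greatest max.mono cINF_lower) auto
  have bdd: "bdd_below ((\<lambda>i. max (a i) (b i)) ` I)"
    using assms(2) by (auto simp: bdd_below_def le_max_iff_disj)
  show "(INF i\<in>I. max (a i) (b i)) \<le> max (INF i\<in>I. a i) (INF i\<in>I. b i)"
  proof (rule field_le_epsilon)
    fix e :: real assume "0 < e"
    obtain i where i: "i \<in> I" "a i < (INF i\<in>I. a i) + e"
      using cInf_lessD[of "a ` I" "(INF i\<in>I. a i) + e"] assms(1) \<open>0 < e\<close> by auto
    obtain j where j: "j \<in> I" "b j < (INF i\<in>I. b i) + e"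
      using cInf_lessD[of "b ` I" "(INF i\<in>I. b i) + e"] assms(1) \<open>0 < e\<close> by auto
    obtain k where k: "k \<in> I" "a k \<le> a i" "b k \<le> b j" using dir i(1) j(1) by blast
    have "(INF i\<in>I. max (a i) (b i)) \<le> max (a k) (b k)" by (rule cINF_lower[OF bdd k(1)])
    also have "\<dots> \<le> max (INF i\<in>I. a i) (INF i\<in>I. b i) + e" using i j k by linarith
    finally show "(INF i\<in>I. max (a i) (b i)) \<le> max (INF i\<in>I. a i) (INF i\<in>I. b i) + e" .
  qed
qed

text \<open>Operations are parameters and the carrier is a set, so that one extension theorem serves
  the space of bounded functions, a principal ideal, and a concavification, whose addition differs
  from that of the lattice it lives on.\<close>

locale real_vspace =
  fixes V :: "'v set" and add :: "'v \<Rightarrow> 'v \<Rightarrow> 'v" (infixl \<open>\<boxplus>\<close> 65)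
    and scale :: "real \<Rightarrow> 'v \<Rightarrow> 'v" (infixr \<open>\<bullet>\<^sub>s\<close> 75) and zero :: 'v
  assumes zero_in: "zero \<in> V"
    and add_in: "\<lbrakk>x \<in> V; y \<in> V\<rbrakk> \<Longrightarrow> x \<boxplus> y \<in> V"
    and scale_in: "x \<in> V \<Longrightarrow> a \<bullet>\<^sub>s x \<in> V"
    and v_assoc: "\<lbrakk>x \<in> V; y \<in> V; z \<in> V\<rbrakk> \<Longrightarrow> (x \<boxplus> y) \<boxplus> z = x \<boxplus> (y \<boxplus> z)"
    and v_commute: "\<lbrakk>x \<in> V; y \<in> V\<rbrakk> \<Longrightarrow> x \<boxplus> y = y \<boxplus> x"
    and v_zero: "x \<in> V \<Longrightarrow> x \<boxplus> zero = x"
    and v_neg: "x \<in> V \<Longrightarrow> x \<boxplus> (-1) \<bullet>\<^sub>s x = zero"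
    and v_distrib_right: "\<lbrakk>x \<in> V; y \<in> V\<rbrakk> \<Longrightarrow> a \<bullet>\<^sub>s (x \<boxplus> y) = a \<bullet>\<^sub>s x \<boxplus> a \<bullet>\<^sub>s y"
    and v_distrib_left: "x \<in> V \<Longrightarrow> (a + b) \<bullet>\<^sub>s x = a \<bullet>\<^sub>s x \<boxplus> b \<bullet>\<^sub>s x"
    and v_scale: "x \<in> V \<Longrightarrow> a \<bullet>\<^sub>s b \<bullet>\<^sub>s x = (a * b) \<bullet>\<^sub>s x"
    and v_one: "x \<in> V \<Longrightarrow> 1 \<bullet>\<^sub>s x = x"
begin

definition sublin :: "('v \<Rightarrow> real) \<Rightarrow> bool" where
  "sublin q \<longleftrightarrow> (\<forall>x\<in>V. \<forall>y\<in>V. q (x \<boxplus> y) \<le> q x + q y) \<and> (\<forall>c\<ge>0. \<forall>x\<in>V. q (c \<bullet>\<^sub>s x) = c * q x)"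

definition linear_on_V :: "('v \<Rightarrow> real) \<Rightarrow> bool" where
  "linear_on_V L \<longleftrightarrow> (\<forall>x\<in>V. \<forall>y\<in>V. L (x \<boxplus> y) = L x + L y) \<and> (\<forall>c. \<forall>x\<in>V. L (c \<bullet>\<^sub>s x) = c * L x)"

lemma scale_0: "x \<in> V \<Longrightarrow> 0 \<bullet>\<^sub>s x = zero"
  using v_distrib_left[of x 1 "-1"] v_neg v_one by simp

lemma scale_zero: "a \<bullet>\<^sub>s zero = zero"
  using scale_0[OF zero_in] v_scale[OF zero_in, of a 0] by simp

lemma zero_left: "x \<in> V \<Longrightarrow> zero \<boxplus> x = x"
  using v_commute v_zero zero_in by simp

lemma add_cancel_right: "\<lbrakk>x \<in> V; y \<in> V\<rbrakk> \<Longrightarrow> (x \<boxplus> y) \<boxplus> (-1) \<bullet>\<^sub>s y = x"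
  by (simp add: v_assoc scale_in v_neg v_zero)

lemma add_add_add_comm:
  "\<lbrakk>x \<in> V; y \<in> V; u \<in> V; v \<in> V\<rbrakk> \<Longrightarrow> (x \<boxplus> u) \<boxplus> (y \<boxplus> v) = (x \<boxplus> y) \<boxplus> (u \<boxplus> v)"
proof -
  assume V: "x \<in> V" "y \<in> V" "u \<in> V" "v \<in> V"
  have "u \<boxplus> (y \<boxplus> v) = y \<boxplus> (u \<boxplus> v)" using V v_assoc v_commute by metis
  then show ?thesis using V by (simp add: v_assoc add_in)
qed

lemma sublin_zero: "sublin q \<Longrightarrow> q zero = 0"
  unfolding sublin_def using scale_0[OF zero_in] zero_in by (metis mult_zero_left order_refl)

text \<open>Applying the inequality with factor 1/c to the vector scaled by c gives the reverse
  inequality, so one direction of positive homogeneity is enough.\<close>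

lemma sublinI:
  assumes "\<And>x y. x \<in> V \<Longrightarrow> y \<in> V \<Longrightarrow> q (x \<boxplus> y) \<le> q x + q y" and q0: "q zero = 0"
    and le: "\<And>c x. 0 < c \<Longrightarrow> x \<in> V \<Longrightarrow> q (c \<bullet>\<^sub>s x) \<le> c * q x"
  shows "sublin q"
  unfolding sublin_def
proof (intro conjI ballI allI impI)
  fix c :: real and x assume c: "0 \<le> c" and x: "x \<in> V"
  show "q (c \<bullet>\<^sub>s x) = c * q x"
  proof (cases "c = 0")
    case True then show ?thesis using x q0 by (simp add: scale_0)
  next
    case False
    with c have c: "0 < c" by simp
    have "q ((1 / c) \<bullet>\<^sub>s c \<bullet>\<^sub>s x) \<le> (1 / c) * q (c \<bullet>\<^sub>s x)" using c x by (intro le scale_in) auto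
    then have "c * q x \<le> q (c \<bullet>\<^sub>s x)" using c x by (simp add: v_scale v_one field_simps)
    with le[OF c x] show ?thesis by simp
  qed
qed (rule assms(1))

text \<open>For sublinear q this pushes the value at -u down to -q u, the lowest value that a
  sublinear functional below q can take there. A linear functional below the tilt must agree with q
  at u.\<close>

definition tilt :: "('v \<Rightarrow> real) \<Rightarrow> 'v \<Rightarrow> 'v \<Rightarrow> real" where
  "tilt q u x = (INF t\<in>{0..}. q (x \<boxplus> t \<bullet>\<^sub>s u) - t * q u)"

context
  fixes q u assumes q: "sublin q" and u: "u \<in> V"
begin

lemma sublin_add: "x \<in> V \<Longrightarrow> y \<in> V \<Longrightarrow> q (x \<boxplus> y) \<le> q x + q y"
  and sublin_scale: "0 \<le> c \<Longrightarrow> x \<in> V \<Longrightarrow> q (c \<bullet>\<^sub>s x) = c * q x"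
  using q unfolding sublin_def by auto

text \<open>Subadditivity at t u = (x + t u) - x bounds all terms of the infimum from below by a
  number free of t; a real infimum is meaningful only with such a bound.\<close>

lemma tilt_lower:
  assumes "x \<in> V" "0 \<le> t" shows "- q ((-1) \<bullet>\<^sub>s x) \<le> q (x \<boxplus> t \<bullet>\<^sub>s u) - t * q u"
proof -
  have "t \<bullet>\<^sub>s u = (x \<boxplus> t \<bullet>\<^sub>s u) \<boxplus> (-1) \<bullet>\<^sub>s x"
    using assms u by (metis add_cancel_right scale_in v_commute)
  then have "t * q u \<le> q (x \<boxplus> t \<bullet>\<^sub>s u) + q ((-1) \<bullet>\<^sub>s x)"
    using sublin_add[of "x \<boxplus> t \<bullet>\<^sub>s u" "(-1) \<bullet>\<^sub>s x"] assms u sublin_scale by (simp add: add_in scale_in)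
  then show ?thesis by simp
qed

lemma tilt_bdd: "x \<in> V \<Longrightarrow> bdd_below ((\<lambda>t. q (x \<boxplus> t \<bullet>\<^sub>s u) - t * q u) ` {0..})"
  using tilt_lower by (intro bdd_belowI[of _ "- q ((-1) \<bullet>\<^sub>s x)"]) auto

lemma tilt_le_term: "x \<in> V \<Longrightarrow> 0 \<le> t \<Longrightarrow> tilt q u x \<le> q (x \<boxplus> t \<bullet>\<^sub>s u) - t * q u"
  unfolding tilt_def by (rule cINF_lower[OF tilt_bdd]) auto

lemma tilt_le: "x \<in> V \<Longrightarrow> tilt q u x \<le> q x"
  using tilt_le_term[of x 0] u by (simp add: scale_0 v_zero)

lemma tilt_neg: "tilt q u ((-1) \<bullet>\<^sub>s u) \<le> - q u"
proof -
  have "(-1) \<bullet>\<^sub>s u \<boxplus> 1 \<bullet>\<^sub>s u = zero" using u by (metis scale_in v_commute v_neg v_one)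
  then show ?thesis
    using tilt_le_term[of "(-1) \<bullet>\<^sub>s u" 1] u by (simp add: scale_in sublin_zero[OF q])
qed

text \<open>Monotonicity in the parameter makes the family of terms directed: the larger of two
  parameters serves both, which is how a maximum gets through the infimum.\<close>

lemma tilt_decreasing:
  assumes "x \<in> V" "0 \<le> s" "s \<le> t"
  shows "q (x \<boxplus> t \<bullet>\<^sub>s u) - t * q u \<le> q (x \<boxplus> s \<bullet>\<^sub>s u) - s * q u"
proof -
  have "x \<boxplus> t \<bullet>\<^sub>s u = (x \<boxplus> s \<bullet>\<^sub>s u) \<boxplus> (t - s) \<bullet>\<^sub>s u"
    using assms u v_distrib_left[of u s "t - s"] by (simp add: v_assoc scale_in)
  then have "q (x \<boxplus> t \<bullet>\<^sub>s u) \<le> q (x \<boxplus> s \<bullet>\<^sub>s u) + (t - s) * q u"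
    using sublin_add[of "x \<boxplus> s \<bullet>\<^sub>s u" "(t - s) \<bullet>\<^sub>s u"] sublin_scale[of "t - s" u] assms u
    by (simp add: add_in scale_in)
  then show ?thesis by (simp add: algebra_simps)
qed

lemma tilt_sublin: "sublin (tilt q u)"
proof (rule sublinI)
  fix x y assume x: "x \<in> V" and y: "y \<in> V"
  show "tilt q u (x \<boxplus> y) \<le> tilt q u x + tilt q u y"
    unfolding tilt_def
  proof (rule cINF_add_le)
    fix t s :: real assume ts: "t \<in> {0..}" "s \<in> {0..}"
    have "(x \<boxplus> y) \<boxplus> (t + s) \<bullet>\<^sub>s u = (x \<boxplus> t \<bullet>\<^sub>s u) \<boxplus> (y \<boxplus> s \<bullet>\<^sub>s u)"
      using x y u by (simp add: v_distrib_left add_add_add_comm scale_in)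
    then have "q ((x \<boxplus> y) \<boxplus> (t + s) \<bullet>\<^sub>s u) \<le> q (x \<boxplus> t \<bullet>\<^sub>s u) + q (y \<boxplus> s \<bullet>\<^sub>s u)"
      using sublin_add x y u by (simp add: add_in scale_in)
    then show "\<exists>k\<in>{0..}. q (x \<boxplus> y \<boxplus> k \<bullet>\<^sub>s u) - k * q u
        \<le> q (x \<boxplus> t \<bullet>\<^sub>s u) - t * q u + (q (y \<boxplus> s \<bullet>\<^sub>s u) - s * q u)"
      using ts by (intro bexI[of _ "t + s"]) (auto simp: algebra_simps)
  qed (use x y tilt_bdd add_in in auto)
next
  show "tilt q u zero = 0"
  proof (rule antisym)
    show "tilt q u zero \<le> 0" using tilt_le[OF zero_in] sublin_zero[OF q] by simp
    show "0 \<le> tilt q u zero" unfolding tilt_def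
      using tilt_lower[OF zero_in] sublin_zero[OF q]
      by (intro cINF_greatest) (auto simp: scale_zero)
  qed
next
  fix d :: real and z assume d: "0 < d" and z: "z \<in> V"
  have "tilt q u (d \<bullet>\<^sub>s z) / d \<le> tilt q u z"
    unfolding tilt_def[of q u z]
  proof (rule cINF_greatest)
    fix t :: real assume t: "t \<in> {0..}"
    have "d \<bullet>\<^sub>s z \<boxplus> (d * t) \<bullet>\<^sub>s u = d \<bullet>\<^sub>s (z \<boxplus> t \<bullet>\<^sub>s u)"
      using z u by (simp add: v_distrib_right v_scale scale_in)
    then have "q (d \<bullet>\<^sub>s z \<boxplus> (d * t) \<bullet>\<^sub>s u) = d * q (z \<boxplus> t \<bullet>\<^sub>s u)"
      using sublin_scale[of d] d z u by (simp add: add_in scale_in)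
    then have "tilt q u (d \<bullet>\<^sub>s z) \<le> d * (q (z \<boxplus> t \<bullet>\<^sub>s u) - t * q u)"
      using tilt_le_term[of "d \<bullet>\<^sub>s z" "d * t"] d z t by (simp add: scale_in algebra_simps)
    then show "tilt q u (d \<bullet>\<^sub>s z) / d \<le> q (z \<boxplus> t \<bullet>\<^sub>s u) - t * q u"
      using d by (simp add: field_simps)
  qed simp
  then show "tilt q u (d \<bullet>\<^sub>s z) \<le> d * tilt q u z" using d by (simp add: field_simps)
qed

end

text \<open>\<open>J x y z\<close> stands for $z = x \vee y$; with the empty relation the theorem below is the plain
  Hahn--Banach theorem.\<close>

definition max_rel :: "('v \<Rightarrow> 'v \<Rightarrow> 'v \<Rightarrow> bool) \<Rightarrow> bool" where
  "max_rel J \<longleftrightarrow> (\<forall>x y z. J x y z \<longrightarrow> x \<in> V \<and> y \<in> V \<and> z \<in> V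
      \<and> (\<forall>v\<in>V. J (x \<boxplus> v) (y \<boxplus> v) (z \<boxplus> v)))"

definition preserves_max :: "('v \<Rightarrow> 'v \<Rightarrow> 'v \<Rightarrow> bool) \<Rightarrow> ('v \<Rightarrow> real) \<Rightarrow> bool" where
  "preserves_max J q \<longleftrightarrow> (\<forall>x y z. J x y z \<longrightarrow> q z = max (q x) (q y))"

text \<open>The relation is invariant under translation, so q splits the maximum at every translate
  by t u before the infimum over t is taken.\<close>

lemma tilt_preserves_max:
  assumes q: "sublin q" and u: "u \<in> V" and J: "max_rel J" and pres: "preserves_max J q"
  shows "preserves_max J (tilt q u)"
  unfolding preserves_max_def
proof (intro allI impI)
  fix x y z assume xyz: "J x y z"
  then have V: "x \<in> V" "y \<in> V" "z \<in> V" using J unfolding max_rel_def by blast+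
  have "q (z \<boxplus> t \<bullet>\<^sub>s u) = max (q (x \<boxplus> t \<bullet>\<^sub>s u)) (q (y \<boxplus> t \<bullet>\<^sub>s u))" for t
    using xyz J pres u scale_in unfolding max_rel_def preserves_max_def by blast
  then have "tilt q u z = (INF t\<in>{0..}. max (q (x \<boxplus> t \<bullet>\<^sub>s u) - t * q u) (q (y \<boxplus> t \<bullet>\<^sub>s u) - t * q u))"
    unfolding tilt_def by (simp add: max_diff_distrib_left)
  also have "\<dots> = max (tilt q u x) (tilt q u y)"
    unfolding tilt_def
  proof (rule cINF_max_directed)
    fix i j :: real assume ij: "i \<in> {0..}" "j \<in> {0..}"
    show "\<exists>k\<in>{0..}. q (x \<boxplus> k \<bullet>\<^sub>s u) - k * q u \<le> q (x \<boxplus> i \<bullet>\<^sub>s u) - i * q u \<and>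
            q (y \<boxplus> k \<bullet>\<^sub>s u) - k * q u \<le> q (y \<boxplus> j \<bullet>\<^sub>s u) - j * q u"
      using ij V by (intro bexI[of _ "max i j"] conjI tilt_decreasing[OF q u]) auto
  qed (use V tilt_bdd[OF q u] in auto)
  finally show "tilt q u z = max (tilt q u x) (tilt q u y)" .
qed

lemma sublin_lower: "sublin q \<Longrightarrow> x \<in> V \<Longrightarrow> - q ((-1) \<bullet>\<^sub>s x) \<le> q x"
  using sublin_add[of q zero x "(-1) \<bullet>\<^sub>s x"] by (simp add: zero_in scale_in v_neg sublin_zero)

text \<open>A minimal sublinear functional is linear, because it cannot be tilted any further.\<close>

theorem hahn_banach:
  assumes p: "sublin p" and J: "max_rel J" and pres: "preserves_max J p" and u: "u \<in> V"
  obtains L where "linear_on_V L" "preserves_max J L" "\<And>x. x \<in> V \<Longrightarrow> L x \<le> p x" "L u = p u"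
proof -
  \<comment> \<open>Searching below the tilt rather than below p itself is what forces L u = p u at
    the end.\<close>
  define p' where "p' = tilt p u"
  \<comment> \<open>Restriction to V makes pointwise comparison antisymmetric.\<close>
  define A where "A = {q \<in> extensional V. sublin q \<and> preserves_max J q \<and> (\<forall>x\<in>V. q x \<le> p' x)}"
  \<comment> \<open>The order is reversed, so that the maximal element delivered by Zorn's lemma is
    a pointwise minimal functional.\<close>
  define P where "P = (\<lambda>(a::'v \<Rightarrow> real) b. \<forall>x\<in>V. b x \<le> a x)"
  have restr: "sublin (restrict q V) \<longleftrightarrow> sublin q" for q
    unfolding sublin_def by (auto simp: add_in scale_in)
  have restrJ: "preserves_max J (restrict q V) \<longleftrightarrow> preserves_max J q" for q
  proof -
    have "x \<in> V \<and> y \<in> V \<and> z \<in> V" if "J x y z" for x y z using J that unfolding max_rel_def by blast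
    then show ?thesis unfolding preserves_max_def by auto
  qed
  have p'A: "restrict p' V \<in> A"
    unfolding A_def using restr restrJ p'_def tilt_sublin[OF p u] tilt_preserves_max[OF p u J pres] by auto
  have "\<exists>m\<in>A. \<forall>a\<in>A. P m a \<longrightarrow> a = m"
  proof (rule predicate_Zorn)
    show "partial_order_on A (relation_of P A)"
      unfolding partial_order_on_def preorder_on_def
    proof (intro conjI)
      show "refl_on A (relation_of P A)" by (auto simp: refl_on_def relation_of_def P_def)
      show "trans (relation_of P A)" by (force simp: trans_def relation_of_def P_def)
      show "antisym (relation_of P A)"
        unfolding antisym_def relation_of_def P_def A_def
        by (auto intro!: extensionalityI[of _ V] order.antisym[of "_ :: real"])
      show "relation_of P A \<subseteq> A \<times> A" by (auto simp: relation_of_def)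
    qed
  next
    fix C assume C: "C \<in> Chains (relation_of P A)"
    have CA: "q \<in> A" if "q \<in> C" for q using C that unfolding Chains_def relation_of_def by auto
    have chain: "P a b \<or> P b a" if "a \<in> C" "b \<in> C" for a b
      using C that unfolding Chains_def relation_of_def by auto
    show "\<exists>w\<in>A. \<forall>a\<in>C. P a w"
    proof (cases "C = {}")
      case True then show ?thesis using p'A by auto
    next
      case False
      define w where "w = (\<lambda>x\<in>V. INF q\<in>C. q x)"
      have sl: "sublin q" and pm: "preserves_max J q" if "q \<in> C" for q using CA[OF that] by (auto simp: A_def)
      \<comment> \<open>A bound uniform over the chain, coming from the common majorant p', keeps
        the pointwise infimum finite.\<close>
      have lower: "- p' ((-1) \<bullet>\<^sub>s x) \<le> q x" if "q \<in> C" "x \<in> V" for q x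
      proof -
        have "q ((-1) \<bullet>\<^sub>s x) \<le> p' ((-1) \<bullet>\<^sub>s x)" using CA[OF that(1)] that(2) scale_in by (auto simp: A_def)
        then show ?thesis using sublin_lower[OF sl[OF that(1)] that(2)] by linarith
      qed
      have bdd: "bdd_below ((\<lambda>q. q x) ` C)" if "x \<in> V" for x
        using lower that by (intro bdd_belowI[of _ "- p' ((-1) \<bullet>\<^sub>s x)"]) auto
      have wle: "w x \<le> q x" if "q \<in> C" "x \<in> V" for q x
        unfolding w_def using that cINF_lower[OF bdd] by simp
      have "sublin w"
      proof (rule sublinI)
        fix x y assume xy: "x \<in> V" "y \<in> V"
        have "(INF q\<in>C. q (x \<boxplus> y)) \<le> (INF q\<in>C. q x) + (INF q\<in>C. q y)"
        proof (rule cINF_add_le[OF False False bdd])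
          fix q r assume qr: "q \<in> C" "r \<in> C"
          have "q (x \<boxplus> y) \<le> q x + q y" "r (x \<boxplus> y) \<le> r x + r y"
            using sublin_add[OF sl u] qr xy by auto
          \<comment> \<open>Of two members of the chain the smaller one serves both
            summands.\<close>
          moreover have "(q x \<le> r x \<and> q y \<le> r y) \<or> (r x \<le> q x \<and> r y \<le> q y)"
            using chain[OF qr] xy unfolding P_def by blast
          ultimately show "\<exists>k\<in>C. k (x \<boxplus> y) \<le> q x + r y"
            using qr by (smt (verit, best))
        qed (use xy add_in in auto)
        then show "w (x \<boxplus> y) \<le> w x + w y" using xy by (simp add: w_def add_in)
      next
        have "w zero = (INF q\<in>C. 0)"
          using sl sublin_zero by (auto simp: w_def zero_in intro!: INF_cong)
        then show "w zero = 0" using False by simp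
      next
        fix c :: real and x assume c: "0 < c" and x: "x \<in> V"
        have "w (c \<bullet>\<^sub>s x) / c \<le> (INF q\<in>C. q x)"
        proof (rule cINF_greatest[OF False])
          fix q assume q: "q \<in> C"
          have "w (c \<bullet>\<^sub>s x) \<le> c * q x"
            using wle[OF q, of "c \<bullet>\<^sub>s x"] sublin_scale[OF sl[OF q] u, of c x] c x by (simp add: scale_in)
          then show "w (c \<bullet>\<^sub>s x) / c \<le> q x" using c by (simp add: field_simps)
        qed
        then show "w (c \<bullet>\<^sub>s x) \<le> c * w x" using c x by (simp add: w_def field_simps)
      qed
      moreover have "preserves_max J w" unfolding preserves_max_def
      proof (intro allI impI)
        fix x y z assume xyz: "J x y z"
        then have V: "x \<in> V" "y \<in> V" "z \<in> V" using J unfolding max_rel_def by blast+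
        have "w z = (INF q\<in>C. max (q x) (q y))"
          using pm xyz V by (auto simp: w_def preserves_max_def intro!: INF_cong)
        also have "\<dots> = max (INF q\<in>C. q x) (INF q\<in>C. q y)"
        proof (rule cINF_max_directed)
          fix q r assume "q \<in> C" "r \<in> C"
          then show "\<exists>k\<in>C. k x \<le> q x \<and> k y \<le> r y"
            using chain[of q r] V unfolding P_def by blast
        qed (use False V bdd in auto)
        finally show "w z = max (w x) (w y)" using V by (simp add: w_def)
      qed
      moreover have "w x \<le> p' x" if "x \<in> V" for x
      proof -
        obtain q where "q \<in> C" using False by auto
        then show ?thesis using wle[OF _ that] CA that by (force simp: A_def)
      qed
      ultimately have "w \<in> A" by (simp add: A_def w_def)
      then show ?thesis using wle unfolding P_def by auto
    qed
  qed
  then obtain L where L: "L \<in> A" and min: "\<And>a. a \<in> A \<Longrightarrow> P L a \<Longrightarrow> a = L" by blast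
  have sl: "sublin L" and pm: "preserves_max J L" and le: "\<And>x. x \<in> V \<Longrightarrow> L x \<le> p' x"
    using L by (auto simp: A_def)
  have neg: "L ((-1) \<bullet>\<^sub>s x) = - L x" if x: "x \<in> V" for x
  proof -
    have tl: "tilt L x y \<le> p' y" if "y \<in> V" for y
      using tilt_le[OF sl x that] le[OF that] by simp
    have "restrict (tilt L x) V \<in> A"
      unfolding A_def using restr restrJ tilt_sublin[OF sl x] tilt_preserves_max[OF sl x J pm] tl by auto
    moreover have "P L (restrict (tilt L x) V)" unfolding P_def using tilt_le[OF sl x] by simp
    ultimately have "restrict (tilt L x) V = L" by (rule min)
    then have "L ((-1) \<bullet>\<^sub>s x) = tilt L x ((-1) \<bullet>\<^sub>s x)" using x scale_in by (metis restrict_apply')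
    then have "L ((-1) \<bullet>\<^sub>s x) \<le> - L x" using tilt_neg[OF sl x] by simp
    moreover have "- L x \<le> L ((-1) \<bullet>\<^sub>s x)" using sublin_lower[OF sl x] by simp
    ultimately show ?thesis by simp
  qed
  have lin: "linear_on_V L" unfolding linear_on_V_def
  proof (intro conjI ballI allI)
    fix x y assume xy: "x \<in> V" "y \<in> V"
    have "L x \<le> L (x \<boxplus> y) + L ((-1) \<bullet>\<^sub>s y)"
      using sublin_add[OF sl u, of "x \<boxplus> y" "(-1) \<bullet>\<^sub>s y"] xy by (simp add: add_in scale_in add_cancel_right)
    then show "L (x \<boxplus> y) = L x + L y" using neg[OF xy(2)] sublin_add[OF sl u xy] by simp
  next
    fix c :: real and x assume x: "x \<in> V"
    show "L (c \<bullet>\<^sub>s x) = c * L x"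
    proof (cases "0 \<le> c")
      case True then show ?thesis using sublin_scale[OF sl u] x by simp
    next
      case False
      then have "L ((- c) \<bullet>\<^sub>s (-1) \<bullet>\<^sub>s x) = - c * L ((-1) \<bullet>\<^sub>s x)"
        using sublin_scale[OF sl u, of "- c"] x by (simp add: scale_in)
      then show ?thesis using x neg by (simp add: v_scale)
    qed
  qed
  have "L u = p u"
  proof (rule antisym)
    show "L u \<le> p u" using le[OF u] tilt_le[OF p u u] by (simp add: p'_def)
    show "p u \<le> L u" using le[of "(-1) \<bullet>\<^sub>s u"] tilt_neg[OF p u] u neg[OF u] by (simp add: scale_in p'_def)
  qed
  moreover have "L x \<le> p x" if "x \<in> V" for x using le[OF that] tilt_le[OF p u that] by (simp add: p'_def)
  ultimately show ?thesis using that lin pm by blast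
qed

end

section \<open>Bounded functions and finitely additive means\<close>

definition bounded_functions :: "'z set \<Rightarrow> ('z \<Rightarrow> real) set" where
  "bounded_functions Z = {f. \<exists>B. \<forall>z\<in>Z. \<bar>f z\<bar> \<le> B}"

lemma bounded_functions_add: "f \<in> bounded_functions Z \<Longrightarrow> g \<in> bounded_functions Z \<Longrightarrow> (\<lambda>z. f z + g z) \<in> bounded_functions Z"
proof -
  assume "f \<in> bounded_functions Z" "g \<in> bounded_functions Z"
  then obtain B C where "\<forall>z\<in>Z. \<bar>f z\<bar> \<le> B" "\<forall>z\<in>Z. \<bar>g z\<bar> \<le> C" unfolding bounded_functions_def by auto
  then have "\<forall>z\<in>Z. \<bar>f z + g z\<bar> \<le> B + C" by fastforce
  then show ?thesis unfolding bounded_functions_def by blast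
qed

lemma bounded_functions_scale: "f \<in> bounded_functions Z \<Longrightarrow> (\<lambda>z. c * f z) \<in> bounded_functions Z"
proof -
  assume "f \<in> bounded_functions Z"
  then obtain B where "\<forall>z\<in>Z. \<bar>f z\<bar> \<le> B" unfolding bounded_functions_def by auto
  then have "\<forall>z\<in>Z. \<bar>c * f z\<bar> \<le> \<bar>c\<bar> * B" by (simp add: abs_mult mult_left_mono)
  then show ?thesis unfolding bounded_functions_def by blast
qed

lemma bounded_functions_const: "(\<lambda>z. c) \<in> bounded_functions Z"
  unfolding bounded_functions_def by auto

lemma real_vspace_bounded_functions:
  "real_vspace (bounded_functions Z) (\<lambda>f g z. f z + g z) (\<lambda>c f z. c * f z) (\<lambda>z. 0)"
  by standard (auto simp: bounded_functions_add bounded_functions_scale bounded_functions_const algebra_simps)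

text \<open>A finitely additive probability in functional form. It acts on every bounded function,
  measurable or not, so that it has a value on the indicator of an arbitrary set.\<close>

definition positive_mean :: "'z set \<Rightarrow> (('z \<Rightarrow> real) \<Rightarrow> real) \<Rightarrow> bool" where
  "positive_mean Z L \<longleftrightarrow>
     (\<forall>f\<in>bounded_functions Z. \<forall>g\<in>bounded_functions Z. L (\<lambda>z. f z + g z) = L f + L g)
   \<and> (\<forall>c. \<forall>f\<in>bounded_functions Z. L (\<lambda>z. c * f z) = c * L f)
   \<and> (\<forall>f\<in>bounded_functions Z. (\<forall>z\<in>Z. 0 \<le> f z) \<longrightarrow> 0 \<le> L f)
   \<and> L (\<lambda>z. 1) = 1"

text \<open>The majorant is the infimum of the constants c with g \<le> c + f for some f in the
  cone. That members of the cone are nearly nonpositive somewhere keeps this infimum finite.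
  Positivity and normalization of L follow because nonpositive functions and constants are bounded
  by means of the zero member.\<close>

lemma positive_mean_nonpositive_on_cone:
  assumes bdd: "F \<subseteq> bounded_functions Z" and zero: "(\<lambda>z. 0) \<in> F"
    and add: "\<And>f g. f \<in> F \<Longrightarrow> g \<in> F \<Longrightarrow> (\<lambda>z. f z + g z) \<in> F"
    and scale: "\<And>c f. 0 < c \<Longrightarrow> f \<in> F \<Longrightarrow> (\<lambda>z. c * f z) \<in> F"
    and small: "\<And>f e. f \<in> F \<Longrightarrow> 0 < e \<Longrightarrow> \<exists>z\<in>Z. f z \<le> e"
  obtains L where "positive_mean Z L" "\<And>f. f \<in> F \<Longrightarrow> L f \<le> 0"
proof -
  interpret B: real_vspace "bounded_functions Z" "\<lambda>f g z. f z + g z" "\<lambda>c f z. c * f z" "\<lambda>z. 0"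
    by (rule real_vspace_bounded_functions)
  define S where "S = (\<lambda>g. {c. \<exists>f\<in>F. \<forall>z\<in>Z. g z \<le> c + f z})"
  define p where "p = (\<lambda>g. Inf (S g))"
  have lower: "-b \<le> c" if gb: "\<forall>z\<in>Z. \<bar>g z\<bar> \<le> b" and cg: "c \<in> S g" for b c g
  proof (rule field_le_epsilon)
    fix e :: real assume e: "0 < e"
    obtain f where f: "f \<in> F" "\<forall>z\<in>Z. g z \<le> c + f z" using cg by (auto simp: S_def)
    \<comment> \<open>At this point f is at most e, so c cannot lie far below the value of
      g.\<close>
    obtain z where z: "z \<in> Z" "f z \<le> e" using small[OF f(1) e] by blast
    have "\<bar>g z\<bar> \<le> b" "g z \<le> c + f z" using gb f(2) z(1) by auto
    then show "-b \<le> c + e" using z(2) by linarith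
  qed
  have Sb: "bdd_below (S g)" if "g \<in> bounded_functions Z" for g
    using that lower unfolding bounded_functions_def bdd_below_def by blast
  have upper: "p g \<le> c" if "g \<in> bounded_functions Z" "f \<in> F" "\<And>z. z \<in> Z \<Longrightarrow> g z \<le> c + f z" for g c f
    unfolding p_def using that by (intro cInf_lower Sb) (auto simp: S_def)
  have ne: "S g \<noteq> {}" if g: "g \<in> bounded_functions Z" for g
  proof -
    obtain b where "\<forall>z\<in>Z. \<bar>g z\<bar> \<le> b" using g by (auto simp: bounded_functions_def)
    then have "b \<in> S g" unfolding S_def using zero by (auto intro!: bexI[of _ "\<lambda>z. 0"])
    then show ?thesis by auto
  qed
  have p0: "p (\<lambda>z. 0) = 0"
  proof (rule antisym)
    show "p (\<lambda>z. 0) \<le> 0" using zero by (intro upper) (auto simp: bounded_functions_const)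
    show "0 \<le> p (\<lambda>z. 0)" unfolding p_def
      using lower[of "\<lambda>z. 0" 0] ne by (intro cInf_greatest) (auto simp: bounded_functions_const)
  qed
  have sublin: "B.sublin p"
  proof (rule B.sublinI[where q = p, OF _ p0])
    fix g h assume gh: "g \<in> bounded_functions Z" "h \<in> bounded_functions Z"
    have "(INF c\<in>S (\<lambda>z. g z + h z). c) \<le> (INF c\<in>S g. c) + (INF c\<in>S h. c)"
    proof (rule cINF_add_le)
      fix c d assume "c \<in> S g" "d \<in> S h"
      then obtain f f' where f: "f \<in> F" "\<forall>z\<in>Z. g z \<le> c + f z" "f' \<in> F" "\<forall>z\<in>Z. h z \<le> d + f' z"
        by (auto simp: S_def)
      have "\<forall>z\<in>Z. g z + h z \<le> (c + d) + (f z + f' z)" using f by fastforce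
      then have "c + d \<in> S (\<lambda>z. g z + h z)" unfolding S_def using add[OF f(1,3)] by (auto simp: algebra_simps)
      then show "\<exists>k\<in>S (\<lambda>z. g z + h z). k \<le> c + d" by blast
    qed (use gh ne Sb[OF bounded_functions_add[OF gh]] in auto)
    then show "p (\<lambda>z. g z + h z) \<le> p g + p h" by (simp add: p_def)
  next
    fix d :: real and k assume d: "0 < d" and k: "k \<in> bounded_functions Z"
    have "p (\<lambda>z. d * k z) / d \<le> Inf (S k)"
    proof (rule cInf_greatest[OF ne[OF k]])
      fix a assume "a \<in> S k"
      then obtain f where f: "f \<in> F" "\<forall>z\<in>Z. k z \<le> a + f z" by (auto simp: S_def)
      have "p (\<lambda>z. d * k z) \<le> d * a"
      proof (rule upper)
        show "(\<lambda>z. d * f z) \<in> F" using scale d f(1) by blast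
        fix z assume "z \<in> Z"
        then have "d * k z \<le> d * (a + f z)" using f(2) d by (intro mult_left_mono) auto
        then show "d * k z \<le> d * a + d * f z" by (simp add: algebra_simps)
      qed (use bounded_functions_scale k in blast)
      then show "p (\<lambda>z. d * k z) / d \<le> a" using d by (simp add: field_simps)
    qed
    then show "p (\<lambda>z. d * k z) \<le> d * p k" using d by (simp add: p_def field_simps)
  qed
  have "B.max_rel (\<lambda>x y z. False)" "B.preserves_max (\<lambda>x y z. False) p"
    by (auto simp: B.max_rel_def B.preserves_max_def)
  from B.hahn_banach[OF sublin this bounded_functions_const[of 0]]
  obtain L where L: "B.linear_on_V L" "\<And>g. g \<in> bounded_functions Z \<Longrightarrow> L g \<le> p g"
    by blast
  have lin: "L (\<lambda>z. f z + g z) = L f + L g" "L (\<lambda>z. c * f z) = c * L f"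
    if "f \<in> bounded_functions Z" "g \<in> bounded_functions Z" for f g c
    using L(1) that unfolding B.linear_on_V_def by auto
  \<comment> \<open>A member of the cone is bounded by 0 plus itself, so the majorant is at most 0
    there.\<close>
  have nonpos: "L f \<le> 0" if "f \<in> F" for f
    using L(2)[of f] upper[of f f 0] that bdd by fastforce
  have ge: "0 \<le> L f" if f: "f \<in> bounded_functions Z" "\<forall>z\<in>Z. 0 \<le> f z" for f
  proof -
    have "L (\<lambda>z. (-1) * f z) \<le> 0"
      using f zero L(2)[of "\<lambda>z. (-1) * f z"] upper[of "\<lambda>z. (-1) * f z" "\<lambda>z. 0" 0] bounded_functions_scale[of f Z "-1"]
      by fastforce
    then show ?thesis using lin(2)[of f f "-1"] f by simp
  qed
  \<comment> \<open>The constants 1 and -1 are both estimated from above, and linearity pinches the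
    value at 1.\<close>
  have "L (\<lambda>z. 1) \<le> 1"
    using L(2)[of "\<lambda>z. 1"] upper[of "\<lambda>z. 1" "\<lambda>z. 0" 1] zero bounded_functions_const by fastforce
  moreover have "L (\<lambda>z. -1) \<le> -1"
    using L(2)[of "\<lambda>z. -1"] upper[of "\<lambda>z. -1" "\<lambda>z. 0" "-1"] zero bounded_functions_const by fastforce
  moreover have "L (\<lambda>z. -1) = - L (\<lambda>z. 1)"
    using lin(2)[OF bounded_functions_const[of 1] bounded_functions_const[of 1], of "-1"] by simp
  ultimately have "L (\<lambda>z. 1) = 1" by simp
  then have "positive_mean Z L" unfolding positive_mean_def using lin ge by blast
  then show ?thesis using that nonpos by blast
qed

section \<open>Regular measures from positive means\<close>

lemma positive_mean_add:
  "positive_mean Z L \<Longrightarrow> f \<in> bounded_functions Z \<Longrightarrow> g \<in> bounded_functions Z \<Longrightarrow> L (\<lambda>z. f z + g z) = L f + L g"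
  unfolding positive_mean_def by blast

lemma positive_mean_scale:
  "positive_mean Z L \<Longrightarrow> f \<in> bounded_functions Z \<Longrightarrow> L (\<lambda>z. c * f z) = c * L f"
  unfolding positive_mean_def by blast

lemma positive_mean_nonneg:
  "positive_mean Z L \<Longrightarrow> f \<in> bounded_functions Z \<Longrightarrow> \<forall>z\<in>Z. 0 \<le> f z \<Longrightarrow> 0 \<le> L f"
  unfolding positive_mean_def by blast

lemma positive_mean_mono:
  assumes L: "positive_mean Z L" and f: "f \<in> bounded_functions Z" and g: "g \<in> bounded_functions Z"
    and le: "\<And>z. z \<in> Z \<Longrightarrow> f z \<le> g z"
  shows "L f \<le> L g"
proof -
  have g': "(\<lambda>z. g z + (-1) * f z) \<in> bounded_functions Z"
    by (intro bounded_functions_add bounded_functions_scale f g)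
  have "0 \<le> L (\<lambda>z. g z + (-1) * f z)"
    using L g' le unfolding positive_mean_def by auto
  also have "\<dots> = L g + L (\<lambda>z. (-1) * f z)"
    by (rule positive_mean_add[OF L g bounded_functions_scale[OF f]])
  also have "L (\<lambda>z. (-1) * f z) = - L f"
    using positive_mean_scale[OF L f, of "-1"] by simp
  finally show ?thesis by simp
qed

lemma indicator_bounded: "(indicator A :: _ \<Rightarrow> real) \<in> bounded_functions Z"
  unfolding bounded_functions_def by (auto intro!: exI[of _ 1] split: split_indicator)

lemma bounded_functions_sum:
  "(\<And>i. i \<in> I \<Longrightarrow> f i \<in> bounded_functions Z) \<Longrightarrow> (\<lambda>z. \<Sum>i\<in>I. f i z) \<in> bounded_functions Z"
  by (induction I rule: infinite_finite_induct) (auto intro: bounded_functions_const bounded_functions_add)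

lemma positive_mean_zero: "positive_mean Z L \<Longrightarrow> L (\<lambda>z. 0) = 0"
  using positive_mean_scale[OF _ bounded_functions_const, of Z L 0 0] by simp

lemma positive_mean_sum:
  assumes L: "positive_mean Z L" and "\<And>i. i \<in> I \<Longrightarrow> f i \<in> bounded_functions Z"
  shows "L (\<lambda>z. \<Sum>i\<in>I. f i z) = (\<Sum>i\<in>I. L (f i))"
  using assms(2)
proof (induction I rule: infinite_finite_induct)
  case (insert i I)
  then show ?case
    using L bounded_functions_sum[of I f Z] unfolding positive_mean_def by simp
qed (simp_all add: positive_mean_zero[OF L])

text \<open>The image of a mean under a map; with a coordinate map of a product it yields the
  marginal.\<close>

lemma positive_mean_compose:
  assumes L: "positive_mean Z L" and f: "\<And>z. z \<in> Z \<Longrightarrow> f z \<in> Y"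
  shows "positive_mean Y (\<lambda>g. L (\<lambda>z. g (f z)))"
proof -
  have b: "(\<lambda>z. g (f z)) \<in> bounded_functions Z" if "g \<in> bounded_functions Y" for g
    using that f unfolding bounded_functions_def by blast
  show ?thesis
    unfolding positive_mean_def
  proof (intro conjI ballI allI impI)
    show "L (\<lambda>z. g (f z) + h (f z)) = L (\<lambda>z. g (f z)) + L (\<lambda>z. h (f z))"
      if "g \<in> bounded_functions Y" "h \<in> bounded_functions Y" for g h
      by (rule positive_mean_add[OF L b[OF that(1)] b[OF that(2)]])
    show "L (\<lambda>z. c * g (f z)) = c * L (\<lambda>z. g (f z))" if "g \<in> bounded_functions Y" for c g
      by (rule positive_mean_scale[OF L b[OF that]])
    show "0 \<le> L (\<lambda>z. g (f z))" if "g \<in> bounded_functions Y" "\<forall>z\<in>Y. 0 \<le> g z" for g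
      using that f by (intro positive_mean_nonneg[OF L b]) auto
    show "L (\<lambda>z. 1) = 1" using L unfolding positive_mean_def by blast
  qed
qed

text \<open>The sum is h * min N (floor (y / h)), the staircase below y cut off after N steps. The
  two cases are carried together because the induction passes from the first to the second when N h
  crosses y.\<close>

lemma step_sum_bounds:
  fixes h y :: real
  assumes "0 < h" "0 \<le> y"
  defines "S \<equiv> \<lambda>N. (\<Sum>i=1..N. h * of_bool (real i * h \<le> y))"
  shows "(real N * h \<le> y \<longrightarrow> S N = real N * h) \<and> (y < real N * h \<longrightarrow> S N \<le> y \<and> y - h \<le> S N)"
proof (induction N)
  case 0 then show ?case using assms by (simp add: S_def)
next
  case (Suc N)
  have S: "S (Suc N) = S N + h * of_bool (real (Suc N) * h \<le> y)" 
    unfolding S_def by (subst sum.cl_ivl_Suc) simp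
  show ?case
  proof (cases "real (Suc N) * h \<le> y")
    case True
    then have "real N * h \<le> y" using assms(1) by (simp add: algebra_simps)
    then show ?thesis using True Suc S by (simp add: algebra_simps)
  next
    case False
    then show ?thesis using Suc S by (cases "real N * h \<le> y") (auto simp: algebra_simps)
  qed
qed

lemma regular_borel_continuous_integrable:
  assumes \<nu>: "regular_borel_prob K \<nu>" and K: "compact_space K" and g: "continuous_map K euclideanreal g"
  shows "integrable \<nu> g"
proof -
  interpret prob_space \<nu> using \<nu> by (simp add: regular_borel_prob_def)
  have sp: "space \<nu> = topspace K" and st: "sets \<nu> = sigma_sets (topspace K) {U. openin K U}"
    using \<nu> by (auto simp: regular_borel_prob_def)
  have meas: "g \<in> borel_measurable \<nu>"
  proof (rule borel_measurableI)
    fix S :: "real set" assume "open S"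
    then have "openin K {x \<in> topspace K. g x \<in> S}"
      using openin_continuous_map_preimage[OF g] by auto
    moreover have "g -` S \<inter> space \<nu> = {x \<in> topspace K. g x \<in> S}" by (auto simp: sp)
    ultimately show "g -` S \<inter> space \<nu> \<in> sets \<nu>" by (simp add: st sigma_sets.Basic)
  qed
  have "compact (g ` topspace K)"
    using image_compactin[of K "topspace K" euclideanreal g] K g by (simp add: compact_space_def)
  then have "bounded (g ` topspace K)" by (rule compact_imp_bounded)
  then obtain B where "\<forall>y\<in>g ` topspace K. norm y \<le> B" unfolding bounded_iff by blast
  then show ?thesis using meas by (intro integrable_const_bound[of _ B]) (auto simp: sp)
qed

section \<open>From a mean on a compact Hausdorff space to a regular Borel measure\<close>

locale compact_mean =
  fixes K :: "'c topology" and L :: "('c \<Rightarrow> real) \<Rightarrow> real"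
  assumes cpt: "compact_space K" and haus: "Hausdorff_space K"
    and mean: "positive_mean (topspace K) L"
begin

abbreviation "\<Omega> \<equiv> topspace K"

definition content :: "'c set \<Rightarrow> real" where "content A = L (indicator A)"

lemma content_mono: "A \<inter> \<Omega> \<subseteq> B \<Longrightarrow> content A \<le> content B"
  unfolding content_def by (rule positive_mean_mono[OF mean]) (auto simp: indicator_bounded split: split_indicator)

lemma content_nonneg: "0 \<le> content A"
  using mean indicator_bounded[of A] unfolding content_def positive_mean_def by auto

lemma content_Un: "A \<inter> B = {} \<Longrightarrow> content (A \<union> B) = content A + content B"
proof -
  assume "A \<inter> B = {}"
  then have "(indicator (A \<union> B) :: 'c \<Rightarrow> real) = (\<lambda>z. indicator A z + indicator B z)"
    by (auto simp: fun_eq_iff split: split_indicator)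
  then show ?thesis using mean indicator_bounded unfolding content_def positive_mean_def by metis
qed

lemma content_Un_le: "content (A \<union> B) \<le> content A + content B"
  using content_Un[of A "B - A"] content_mono[of "B - A" B] by auto

lemma content_space: "content \<Omega> = 1"
proof -
  have "L (\<lambda>z. 1) \<le> content \<Omega>" "content \<Omega> \<le> L (\<lambda>z. 1)"
    unfolding content_def
    by (rule positive_mean_mono[OF mean]; auto simp: indicator_bounded bounded_functions_const)+
  then show ?thesis using mean by (simp add: positive_mean_def)
qed

lemma content_empty: "content {} = 0"
  using positive_mean_zero[OF mean] by (simp add: content_def indicator_def[abs_def])

text \<open>Inner values by closed sets, followed by infima over open supersets, form the Riesz
  construction applied to a finitely additive set function. Closed sets are compact here, and this
  is the source of countable subadditivity.\<close>

definition open_content :: "'c set \<Rightarrow> ennreal" where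
  "open_content U = (SUP C\<in>{C. closedin K C \<and> C \<subseteq> U}. ennreal (content C))"

lemma content_le_open: "closedin K C \<Longrightarrow> C \<subseteq> U \<Longrightarrow> ennreal (content C) \<le> open_content U"
  unfolding open_content_def by (rule SUP_upper) auto

lemma open_content_mono: "U \<subseteq> V \<Longrightarrow> open_content U \<le> open_content V"
  unfolding open_content_def by (intro SUP_subset_mono) auto

lemma open_content_empty: "open_content {} = 0"
  unfolding open_content_def by (simp add: SUP_eq_const content_empty subset_empty)

text \<open>Normality separates the closed sets C - U and C - V by disjoint open G and H. Then C - G
  lies in U, C - H lies in V, and these two closed sets cover C.\<close>

lemma open_content_Un:
  assumes U: "openin K U" and V: "openin K V"
  shows "open_content (U \<union> V) \<le> open_content U + open_content V"
  unfolding open_content_def[of "U \<union> V"]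
proof (rule SUP_least)
  fix C assume C: "C \<in> {C. closedin K C \<and> C \<subseteq> U \<union> V}"
  have "normal_space K" using cpt haus compact_Hausdorff_or_regular_imp_normal_space by blast
  moreover have "closedin K (C - U)" "closedin K (C - V)" using C U V by (auto intro: closedin_diff)
  moreover have "disjnt (C - U) (C - V)" using C by (auto simp: disjnt_def)
  ultimately obtain G H where GH: "openin K G" "openin K H" "C - U \<subseteq> G" "C - V \<subseteq> H" "disjnt G H"
    unfolding normal_space_def by meson
  have "(C - G) \<union> (C - H) = C" using GH(5) by (auto simp: disjnt_def)
  then have "content C \<le> content (C - G) + content (C - H)"
    using content_Un_le[of "C - G" "C - H"] by simp
  then have "ennreal (content C) \<le> ennreal (content (C - G)) + ennreal (content (C - H))"
    by (simp add: content_nonneg ennreal_leI flip: ennreal_plus)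
  also have "\<dots> \<le> open_content U + open_content V"
    using C GH by (intro add_mono content_le_open) (auto intro: closedin_diff)
  finally show "ennreal (content C) \<le> open_content U + open_content V" .
qed

text \<open>A closed set inside the union is compact, hence covered by finitely many U n; this is
  the passage from finite to countable subadditivity.\<close>

lemma open_content_UN:
  assumes U: "\<And>n. openin K (U n)"
  shows "open_content (\<Union>n. U n) \<le> (\<Sum>n. open_content (U (n::nat)))"
  unfolding open_content_def[of "\<Union>n. U n"]
proof (rule SUP_least)
  fix C assume C: "C \<in> {C. closedin K C \<and> C \<subseteq> (\<Union>n. U n)}"
  then have "compactin K C" using cpt closedin_compact_space by blast
  then obtain F where F: "finite F" "F \<subseteq> range U" "C \<subseteq> \<Union> F"
    using compactinD[of K C "range U"] C U by blast
  then obtain I where I: "finite I" "F = U ` I" by (meson finite_subset_image)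
  then obtain N where "I \<subseteq> {..<N}" using finite_nat_iff_bounded by auto
  then have "\<Union> F \<subseteq> (\<Union>n<N. U n)" unfolding I(2) by (intro UN_mono) auto
  then have CN: "C \<subseteq> (\<Union>n<N. U n)" using F(3) by (rule order_trans[rotated])
  have fin: "open_content (\<Union>n<M. U n) \<le> (\<Sum>n<M. open_content (U n))" for M
  proof (induction M)
    case (Suc M)
    have "(\<Union>n<Suc M. U n) = (\<Union>n<M. U n) \<union> U M" by (auto simp: lessThan_Suc)
    moreover have "openin K (\<Union>n<M. U n)" using U by auto
    ultimately show ?case using open_content_Un[of "\<Union>n<M. U n" "U M"] Suc U
      by (auto intro: order_trans[OF _ add_right_mono])
  qed (simp add: open_content_empty)
  have "ennreal (content C) \<le> open_content (\<Union>n<N. U n)" using C CN by (intro content_le_open) auto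
  also have "\<dots> \<le> (\<Sum>n<N. open_content (U n))" by (rule fin)
  also have "\<dots> \<le> (\<Sum>n. open_content (U n))" by (intro sum_le_suminf) auto
  finally show "ennreal (content C) \<le> (\<Sum>n. open_content (U n))" .
qed

definition outer :: "'c set \<Rightarrow> ennreal" where
  "outer A = (INF U\<in>{U. openin K U \<and> A \<subseteq> U}. open_content U)"

lemma outer_le: "openin K U \<Longrightarrow> A \<subseteq> U \<Longrightarrow> outer A \<le> open_content U"
  unfolding outer_def by (rule INF_lower) auto

lemma outer_open: "openin K U \<Longrightarrow> outer U = open_content U"
  unfolding outer_def by (intro antisym INF_lower INF_greatest open_content_mono) auto

lemma outer_mono: "A \<subseteq> B \<Longrightarrow> outer A \<le> outer B"
  unfolding outer_def by (intro INF_superset_mono) auto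

lemma open_content_le_1: "open_content U \<le> 1"
  unfolding open_content_def
proof (rule SUP_least)
  fix C assume "C \<in> {C. closedin K C \<and> C \<subseteq> U}"
  then have "content C \<le> 1" using content_mono[of C \<Omega>] content_space by auto
  then show "ennreal (content C) \<le> 1" by (simp add: ennreal_le_1)
qed

lemma outer_space: "outer \<Omega> = 1"
  using content_le_open[of \<Omega> \<Omega>] open_content_le_1[of \<Omega>]
  by (intro antisym) (auto simp: outer_open content_space)

lemma outer_measure_space_outer: "outer_measure_space (Pow \<Omega>) outer"
  unfolding outer_measure_space_def
proof (intro conjI)
  show "positive (Pow \<Omega>) outer" by (simp add: positive_def outer_open open_content_empty)
  show "increasing (Pow \<Omega>) outer" by (simp add: increasing_def outer_mono)
  show "countably_subadditive (Pow \<Omega>) outer"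
    unfolding countably_subadditive_def
  proof (intro allI impI)
    fix A :: "nat \<Rightarrow> 'c set" assume A: "range A \<subseteq> Pow \<Omega>"
    show "outer (\<Union>i. A i) \<le> (\<Sum>i. outer (A i))"
    proof (rule ennreal_le_epsilon)
      fix e :: real assume e: "0 < e" and fin: "(\<Sum>i. outer (A i)) < top_class.top"
      \<comment> \<open>The slack e / 2^(n+1) sums to e; finiteness of the sum of outer measures
        makes the strict inequality available.\<close>
      have "\<exists>U. openin K U \<and> A n \<subseteq> U \<and> open_content U \<le> outer (A n) + e * (1/2) ^ Suc n" for n
      proof -
        have "outer (A n) < outer (A n) + e * (1/2) ^ Suc n"
          using e fin by (auto simp: less_top dest!: ennreal_suminf_lessD)
        then show ?thesis unfolding outer_def[of "A n"] INF_less_iff by (auto intro: less_imp_le)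
      qed
      then obtain U where U: "\<And>n. openin K (U n)" "\<And>n. A n \<subseteq> U n"
        "\<And>n. open_content (U n) \<le> outer (A n) + e * (1/2) ^ Suc n" by metis
      have "outer (\<Union>i. A i) \<le> open_content (\<Union>i. U i)" using U by (intro outer_le) auto
      also have "\<dots> \<le> (\<Sum>n. open_content (U n))" by (rule open_content_UN[OF U(1)])
      also have "\<dots> \<le> (\<Sum>n. outer (A n) + e * (1/2) ^ Suc n)"
        by (intro suminf_le U(3)) auto
      also have "\<dots> = (\<Sum>n. outer (A n)) + (\<Sum>n. ennreal e * ennreal ((1/2) ^ Suc n))"
        using e by (subst suminf_add[symmetric])
          (auto simp del: ennreal_suminf_cmult simp add: ennreal_mult[symmetric])
      also have "\<dots> = (\<Sum>n. outer (A n)) + e"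
        unfolding ennreal_suminf_cmult
        by (subst suminf_ennreal_eq[OF zero_le_power power_half_series]) auto
      finally show "outer (\<Union>i. A i) \<le> (\<Sum>n. outer (A n)) + e" .
    qed
  qed
qed

text \<open>The approximation is nested: a closed C in V \<inter> U is fixed first, and A - U is
  then covered by the open set V - C, whose closed subsets D are disjoint from C. Additivity of the
  content on C and D and the inclusion of their union in V give the bound.\<close>

lemma open_split:
  assumes U: "openin K U" and A: "A \<subseteq> \<Omega>"
  shows "outer (A \<inter> U) + outer (A - U) \<le> outer A"
  unfolding outer_def[of A]
proof (rule INF_greatest)
  fix V assume V: "V \<in> {V. openin K V \<and> A \<subseteq> V}"
  have VU: "openin K (V \<inter> U)" using V U by auto
  have "outer (A \<inter> U) + outer (A - U) \<le> open_content (V \<inter> U) + outer (A - U)"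
    using V by (intro add_right_mono outer_le VU) auto
  also have "\<dots> = (SUP C\<in>{C. closedin K C \<and> C \<subseteq> V \<inter> U}. ennreal (content C) + outer (A - U))"
    unfolding open_content_def by (rule ennreal_SUP_add_left[symmetric]) auto
  also have "\<dots> \<le> open_content V"
  proof (rule SUP_least)
    fix C assume C: "C \<in> {C. closedin K C \<and> C \<subseteq> V \<inter> U}"
    have VC: "openin K (V - C)" using V C by (auto intro: openin_diff)
    have "ennreal (content C) + outer (A - U) \<le> ennreal (content C) + open_content (V - C)"
      using V C by (intro add_left_mono outer_le VC) auto
    also have "\<dots> = (SUP D\<in>{D. closedin K D \<and> D \<subseteq> V - C}. ennreal (content C) + ennreal (content D))"
      unfolding open_content_def by (subst ennreal_SUP_add_right) auto
    also have "\<dots> \<le> open_content V"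
    proof (rule SUP_least)
      fix D assume D: "D \<in> {D. closedin K D \<and> D \<subseteq> V - C}"
      have "ennreal (content C) + ennreal (content D) = ennreal (content (C \<union> D))"
        using D by (subst content_Un) (auto simp: content_nonneg)
      also have "\<dots> \<le> open_content V" using C D V by (intro content_le_open) auto
      finally show "ennreal (content C) + ennreal (content D) \<le> open_content V" .
    qed
    finally show "ennreal (content C) + outer (A - U) \<le> open_content V" .
  qed
  finally show "outer (A \<inter> U) + outer (A - U) \<le> open_content V" .
qed

definition borel_ext :: "'c measure" where "borel_ext = measure_of \<Omega> {U. openin K U} outer"

lemma opens_Pow: "{U. openin K U} \<subseteq> Pow \<Omega>" by (auto dest: openin_subset)

lemma sets_borel_ext: "sets borel_ext = sigma_sets \<Omega> {U. openin K U}"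
  and space_borel_ext: "space borel_ext = \<Omega>"
  unfolding borel_ext_def using opens_Pow by simp_all

text \<open>The Caratheodory system contains the open sets by \<open>open_split\<close> and is a
  sigma-algebra, so it contains the Borel sets, and the outer measure is countably additive on
  them.\<close>

lemma emeasure_borel_ext: "A \<in> sets borel_ext \<Longrightarrow> emeasure borel_ext A = outer A"
proof -
  assume A: "A \<in> sets borel_ext"
  interpret P: sigma_algebra \<Omega> "Pow \<Omega>" by (rule sigma_algebra_Pow)
  define M where "M = lambda_system \<Omega> (Pow \<Omega>) outer"
  have ms: "measure_space \<Omega> M outer"
    unfolding M_def by (rule P.caratheodory_lemma[OF outer_measure_space_outer])
  have "{U. openin K U} \<subseteq> M"
  proof
    fix U assume "U \<in> {U. openin K U}"
    then have U: "openin K U" by simp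
    have "outer (A \<inter> U) + outer (A - U) = outer A" if "A \<subseteq> \<Omega>" for A
    proof (rule antisym[OF open_split[OF U that]])
      have "subadditive (Pow \<Omega>) outer"
        using outer_measure_space_outer P.countably_subadditive_subadditive
        unfolding outer_measure_space_def by blast
      then have "outer (A \<inter> U \<union> (A - U)) \<le> outer (A \<inter> U) + outer (A - U)"
        using that by (intro subadditiveD) auto
      then show "outer A \<le> outer (A \<inter> U) + outer (A - U)" by (simp add: Int_Diff_Un)
    qed
    then show "U \<in> M" unfolding M_def P.lambda_system_eq using openin_subset[OF U] by auto
  qed
  then have sub: "sigma_sets \<Omega> {U. openin K U} \<subseteq> M"
    using ms by (intro sigma_algebra.sigma_sets_subset) (auto simp: measure_space_def)
  have "measure_space \<Omega> (sigma_sets \<Omega> {U. openin K U}) outer"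
    by (rule measure_down[OF ms sigma_algebra_sigma_sets[OF opens_Pow] sub])
  then show ?thesis
    using A unfolding borel_ext_def measure_space_def
    by (subst emeasure_measure_of_conv) (simp add: sets_borel_ext[unfolded borel_ext_def] measure_space_def)
qed

lemma prob_space_borel_ext: "prob_space borel_ext"
  using outer_space emeasure_borel_ext[of \<Omega>] sets.top[of borel_ext]
  by (intro prob_spaceI) (simp add: space_borel_ext)

lemma open_sets: "openin K U \<Longrightarrow> U \<in> sets borel_ext"
  by (simp add: sets_borel_ext)

lemma closed_sets: "closedin K C \<Longrightarrow> C \<in> sets borel_ext"
proof -
  assume C: "closedin K C"
  then have "\<Omega> - (\<Omega> - C) \<in> sets borel_ext"
    using sets.compl_sets[OF open_sets[of "\<Omega> - C"]] by (auto simp: space_borel_ext)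
  moreover have "\<Omega> - (\<Omega> - C) = C" using closedin_subset[OF C] by auto
  ultimately show ?thesis by simp
qed

text \<open>Outer regularity is built into the definition. Inner regularity follows by complements:
  an open set slightly larger than the complement of A has a closed, hence compact, complement that
  is slightly smaller than A.\<close>

lemma regular_borel_ext: "regular_borel_prob K borel_ext"
  unfolding regular_borel_prob_def
proof (intro conjI ballI)
  interpret prob_space borel_ext by (rule prob_space_borel_ext)
  show "prob_space borel_ext" by (rule prob_space_borel_ext)
  fix A assume A: "A \<in> sets borel_ext"
  show outer_reg: "emeasure borel_ext A = (INF U\<in>{U. openin K U \<and> A \<subseteq> U}. emeasure borel_ext U)"
    unfolding emeasure_borel_ext[OF A] outer_def
    by (intro INF_cong) (auto simp: emeasure_borel_ext open_sets outer_open)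
  show "emeasure borel_ext A = (SUP C\<in>{C. compactin K C \<and> C \<subseteq> A}. emeasure borel_ext C)"
  proof (rule antisym)
    show "(SUP C\<in>{C. compactin K C \<and> C \<subseteq> A}. emeasure borel_ext C) \<le> emeasure borel_ext A"
      using A by (intro SUP_least emeasure_mono) auto
    show "emeasure borel_ext A \<le> (SUP C\<in>{C. compactin K C \<and> C \<subseteq> A}. emeasure borel_ext C)"
    proof (rule ennreal_le_epsilon)
      fix e :: real assume e: "0 < e"
      have A': "\<Omega> - A \<in> sets borel_ext" using sets.compl_sets[OF A] by (simp add: space_borel_ext)
      have "outer (\<Omega> - A) < outer (\<Omega> - A) + e"
        using e emeasure_borel_ext[OF A'] emeasure_finite[of "\<Omega> - A"] by (simp add: less_top)
      then obtain U where U: "openin K U" "\<Omega> - A \<subseteq> U" "open_content U < outer (\<Omega> - A) + e"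
        unfolding outer_def[of "\<Omega> - A"] INF_less_iff by auto
      have "emeasure borel_ext U \<le> emeasure borel_ext (\<Omega> - A) + e"
        using U by (simp add: emeasure_borel_ext A' open_sets outer_open less_imp_le)
      then have "prob U \<le> prob (\<Omega> - A) + e"
        using e by (simp add: emeasure_eq_measure flip: ennreal_plus)
      moreover have "prob (\<Omega> - A) = 1 - prob A" "prob (\<Omega> - U) = 1 - prob U"
        using prob_compl[OF A] prob_compl[OF open_sets[OF U(1)]] by (simp_all add: space_borel_ext)
      ultimately have "prob A \<le> prob (\<Omega> - U) + e" by simp
      then have "emeasure borel_ext A \<le> emeasure borel_ext (\<Omega> - U) + e"
        using e by (simp add: emeasure_eq_measure flip: ennreal_plus)
      also have "emeasure borel_ext (\<Omega> - U) \<le> (SUP C\<in>{C. compactin K C \<and> C \<subseteq> A}. emeasure borel_ext C)"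
        using U cpt sets.sets_into_space[OF A]
        by (intro SUP_upper) (auto intro!: closedin_compact_space simp: space_borel_ext)
      finally show "emeasure borel_ext A \<le> (SUP C\<in>{C. compactin K C \<and> C \<subseteq> A}. emeasure borel_ext C) + e"
        by (simp add: add_right_mono)
    qed
  qed
qed (auto simp: sets_borel_ext space_borel_ext)

text \<open>C is among the closed subsets of each open superset. Equality fails in general: a mean
  given by a limit along an ultrafilter can vanish on a point around which all its mass
  gathers.\<close>

lemma content_le_measure: "closedin K C \<Longrightarrow> content C \<le> measure borel_ext C"
proof -
  assume C: "closedin K C"
  interpret prob_space borel_ext by (rule prob_space_borel_ext)
  have "ennreal (content C) \<le> outer C"
    unfolding outer_def by (intro INF_greatest content_le_open C) auto
  then show ?thesis
    using emeasure_borel_ext[OF closed_sets[OF C]] by (metis emeasure_eq_measure ennreal_le_iff measure_nonneg)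
qed

text \<open>A nonnegative g is approximated from below by a staircase with positive coefficients on
  its closed superlevel sets, so the inequality between content and measure applies term by term;
  the step height is the error.\<close>

lemma mean_le_integral:
  assumes g: "continuous_map K euclideanreal g" and nonneg: "\<And>z. z \<in> \<Omega> \<Longrightarrow> 0 \<le> g z"
  shows "L g \<le> (\<integral>z. g z \<partial>borel_ext)"
proof -
  interpret prob_space borel_ext by (rule prob_space_borel_ext)
  have "compact (g ` \<Omega>)" using image_compactin[of K \<Omega> euclideanreal g] cpt g by (simp add: compact_space_def)
  then obtain B0 where B0: "\<And>z. z \<in> \<Omega> \<Longrightarrow> g z \<le> B0"
    using compact_imp_bounded bounded_has_Sup by (meson bounded_imp_bdd_above bdd_above_def imageI)
  \<comment> \<open>The added 1 makes the bound strict, which places every value of g in the second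
    case of \<open>step_sum_bounds\<close> with N h = B.\<close>
  define B where "B = \<bar>B0\<bar> + 1"
  have B: "0 < B" "\<And>z. z \<in> \<Omega> \<Longrightarrow> g z < B" using B0 by (auto simp: B_def intro: le_less_trans[of _ B0])
  have gb: "g \<in> bounded_functions \<Omega>"
    unfolding bounded_functions_def using nonneg B by (auto intro!: exI[of _ B] simp: abs_le_iff less_imp_le intro: order_trans[of _ 0])
  have int: "integrable borel_ext g"
    by (rule regular_borel_continuous_integrable[OF regular_borel_ext cpt g])
  have step: "L g \<le> B / real N + (\<integral>z. g z \<partial>borel_ext)" if N: "0 < N" for N :: nat
  proof -
    define h where "h = B / real N"
    have h: "0 < h" "real N * h = B" using N B by (auto simp: h_def)
    define A where "A = (\<lambda>i::nat. {z \<in> \<Omega>. real i * h \<le> g z})"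
    have A: "closedin K (A i)" for i
      using closedin_continuous_map_preimage[OF g, of "{real i * h..}"] by (simp add: A_def)
    have intA: "integrable borel_ext (\<lambda>z. h * indicator (A i) z :: real)" for i
      using closed_sets[OF A] by (intro integrable_mult_right integrable_real_indicator) (auto simp: emeasure_eq_measure)
    define S where "S = (\<lambda>z. \<Sum>i=1..N. h * indicator (A i) z :: real)"
    have Seq: "S z = (\<Sum>i=1..N. h * of_bool (real i * h \<le> g z))" if "z \<in> \<Omega>" for z
      unfolding S_def A_def using that by (intro sum.cong) (auto simp: indicator_def)
    have S: "S z \<le> g z" "g z \<le> h + S z" if "z \<in> \<Omega>" for z
      using step_sum_bounds[OF h(1) nonneg[OF that], of N] B(2)[OF that] h(2) Seq[OF that] by auto
    have Sb: "S \<in> bounded_functions \<Omega>"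
      unfolding S_def by (intro bounded_functions_sum bounded_functions_scale indicator_bounded)
    have "L g \<le> L (\<lambda>z. h + S z)"
      using S by (intro positive_mean_mono[OF mean] gb bounded_functions_add[OF bounded_functions_const Sb])
    also have "\<dots> = L (\<lambda>z. h) + L S"
      by (rule positive_mean_add[OF mean bounded_functions_const Sb])
    also have "L (\<lambda>z. h) = h"
      using positive_mean_scale[OF mean bounded_functions_const, of h 1] mean
      by (simp add: positive_mean_def)
    also have "L S = (\<Sum>i=1..N. h * content (A i))"
      unfolding S_def
      by (subst positive_mean_sum[OF mean bounded_functions_scale[OF indicator_bounded]])
         (auto simp: content_def positive_mean_scale[OF mean indicator_bounded])
    also have "\<dots> \<le> (\<Sum>i=1..N. h * prob (A i))"
      using h by (intro sum_mono mult_left_mono content_le_measure A) auto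
    also have "\<dots> = (\<integral>z. S z \<partial>borel_ext)"
      unfolding S_def by (subst Bochner_Integration.integral_sum[OF intA]) (simp add: closed_sets[OF A])
    also have "\<dots> \<le> (\<integral>z. g z \<partial>borel_ext)"
    proof (rule integral_mono[OF _ int])
      show "integrable borel_ext S" unfolding S_def by (rule Bochner_Integration.integrable_sum[OF intA])
    qed (use S in \<open>simp add: space_borel_ext\<close>)
    finally show ?thesis by (simp add: h_def)
  qed
  show ?thesis
  proof (rule field_le_epsilon)
    fix e :: real assume e: "0 < e"
    obtain N :: nat where N: "B / e < real N" using reals_Archimedean2 by blast
    then have "0 < real N" using B e by (meson divide_pos_pos less_trans)
    then have "0 < N" "B / real N < e" using N e by (auto simp: field_simps)
    then show "L g \<le> (\<integral>z. g z \<partial>borel_ext) + e" using step[of N] by simp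
  qed
qed

end

section \<open>Lattice homomorphisms on principal ideals\<close>

context vector_lattice
begin

lemma real_vspace_carrier: "real_vspace (carrier X) (vadd X) (vscale X) (vzero X)"
  by standard (auto intro: zero_closed add_closed scale_closed add_assoc add_commute add_zero add_neg
      scale_add_right scale_add_left scale_scale scale_one)

sublocale vs: real_vspace "carrier X" "vadd X" "vscale X" "vzero X"
  by (rule real_vspace_carrier)

lemmas vector_closed [simp] = zero_closed add_closed scale_closed

lemma add_mono2:
  "\<lbrakk>x \<sqsubseteq> y; u \<sqsubseteq> v; x \<in> carrier X; y \<in> carrier X; u \<in> carrier X; v \<in> carrier X\<rbrakk> \<Longrightarrow> x \<oplus> u \<sqsubseteq> y \<oplus> v"
  using add_mono[of x y u] add_mono[of u v y] add_commute le_trans[of "x \<oplus> u" "y \<oplus> u" "y \<oplus> v"] by simp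

lemma le_add_cancel:
  assumes "x \<oplus> z \<sqsubseteq> y \<oplus> z" "x \<in> carrier X" "y \<in> carrier X" "z \<in> carrier X"
  shows "x \<sqsubseteq> y"
  using add_mono[of "x \<oplus> z" "y \<oplus> z" "(-1) \<odot> z"] assms by (simp add: vs.add_cancel_right)

lemma diff_nonneg_iff:
  assumes "x \<in> carrier X" "y \<in> carrier X" shows "\<zero> \<sqsubseteq> y \<oplus> (-1) \<odot> x \<longleftrightarrow> x \<sqsubseteq> y"
proof
  assume "\<zero> \<sqsubseteq> y \<oplus> (-1) \<odot> x"
  then have "\<zero> \<oplus> x \<sqsubseteq> (y \<oplus> (-1) \<odot> x) \<oplus> x" using assms by (intro add_mono) auto
  moreover have "(y \<oplus> (-1) \<odot> x) \<oplus> x = y"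
    using vs.add_cancel_right[of y "(-1) \<odot> x"] assms by (simp add: scale_scale scale_one)
  ultimately show "x \<sqsubseteq> y" using assms by (simp add: vs.zero_left)
next
  assume "x \<sqsubseteq> y"
  then show "\<zero> \<sqsubseteq> y \<oplus> (-1) \<odot> x"
    using add_mono[of x y "(-1) \<odot> x"] assms by (simp add: add_neg)
qed

lemma diff_le_iff:
  assumes "x \<in> carrier X" "y \<in> carrier X" "z \<in> carrier X"
  shows "x \<oplus> (-1) \<odot> y \<sqsubseteq> z \<longleftrightarrow> x \<sqsubseteq> y \<oplus> z"
proof -
  have eq: "(x \<oplus> (-1) \<odot> y) \<oplus> y = x"
    using vs.add_cancel_right[of x "(-1) \<odot> y"] assms by (simp add: scale_scale scale_one)
  show ?thesis
    using add_mono[of "x \<oplus> (-1) \<odot> y" z y] le_add_cancel[of "x \<oplus> (-1) \<odot> y" y z] assms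
    by (auto simp: eq add_commute)
qed

lemma scale_mono:
  assumes "0 \<le> a" "x \<sqsubseteq> y" "x \<in> carrier X" "y \<in> carrier X" shows "a \<odot> x \<sqsubseteq> a \<odot> y"
proof -
  have "\<zero> \<sqsubseteq> a \<odot> (y \<oplus> (-1) \<odot> x)" using assms diff_nonneg_iff by (intro scale_nonneg) auto
  also have "a \<odot> (y \<oplus> (-1) \<odot> x) = a \<odot> y \<oplus> (-1) \<odot> a \<odot> x"
    using assms by (simp add: scale_add_right scale_scale)
  finally show ?thesis using assms diff_nonneg_iff by simp
qed

lemma scale_mono_left:
  assumes "a \<le> b" "\<zero> \<sqsubseteq> e" "e \<in> carrier X" shows "a \<odot> e \<sqsubseteq> b \<odot> e"
proof -
  have "\<zero> \<sqsubseteq> (b - a) \<odot> e" using assms by (intro scale_nonneg) auto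
  also have "(b - a) \<odot> e = b \<odot> e \<oplus> (-1) \<odot> a \<odot> e"
    using assms scale_add_left[of e b "- a"] by (simp add: scale_scale)
  finally show ?thesis using assms diff_nonneg_iff by simp
qed

lemma neg_le_iff:
  assumes "x \<in> carrier X" "y \<in> carrier X" shows "(-1) \<odot> x \<sqsubseteq> (-1) \<odot> y \<longleftrightarrow> y \<sqsubseteq> x"
  using diff_nonneg_iff[of y x] diff_nonneg_iff[of "(-1) \<odot> x" "(-1) \<odot> y"] assms
  by (simp add: scale_scale scale_one add_commute)

lemma neg_neg: "x \<in> carrier X \<Longrightarrow> (-1) \<odot> (-1) \<odot> x = x"
  by (simp add: scale_scale scale_one)

text \<open>Translation by z is an order isomorphism whose inverse is translation by the negative.
  This invariance makes the join an admissible relation for the extension theorem.\<close>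

lemma join_add:
  assumes "x \<in> carrier X" "y \<in> carrier X" "z \<in> carrier X"
  shows "(x \<squnion> y) \<oplus> z = (x \<oplus> z) \<squnion> (y \<oplus> z)"
proof (rule le_antisym)
  let ?j = "(x \<oplus> z) \<squnion> (y \<oplus> z)"
  have eq: "(?j \<oplus> (-1) \<odot> z) \<oplus> z = ?j"
    using vs.add_cancel_right[of ?j "(-1) \<odot> z"] assms by (simp add: neg_neg)
  have "x \<sqsubseteq> ?j \<oplus> (-1) \<odot> z" "y \<sqsubseteq> ?j \<oplus> (-1) \<odot> z"
    by (rule le_add_cancel[of _ z]; use assms in \<open>simp add: eq join_left join_right\<close>)+
  then have "x \<squnion> y \<sqsubseteq> ?j \<oplus> (-1) \<odot> z" using assms by (intro join_le) auto
  then have "(x \<squnion> y) \<oplus> z \<sqsubseteq> (?j \<oplus> (-1) \<odot> z) \<oplus> z" using assms by (intro add_mono) auto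
  then show "(x \<squnion> y) \<oplus> z \<sqsubseteq> ?j" by (simp add: eq)
  show "?j \<sqsubseteq> (x \<squnion> y) \<oplus> z" using assms by (auto intro!: join_le add_mono join_left join_right)
qed (use assms in auto)

lemma meet_eq_join:
  assumes "x \<in> carrier X" "y \<in> carrier X"
  shows "x \<sqinter> y = (-1) \<odot> ((-1) \<odot> x \<squnion> (-1) \<odot> y)"
proof (rule le_antisym)
  let ?j = "(-1) \<odot> x \<squnion> (-1) \<odot> y"
  have "(-1) \<odot> ?j \<sqsubseteq> (-1) \<odot> (-1) \<odot> x" "(-1) \<odot> ?j \<sqsubseteq> (-1) \<odot> (-1) \<odot> y"
    by (subst neg_le_iff; use assms in \<open>simp add: join_left join_right\<close>)+
  then show "(-1) \<odot> ?j \<sqsubseteq> x \<sqinter> y" using assms by (intro meet_le) (auto simp: neg_neg)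
  have "?j \<sqsubseteq> (-1) \<odot> (x \<sqinter> y)"
    using assms by (auto intro!: join_le simp: neg_le_iff meet_left meet_right)
  then have "(-1) \<odot> (-1) \<odot> (x \<sqinter> y) \<sqsubseteq> (-1) \<odot> ?j" using assms by (subst neg_le_iff) auto
  then show "x \<sqinter> y \<sqsubseteq> (-1) \<odot> ?j" using assms by (simp add: neg_neg)
qed (use assms in auto)

lemma vabs_closed [simp]: "x \<in> carrier X \<Longrightarrow> vabs X x \<in> carrier X"
  by (simp add: vabs_def)

lemma le_vabs: "x \<in> carrier X \<Longrightarrow> x \<sqsubseteq> vabs X x" "x \<in> carrier X \<Longrightarrow> (-1) \<odot> x \<sqsubseteq> vabs X x"
  by (simp_all add: vabs_def join_left join_right)

text \<open>Adding the bounds of x and -x by the modulus gives that twice the modulus is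
  nonnegative; the result is then halved.\<close>

lemma vabs_nonneg: "x \<in> carrier X \<Longrightarrow> \<zero> \<sqsubseteq> vabs X x"
proof -
  assume x: "x \<in> carrier X"
  have "x \<oplus> (-1) \<odot> x \<sqsubseteq> vabs X x \<oplus> vabs X x" using x le_vabs by (intro add_mono2) auto
  then have "(1/2) \<odot> \<zero> \<sqsubseteq> (1/2) \<odot> (vabs X x \<oplus> vabs X x)"
    using x by (intro scale_mono) (auto simp: add_neg)
  also have "(1/2) \<odot> (vabs X x \<oplus> vabs X x) = vabs X x"
    using x scale_add_left[of "vabs X x" "1/2" "1/2"] by (simp add: scale_add_right scale_one)
  finally show ?thesis by (simp add: vs.scale_zero)
qed

lemma vabs_eq: "x \<in> carrier X \<Longrightarrow> \<zero> \<sqsubseteq> x \<Longrightarrow> vabs X x = x"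
proof -
  assume x: "x \<in> carrier X" "\<zero> \<sqsubseteq> x"
  have "(-1) \<odot> x \<sqsubseteq> \<zero>" using neg_le_iff[of x \<zero>] x by (simp add: vs.scale_zero)
  then have "(-1) \<odot> x \<sqsubseteq> x" using x le_trans[of "(-1) \<odot> x" \<zero> x] by simp
  then show ?thesis using x by (auto intro!: le_antisym join_le simp: vabs_def join_left)
qed

section \<open>Principal ideals and their gauge\<close>

definition ideal_gen :: "'a \<Rightarrow> 'a set" where
  "ideal_gen e = {x \<in> carrier X. \<exists>c. x \<sqsubseteq> c \<odot> e \<and> (-1) \<odot> x \<sqsubseteq> c \<odot> e}"

text \<open>Values outside the ideal are unconstrained. On a whole Banach lattice there may be too
  few such maps: on L_p[0,1] with p finite the only real lattice homomorphism is zero.\<close>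

definition lathom :: "'a \<Rightarrow> ('a \<Rightarrow> real) set" where
  "lathom e = {\<phi>. (\<forall>x\<in>ideal_gen e. \<forall>y\<in>ideal_gen e. \<phi> (x \<oplus> y) = \<phi> x + \<phi> y \<and> \<phi> (x \<squnion> y) = max (\<phi> x) (\<phi> y))
     \<and> (\<forall>a. \<forall>x\<in>ideal_gen e. \<phi> (a \<odot> x) = a * \<phi> x)}"

lemma ideal_gen_carrier: "x \<in> ideal_gen e \<Longrightarrow> x \<in> carrier X"
  by (simp add: ideal_gen_def)

context
  fixes e assumes e: "e \<in> carrier X" "\<zero> \<sqsubseteq> e"
begin

lemma ideal_genI: "\<lbrakk>x \<in> carrier X; x \<sqsubseteq> c \<odot> e; (-1) \<odot> x \<sqsubseteq> c \<odot> e\<rbrakk> \<Longrightarrow> x \<in> ideal_gen e"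
  unfolding ideal_gen_def by blast

lemma ideal_genE:
  assumes "x \<in> ideal_gen e" obtains c where "0 \<le> c" "x \<sqsubseteq> c \<odot> e" "(-1) \<odot> x \<sqsubseteq> c \<odot> e"
proof -
  obtain c where x: "x \<in> carrier X" and c: "x \<sqsubseteq> c \<odot> e" "(-1) \<odot> x \<sqsubseteq> c \<odot> e"
    using assms unfolding ideal_gen_def by blast
  have *: "c \<odot> e \<sqsubseteq> max c 0 \<odot> e" using e by (intro scale_mono_left) auto
  show ?thesis
    using that[of "max c 0"] c le_trans[OF c(1) *] le_trans[OF c(2) *] x e by simp
qed

lemma ideal_gen_interval:
  assumes "a \<in> ideal_gen e" "b \<in> ideal_gen e" "a \<sqsubseteq> x" "x \<sqsubseteq> b" "x \<in> carrier X"
  shows "x \<in> ideal_gen e"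
proof -
  obtain c d where c: "0 \<le> c" "(-1) \<odot> a \<sqsubseteq> c \<odot> e" and d: "0 \<le> d" "b \<sqsubseteq> d \<odot> e"
    using assms ideal_genE by metis
  have car: "a \<in> carrier X" "b \<in> carrier X" using assms ideal_gen_carrier by auto
  have le: "c \<odot> e \<sqsubseteq> (c + d) \<odot> e" "d \<odot> e \<sqsubseteq> (c + d) \<odot> e" using c d e by (auto intro: scale_mono_left)
  have "x \<sqsubseteq> d \<odot> e" using le_trans[OF assms(4) d(2)] car assms e by simp
  moreover have "(-1) \<odot> x \<sqsubseteq> (-1) \<odot> a" using assms car by (simp add: neg_le_iff)
  then have "(-1) \<odot> x \<sqsubseteq> c \<odot> e" using le_trans[OF _ c(2)] car assms e by simp
  ultimately have "x \<sqsubseteq> (c + d) \<odot> e" "(-1) \<odot> x \<sqsubseteq> (c + d) \<odot> e"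
    using le_trans[OF _ le(1)] le_trans[OF _ le(2)] assms e by auto
  then show ?thesis using assms(5) by (intro ideal_genI)
qed

lemma ideal_gen_zero: "\<zero> \<in> ideal_gen e"
  using e by (intro ideal_genI[of _ 0]) (auto simp: vs.scale_0 vs.scale_zero)

lemma ideal_gen_add:
  assumes "x \<in> ideal_gen e" "y \<in> ideal_gen e" shows "x \<oplus> y \<in> ideal_gen e"
proof -
  obtain c d where c: "x \<sqsubseteq> c \<odot> e" "(-1) \<odot> x \<sqsubseteq> c \<odot> e" and d: "y \<sqsubseteq> d \<odot> e" "(-1) \<odot> y \<sqsubseteq> d \<odot> e"
    using assms ideal_genE by metis
  have car: "x \<in> carrier X" "y \<in> carrier X" using assms ideal_gen_carrier by auto
  have "x \<oplus> y \<sqsubseteq> (c + d) \<odot> e" "(-1) \<odot> x \<oplus> (-1) \<odot> y \<sqsubseteq> (c + d) \<odot> e"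
    using c d car e by (auto simp: scale_add_left intro!: add_mono2)
  then show ?thesis using car by (intro ideal_genI[of _ "c + d"]) (auto simp: scale_add_right)
qed

lemma ideal_gen_scale:
  assumes "x \<in> ideal_gen e" shows "a \<odot> x \<in> ideal_gen e"
proof -
  obtain c where c: "x \<sqsubseteq> c \<odot> e" "(-1) \<odot> x \<sqsubseteq> c \<odot> e" using assms ideal_genE by metis
  have car: "x \<in> carrier X" using assms ideal_gen_carrier by auto
  have *: "\<bar>a\<bar> \<odot> x \<sqsubseteq> (\<bar>a\<bar> * c) \<odot> e" "\<bar>a\<bar> \<odot> (-1) \<odot> x \<sqsubseteq> (\<bar>a\<bar> * c) \<odot> e"
    using scale_mono[of "\<bar>a\<bar>", OF _ c(1)] scale_mono[of "\<bar>a\<bar>", OF _ c(2)] car e by (simp_all add: scale_scale)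
  show ?thesis
    using * car by (intro ideal_genI[of _ "\<bar>a\<bar> * c"]; cases "0 \<le> a") (auto simp: scale_scale)
qed

lemma ideal_gen_join:
  assumes "x \<in> ideal_gen e" "y \<in> ideal_gen e" shows "x \<squnion> y \<in> ideal_gen e"
proof -
  obtain c d where c: "0 \<le> c" "x \<sqsubseteq> c \<odot> e" "(-1) \<odot> x \<sqsubseteq> c \<odot> e" and d: "0 \<le> d" "y \<sqsubseteq> d \<odot> e"
    using assms ideal_genE by metis
  have car: "x \<in> carrier X" "y \<in> carrier X" using assms ideal_gen_carrier by auto
  have "c \<odot> e \<sqsubseteq> (c + d) \<odot> e" "d \<odot> e \<sqsubseteq> (c + d) \<odot> e" using c d e by (auto intro: scale_mono_left)
  then have "x \<sqsubseteq> (c + d) \<odot> e" "y \<sqsubseteq> (c + d) \<odot> e"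
    using le_trans[OF c(2)] le_trans[OF d(2)] car e by auto
  then have "x \<squnion> y \<sqsubseteq> (c + d) \<odot> e" using car e by (intro join_le) auto
  moreover have "(c + d) \<odot> e \<in> ideal_gen e"
  proof (rule ideal_genI)
    have "(-1) \<odot> (c + d) \<odot> e = (- (c + d)) \<odot> e" using e by (simp add: scale_scale)
    also have "\<dots> \<sqsubseteq> (c + d) \<odot> e" using c d e by (intro scale_mono_left) auto
    finally show "(-1) \<odot> (c + d) \<odot> e \<sqsubseteq> (c + d) \<odot> e" .
  qed (use e in auto)
  ultimately show ?thesis
    using ideal_gen_interval[OF assms(1)] car join_left[of x y] by simp
qed

lemma ideal_gen_meet:
  assumes "x \<in> ideal_gen e" "y \<in> ideal_gen e" shows "x \<sqinter> y \<in> ideal_gen e"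
  using assms by (simp add: meet_eq_join ideal_gen_carrier ideal_gen_scale ideal_gen_join)

lemma ideal_gen_vabs: "x \<in> ideal_gen e \<Longrightarrow> vabs X x \<in> ideal_gen e"
  by (simp add: vabs_def ideal_gen_scale ideal_gen_join)

lemma ideal_gen_self: "e \<in> ideal_gen e"
proof (rule ideal_genI[of _ 1])
  have "(-1) \<odot> e \<sqsubseteq> 1 \<odot> e" using e by (intro scale_mono_left) auto
  then show "(-1) \<odot> e \<sqsubseteq> 1 \<odot> e" .
qed (use e in \<open>auto simp: scale_one\<close>)

lemma real_vspace_ideal: "real_vspace (ideal_gen e) (vadd X) (vscale X) (vzero X)"
  by standard (simp_all add: ideal_gen_zero ideal_gen_add ideal_gen_scale ideal_gen_carrier add_assoc add_zero add_neg
      scale_add_right scale_add_left scale_scale scale_one add_commute[OF ideal_gen_carrier ideal_gen_carrier])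

context
  fixes \<phi> assumes \<phi>: "\<phi> \<in> lathom e"
begin

lemma lathom_add: "x \<in> ideal_gen e \<Longrightarrow> y \<in> ideal_gen e \<Longrightarrow> \<phi> (x \<oplus> y) = \<phi> x + \<phi> y"
  and lathom_scale: "x \<in> ideal_gen e \<Longrightarrow> \<phi> (a \<odot> x) = a * \<phi> x"
  and lathom_join: "x \<in> ideal_gen e \<Longrightarrow> y \<in> ideal_gen e \<Longrightarrow> \<phi> (x \<squnion> y) = max (\<phi> x) (\<phi> y)"
  using \<phi> unfolding lathom_def by blast+

lemma lathom_zero: "\<phi> \<zero> = 0"
  using lathom_scale[OF ideal_gen_zero, of 0] by (simp add: vs.scale_zero)

lemma lathom_meet: "x \<in> ideal_gen e \<Longrightarrow> y \<in> ideal_gen e \<Longrightarrow> \<phi> (x \<sqinter> y) = min (\<phi> x) (\<phi> y)"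
  by (simp add: meet_eq_join ideal_gen_carrier lathom_scale lathom_join ideal_gen_scale ideal_gen_join)

lemma lathom_vabs: "x \<in> ideal_gen e \<Longrightarrow> \<phi> (vabs X x) = \<bar>\<phi> x\<bar>"
  by (simp add: vabs_def lathom_scale lathom_join ideal_gen_scale)

lemma lathom_mono: "x \<in> ideal_gen e \<Longrightarrow> y \<in> ideal_gen e \<Longrightarrow> x \<sqsubseteq> y \<Longrightarrow> \<phi> x \<le> \<phi> y"
  using lathom_join[of x y] le_iff_meet[of x y] by (simp add: ideal_gen_carrier)

end

text \<open>The bound \<open>0 \<le> c\<close> keeps the gauge finite for \<open>e = 0\<close>.\<close>

definition gauge_set :: "'a \<Rightarrow> real set" where "gauge_set x = {c. 0 \<le> c \<and> x \<sqsubseteq> c \<odot> e}"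

lemma gauge_set_ne: "x \<in> ideal_gen e \<Longrightarrow> gauge_set x \<noteq> {}"
  by (erule ideal_genE) (auto simp: gauge_set_def)

lemma gauge_set_bdd: "bdd_below (gauge_set x)"
  by (rule bdd_belowI[of _ 0]) (simp add: gauge_set_def)

lemma gauge_set_up: "x \<in> carrier X \<Longrightarrow> c \<in> gauge_set x \<Longrightarrow> c \<le> d \<Longrightarrow> d \<in> gauge_set x"
  unfolding gauge_set_def using scale_mono_left[of c d e] e le_trans[of x "c \<odot> e" "d \<odot> e"] by simp

lemma gauge_less: "x \<in> ideal_gen e \<Longrightarrow> Inf (gauge_set x) < c \<Longrightarrow> x \<sqsubseteq> c \<odot> e"
proof -
  assume x: "x \<in> ideal_gen e" and c: "Inf (gauge_set x) < c"
  obtain d where "d \<in> gauge_set x" "d < c" using cInf_lessD[OF gauge_set_ne[OF x] c] by blast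
  then have "c \<in> gauge_set x" using gauge_set_up[OF ideal_gen_carrier[OF x]] by simp
  then show ?thesis by (simp add: gauge_set_def)
qed

text \<open>The gauge preserves binary suprema, so that the Hahn--Banach functional below it is a lattice
  homomorphism.\<close>

lemma lathom_attains_gauge:
  assumes u: "u \<in> ideal_gen e"
  obtains \<phi> where "\<phi> \<in> lathom e" "\<phi> u = Inf (gauge_set u)"
proof -
  interpret I: real_vspace "ideal_gen e" "vadd X" "vscale X" "vzero X" by (rule real_vspace_ideal)
  define p where "p = (\<lambda>x. Inf (gauge_set x))"
  define J where "J = (\<lambda>x y z. x \<in> ideal_gen e \<and> y \<in> ideal_gen e \<and> z = x \<squnion> y)"
  have sub: "I.sublin p"
  proof (rule I.sublinI)
    fix x y assume xy: "x \<in> ideal_gen e" "y \<in> ideal_gen e"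
    have "(INF c\<in>gauge_set (x \<oplus> y). c) \<le> (INF c\<in>gauge_set x. c) + (INF c\<in>gauge_set y. c)"
    proof (rule cINF_add_le)
      fix c d assume cd: "c \<in> gauge_set x" "d \<in> gauge_set y"
      then have "x \<oplus> y \<sqsubseteq> (c + d) \<odot> e"
        using xy e by (auto simp: gauge_set_def scale_add_left ideal_gen_carrier intro!: add_mono2)
      then have "c + d \<in> gauge_set (x \<oplus> y)" using cd by (simp add: gauge_set_def)
      then show "\<exists>k\<in>gauge_set (x \<oplus> y). k \<le> c + d" by blast
    qed (use xy gauge_set_ne gauge_set_bdd in auto)
    then show "p (x \<oplus> y) \<le> p x + p y" by (simp add: p_def)
  next
    have "gauge_set \<zero> = {0..}" using e by (auto simp: gauge_set_def intro: scale_nonneg)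
    then show "p \<zero> = 0" by (simp add: p_def)
  next
    fix d :: real and z assume d: "0 < d" and z: "z \<in> ideal_gen e"
    have "p (d \<odot> z) / d \<le> Inf (gauge_set z)"
    proof (rule cInf_greatest[OF gauge_set_ne[OF z]])
      fix a assume a: "a \<in> gauge_set z"
      then have "d \<odot> z \<sqsubseteq> d \<odot> a \<odot> e"
        using d z e by (intro scale_mono) (auto simp: gauge_set_def ideal_gen_carrier)
      then have "d * a \<in> gauge_set (d \<odot> z)" using a d e by (simp add: gauge_set_def scale_scale)
      then have "p (d \<odot> z) \<le> d * a" unfolding p_def using gauge_set_bdd by (rule cInf_lower)
      then show "p (d \<odot> z) / d \<le> a" using d by (simp add: field_simps)
    qed
    then show "p (d \<odot> z) \<le> d * p z" using d by (simp add: p_def field_simps)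
  qed
  have J: "I.max_rel J"
    unfolding I.max_rel_def J_def by (auto simp: ideal_gen_join ideal_gen_add join_add ideal_gen_carrier)
  have pres: "I.preserves_max J p"
    unfolding I.preserves_max_def
  proof (intro allI impI)
    fix x y z assume "J x y z"
    then have xy: "x \<in> ideal_gen e" "y \<in> ideal_gen e" and z: "z = x \<squnion> y" by (auto simp: J_def)
    have car: "x \<in> carrier X" "y \<in> carrier X" using xy ideal_gen_carrier by auto
    have "x \<squnion> y \<sqsubseteq> w \<longleftrightarrow> x \<sqsubseteq> w \<and> y \<sqsubseteq> w" if "w \<in> carrier X" for w
      using that car join_le[of x w y] le_trans[OF join_left, of x y w] le_trans[OF join_right, of x y w]
      by auto
    \<comment> \<open>Both gauge sets are upward closed, so the infimum over their intersection is
      the larger of the two infima.\<close>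
    then have eq: "gauge_set z = gauge_set x \<inter> gauge_set y"
      unfolding z gauge_set_def using e by auto
    have ne: "gauge_set z \<noteq> {}" using z xy by (simp add: gauge_set_ne ideal_gen_join)
    show "p z = max (p x) (p y)"
    proof (rule antisym)
      show "max (p x) (p y) \<le> p z"
        unfolding p_def using eq ne by (auto intro!: cInf_superset_mono gauge_set_bdd)
      show "p z \<le> max (p x) (p y)"
      proof (rule dense_ge)
        fix c assume c: "max (p x) (p y) < c"
        obtain a b where "a \<in> gauge_set x" "a < c" "b \<in> gauge_set y" "b < c"
          using c cInf_lessD[OF gauge_set_ne[OF xy(1)]] cInf_lessD[OF gauge_set_ne[OF xy(2)]]
          unfolding p_def by (metis max_less_iff_conj)
        then have "c \<in> gauge_set z" unfolding eq using gauge_set_up car by (metis IntI less_imp_le)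
        then show "p z \<le> c" unfolding p_def using gauge_set_bdd by (rule cInf_lower)
      qed
    qed
  qed
  from I.hahn_banach[OF sub J pres u]
  obtain L where L: "I.linear_on_V L" "I.preserves_max J L" "L u = p u" by blast
  have "L \<in> lathom e"
    using L(1,2) unfolding lathom_def I.linear_on_V_def I.preserves_max_def J_def mem_Collect_eq by blast
  with L(3) show ?thesis using that by (simp add: p_def)
qed

end

end

section \<open>Separation of points in a Banach lattice\<close>

context banach_lattice
begin

text \<open>The positive part of u lies below every admissible d, so monotonicity of the norm makes
  it zero. The majorant may vary with c, which covers small multiples of e as well as moduli of
  differences in a convergent sequence.\<close>

lemma archimedean:
  assumes u: "u \<in> carrier X" and e: "e \<in> carrier X" "\<zero> \<sqsubseteq> e"
    and le: "\<And>c. 0 < c \<Longrightarrow> \<exists>d\<in>carrier X. \<zero> \<sqsubseteq> d \<and> u \<sqsubseteq> d \<and> vnorm X d \<le> c"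
  shows "u \<sqsubseteq> \<zero>"
proof -
  let ?u = "u \<squnion> \<zero>"
  have u0: "\<zero> \<sqsubseteq> ?u" using u join_right by simp
  have "vnorm X ?u \<le> 0 + c" if c: "0 < c" for c
  proof -
    obtain d where d: "d \<in> carrier X" "\<zero> \<sqsubseteq> d" "u \<sqsubseteq> d" "vnorm X d \<le> c" using le[OF c] by blast
    have "?u \<sqsubseteq> d" using u d by (intro join_le) auto
    then have "vnorm X ?u \<le> vnorm X d" using u0 u d by (intro norm_lattice) (auto simp: vabs_eq)
    then show ?thesis using d by simp
  qed
  then have "vnorm X ?u \<le> 0" by (rule field_le_epsilon)
  then have "?u = \<zero>" using norm_nonneg[of ?u] norm_eq_zero[of ?u] u by simp
  then show ?thesis using join_left[of u \<zero>] u by simp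
qed

text \<open>The homomorphism that attains the gauge at x - y shows this gauge to be at most zero.
  Hence x - y lies below every positive multiple of e, and the Archimedean property
  finishes.\<close>

lemma separation:
  assumes e: "e \<in> carrier X" "\<zero> \<sqsubseteq> e" and xy: "x \<in> ideal_gen e" "y \<in> ideal_gen e"
    and le: "\<And>\<phi>. \<phi> \<in> lathom e \<Longrightarrow> \<phi> x \<le> \<phi> y"
  shows "x \<sqsubseteq> y"
proof -
  define u where "u = x \<oplus> (-1) \<odot> y"
  have u: "u \<in> ideal_gen e" unfolding u_def using e xy by (simp add: ideal_gen_add ideal_gen_scale)
  obtain \<phi> where \<phi>: "\<phi> \<in> lathom e" "\<phi> u = Inf (gauge_set e u)" by (rule lathom_attains_gauge[OF e u])
  have "\<phi> u = \<phi> x - \<phi> y"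
    unfolding u_def using xy \<phi> e by (simp add: lathom_add[OF e] lathom_scale[OF e] ideal_gen_scale)
  then have 0: "Inf (gauge_set e u) \<le> 0" using le[OF \<phi>(1)] \<phi>(2) by simp
  have uc: "u \<in> carrier X" "x \<in> carrier X" "y \<in> carrier X" using u xy ideal_gen_carrier by auto
  have "u \<sqsubseteq> \<zero>"
  proof (rule archimedean[OF uc(1) e])
    fix c :: real assume c: "0 < c"
    \<comment> \<open>The added 1 covers e = 0, where the norm of e vanishes.\<close>
    define d where "d = c / (vnorm X e + 1)"
    have n: "0 \<le> vnorm X e" using norm_nonneg e by simp
    then have d: "0 < d" using c by (simp add: d_def)
    have "d * vnorm X e \<le> c" using n c by (simp add: d_def field_simps)
    then have "\<zero> \<sqsubseteq> d \<odot> e" "u \<sqsubseteq> d \<odot> e" "vnorm X (d \<odot> e) \<le> c"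
      using e d 0 u gauge_less[OF e u, of d] by (auto simp: scale_nonneg norm_scale)
    then show "\<exists>d\<in>carrier X. \<zero> \<sqsubseteq> d \<and> u \<sqsubseteq> d \<and> vnorm X d \<le> c" using e by auto
  qed
  then have "\<zero> \<sqsubseteq> (-1) \<odot> u" using neg_le_iff[of \<zero> u] uc by (simp add: vs.scale_zero)
  also have "(-1) \<odot> u = y \<oplus> (-1) \<odot> x"
    unfolding u_def using uc by (simp add: scale_add_right scale_scale scale_one add_commute)
  finally show ?thesis using uc diff_nonneg_iff by simp
qed

lemma separation_eq:
  assumes e: "e \<in> carrier X" "\<zero> \<sqsubseteq> e" and xy: "x \<in> ideal_gen e" "y \<in> ideal_gen e"
    and eq: "\<And>\<phi>. \<phi> \<in> lathom e \<Longrightarrow> \<phi> x = \<phi> y"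
  shows "x = y"
proof (rule le_antisym)
  show "x \<sqsubseteq> y" "y \<sqsubseteq> x"
    by (rule separation[OF e xy], simp add: eq) (rule separation[OF e xy(2,1)], simp add: eq)
qed (use xy ideal_gen_carrier in auto)

text \<open>The constant one in the bounds matters: it lets a homomorphism estimate the modulus of
  each value on A by its value at e, without further constants.\<close>

lemma common_ideal:
  assumes "finite A" "A \<subseteq> carrier X"
  obtains e where "e \<in> carrier X" "\<zero> \<sqsubseteq> e" "\<And>a. a \<in> A \<Longrightarrow> a \<sqsubseteq> e \<and> (-1) \<odot> a \<sqsubseteq> e"
proof -
  have "\<exists>e\<in>carrier X. \<zero> \<sqsubseteq> e \<and> (\<forall>a\<in>A. a \<sqsubseteq> e \<and> (-1) \<odot> a \<sqsubseteq> e)"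
    using assms
  proof (induction A)
    case empty then show ?case by (auto intro!: bexI[of _ \<zero>])
  next
    case (insert a A)
    then obtain e where e: "e \<in> carrier X" "\<zero> \<sqsubseteq> e" "\<forall>a\<in>A. a \<sqsubseteq> e \<and> (-1) \<odot> a \<sqsubseteq> e" by auto
    have a: "a \<in> carrier X" "A \<subseteq> carrier X" using insert by auto
    let ?e = "e \<squnion> vabs X a"
    have up: "b \<sqsubseteq> ?e" if "b \<sqsubseteq> e \<or> b \<sqsubseteq> vabs X a" "b \<in> carrier X" for b
      using that a e join_left[of e "vabs X a"] join_right[of e "vabs X a"] le_trans[of b e ?e] le_trans[of b "vabs X a" ?e]
      by auto
    have "\<forall>b\<in>insert a A. b \<sqsubseteq> ?e \<and> (-1) \<odot> b \<sqsubseteq> ?e"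
      using e(3) a le_vabs[of a] by (auto intro!: up)
    moreover have "\<zero> \<sqsubseteq> ?e" using e by (intro up) auto
    ultimately show ?case using a e by (intro bexI[of _ ?e]) auto
  qed
  then show ?thesis using that by blast
qed

lemma common_ideal':
  assumes "finite A" "A \<subseteq> carrier X"
  obtains e where "e \<in> carrier X" "\<zero> \<sqsubseteq> e" "A \<subseteq> ideal_gen e"
proof -
  obtain e where e: "e \<in> carrier X" "\<zero> \<sqsubseteq> e" "\<And>a. a \<in> A \<Longrightarrow> a \<sqsubseteq> e \<and> (-1) \<odot> a \<sqsubseteq> e"
    using common_ideal[OF assms] by blast
  then have "A \<subseteq> ideal_gen e" using assms(2) ideal_genI[OF e(1,2), of _ 1] by (auto simp: scale_one)
  then show ?thesis using that e by blast
qed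

text \<open>In the tail y - b \<le> y - s l \<le> |s l - y|, and the last modulus has small norm, so
  order bounds survive norm limits by the Archimedean property.\<close>

lemma norm_limit_le:
  assumes s: "\<And>l. s l \<in> carrier X" and y: "y \<in> carrier X" and b: "b \<in> carrier X"
    and lim: "(\<lambda>l. vnorm X (s l \<oplus> (-1) \<odot> y)) \<longlonglongrightarrow> 0"
    and le: "\<And>l. N \<le> l \<Longrightarrow> s l \<sqsubseteq> b"
  shows "y \<sqsubseteq> b"
proof -
  have "y \<oplus> (-1) \<odot> b \<sqsubseteq> \<zero>"
  proof (rule archimedean[OF _ zero_closed])
    fix c :: real assume "0 < c"
    then obtain M where M: "\<And>l. M \<le> l \<Longrightarrow> \<bar>vnorm X (s l \<oplus> (-1) \<odot> y)\<bar> < c"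
      using LIMSEQ_D[OF lim] by auto
    define l where "l = max M N"
    define d where "d = s l \<oplus> (-1) \<odot> y"
    have d: "d \<in> carrier X" using s y by (simp add: d_def)
    have "vnorm X (vabs X d) \<le> vnorm X d"
      using d by (intro norm_lattice) (auto simp: vabs_eq vabs_nonneg)
    then have nd: "vnorm X (vabs X d) \<le> c" using M[of l] by (simp add: l_def d_def)
    have "y \<oplus> (-1) \<odot> s l = (-1) \<odot> d"
      using s y by (simp add: d_def scale_add_right scale_scale scale_one add_commute)
    then have 1: "y \<oplus> (-1) \<odot> s l \<sqsubseteq> vabs X d" using le_vabs(2)[OF d] by simp
    have "(-1) \<odot> b \<sqsubseteq> (-1) \<odot> s l" using le[of l] s b by (simp add: neg_le_iff l_def)
    then have "y \<oplus> (-1) \<odot> b \<sqsubseteq> y \<oplus> (-1) \<odot> s l" using s b y by (intro add_mono2) auto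
    then have "y \<oplus> (-1) \<odot> b \<sqsubseteq> vabs X d" using le_trans[OF _ 1] s b y d by simp
    then show "\<exists>d\<in>carrier X. \<zero> \<sqsubseteq> d \<and> y \<oplus> (-1) \<odot> b \<sqsubseteq> d \<and> vnorm X d \<le> c"
      using d nd vabs_nonneg by (intro bexI[of _ "vabs X d"]) auto
  qed (use y b in auto)
  then have "(y \<oplus> (-1) \<odot> b) \<oplus> b \<sqsubseteq> \<zero> \<oplus> b" using y b by (intro add_mono) auto
  moreover have "(y \<oplus> (-1) \<odot> b) \<oplus> b = y"
    using vs.add_cancel_right[of y "(-1) \<odot> b"] y b by (simp add: neg_neg)
  ultimately show ?thesis using b by (simp add: vs.zero_left)
qed

end

section \<open>Existence of the Krivine calculus\<close>

definition sumabs :: "nat \<Rightarrow> (nat \<Rightarrow> real) \<Rightarrow> real" where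
  "sumabs n t = (\<Sum>i=1..n. \<bar>t i\<bar>)"

lemma sumabs_nonneg: "0 \<le> sumabs n t"
  by (simp add: sumabs_def sum_nonneg)

lemma hc_continuous: "h \<in> homogeneous_cont n \<Longrightarrow> continuous_on UNIV h"
  and hc_cong: "h \<in> homogeneous_cont n \<Longrightarrow> (\<And>i. i \<in> {1..n} \<Longrightarrow> s i = t i) \<Longrightarrow> h s = h t"
  and hc_scale: "h \<in> homogeneous_cont n \<Longrightarrow> 0 \<le> c \<Longrightarrow> h (\<lambda>i. c * t i) = c * h t"
  unfolding homogeneous_cont_def by blast+

lemma homogeneous_contI:
  assumes "continuous_on UNIV h" "\<And>s t. (\<And>i. i \<in> {1..n} \<Longrightarrow> s i = t i) \<Longrightarrow> h s = h t"
    "\<And>c t. 0 \<le> c \<Longrightarrow> h (\<lambda>i. c * t i) = c * h t"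
  shows "h \<in> homogeneous_cont n"
  using assms unfolding homogeneous_cont_def by blast

lemma homogeneous_cont_const0: "(\<lambda>t. 0) \<in> homogeneous_cont n"
  by (rule homogeneous_contI) auto

lemma homogeneous_cont_coord: "i \<in> {1..n} \<Longrightarrow> (\<lambda>t. t i) \<in> homogeneous_cont n"
  by (rule homogeneous_contI) (auto intro: continuous_on_product_coordinates)

lemma homogeneous_cont_add:
  assumes "f \<in> homogeneous_cont n" "g \<in> homogeneous_cont n"
  shows "(\<lambda>t. f t + g t) \<in> homogeneous_cont n"
  by (rule homogeneous_contI)
     (auto simp: hc_scale[OF assms(1)] hc_scale[OF assms(2)] algebra_simps
       intro!: continuous_on_add hc_continuous[OF assms(1)] hc_continuous[OF assms(2)]
         arg_cong2[where f="(+)"] hc_cong[OF assms(1)] hc_cong[OF assms(2)])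

lemma homogeneous_cont_mult:
  assumes "f \<in> homogeneous_cont n" shows "(\<lambda>t. a * f t) \<in> homogeneous_cont n"
  by (rule homogeneous_contI)
     (auto simp: hc_scale[OF assms] intro!: continuous_on_mult_left hc_continuous[OF assms] hc_cong[OF assms])

lemma homogeneous_cont_max:
  assumes "f \<in> homogeneous_cont n" "g \<in> homogeneous_cont n"
  shows "(\<lambda>t. max (f t) (g t)) \<in> homogeneous_cont n"
  by (rule homogeneous_contI)
     (auto simp: hc_scale[OF assms(1)] hc_scale[OF assms(2)] max_mult_distrib_left
       intro!: continuous_on_max hc_continuous[OF assms(1)] hc_continuous[OF assms(2)]
         arg_cong2[where f=max] hc_cong[OF assms(1)] hc_cong[OF assms(2)])

lemma homogeneous_cont_min:
  assumes "f \<in> homogeneous_cont n" "g \<in> homogeneous_cont n"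
  shows "(\<lambda>t. min (f t) (g t)) \<in> homogeneous_cont n"
  by (rule homogeneous_contI)
     (auto simp: hc_scale[OF assms(1)] hc_scale[OF assms(2)] min_mult_distrib_left
       intro!: continuous_on_min hc_continuous[OF assms(1)] hc_continuous[OF assms(2)]
         arg_cong2[where f=min] hc_cong[OF assms(1)] hc_cong[OF assms(2)])

text \<open>The vector lattice of functions generated by the coordinates. The values of a Krivine
  homomorphism on it are determined by those at the coordinates alone, and its members have explicit
  representing elements.\<close>

inductive_set latlin :: "nat \<Rightarrow> ((nat \<Rightarrow> real) \<Rightarrow> real) set" for n where
  latlin_zero: "(\<lambda>t. 0) \<in> latlin n"
| latlin_coord: "i \<in> {1..n} \<Longrightarrow> (\<lambda>t. t i) \<in> latlin n"
| latlin_add: "f \<in> latlin n \<Longrightarrow> g \<in> latlin n \<Longrightarrow> (\<lambda>t. f t + g t) \<in> latlin n"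
| latlin_mult: "f \<in> latlin n \<Longrightarrow> (\<lambda>t. a * f t) \<in> latlin n"
| latlin_max: "f \<in> latlin n \<Longrightarrow> g \<in> latlin n \<Longrightarrow> (\<lambda>t. max (f t) (g t)) \<in> latlin n"

lemma latlin_homogeneous_cont: "f \<in> latlin n \<Longrightarrow> f \<in> homogeneous_cont n"
  by (induction rule: latlin.induct)
     (auto intro: homogeneous_cont_const0 homogeneous_cont_coord homogeneous_cont_add
        homogeneous_cont_mult homogeneous_cont_max)

lemma latlin_abs: assumes "f \<in> latlin n" shows "(\<lambda>t. \<bar>f t\<bar>) \<in> latlin n"
proof -
  have "(\<lambda>t. max (f t) ((-1) * f t)) \<in> latlin n" by (intro latlin_max latlin_mult assms)
  moreover have "(\<lambda>t. max (f t) ((-1) * f t)) = (\<lambda>t. \<bar>f t\<bar>)" by (auto simp: fun_eq_iff)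
  ultimately show ?thesis by metis
qed

lemma latlin_sum: "(\<And>i. i \<in> I \<Longrightarrow> f i \<in> latlin n) \<Longrightarrow> (\<lambda>t. \<Sum>i\<in>I. f i t) \<in> latlin n"
  by (induction I rule: infinite_finite_induct) (auto intro: latlin.intros)

text \<open>Error terms are measured by the l1 norm because it is itself a lattice-linear
  expression: adding a multiple of it to an approximant does not leave
  \<open>latlin\<close>.\<close>

lemma latlin_sumabs: "sumabs n \<in> latlin n"
  using latlin_sum[of "{1..n}" "\<lambda>i t. \<bar>t i\<bar>" n] latlin_abs latlin_coord
  by (auto simp: sumabs_def[abs_def])

lemma latlin_Max:
  assumes "finite F" "F \<noteq> {}" "\<And>s. s \<in> F \<Longrightarrow> b s \<in> latlin n"
  shows "\<exists>g\<in>latlin n. \<forall>t. (\<forall>s\<in>F. b s t \<le> g t) \<and> (\<exists>s\<in>F. g t = b s t)"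
  using assms
proof (induction F rule: finite_ne_induct)
  case (singleton s) then show ?case by (intro bexI[of _ "b s"]) auto
next
  case (insert s F)
  then obtain g where g: "g \<in> latlin n" "\<forall>t. (\<forall>s\<in>F. b s t \<le> g t) \<and> (\<exists>s\<in>F. g t = b s t)" by auto
  have "(\<lambda>t. max (b s t) (g t)) \<in> latlin n" using insert g by (intro latlin_max) auto
  moreover have "(\<forall>r\<in>insert s F. b r t \<le> max (b s t) (g t)) \<and> (\<exists>r\<in>insert s F. max (b s t) (g t) = b r t)" for t
    using g(2)[rule_format, of t] by (auto simp: max_def le_max_iff_disj)
  ultimately show ?case by (intro bexI[of _ "\<lambda>t. max (b s t) (g t)"]) auto
qed

text \<open>Coordinates beyond n are fixed at zero, so that the sphere is compact in the product
  topology on all sequences.\<close>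

definition sumabs_sphere :: "nat \<Rightarrow> (nat \<Rightarrow> real) set" where
  "sumabs_sphere n = {t. sumabs n t = 1 \<and> (\<forall>i. i \<notin> {1..n} \<longrightarrow> t i = 0)}"

lemma compact_sumabs_sphere: "compact (sumabs_sphere n)"
proof -
  define C where "C = (\<Pi>\<^sub>E i\<in>UNIV. if i \<in> {1..n} then {-1..1::real} else {0})"
  have "compactin (product_topology (\<lambda>_. euclidean) UNIV) C"
    unfolding C_def by (subst compactin_PiE) auto
  then have "compact C" by (simp add: euclidean_product_topology)
  moreover have "closed (sumabs n -` {1})"
    using hc_continuous[OF latlin_homogeneous_cont[OF latlin_sumabs]] by (intro continuous_closed_vimage) (auto simp: continuous_on_eq_continuous_at)
  moreover have "sumabs_sphere n = C \<inter> sumabs n -` {1}"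
  proof -
    have "\<bar>t i\<bar> \<le> 1" if "sumabs n t = 1" "i \<in> {1..n}" for t i
      using member_le_sum[of i "{1..n}" "\<lambda>i. \<bar>t i\<bar>"] that by (simp add: sumabs_def)
    then show ?thesis unfolding sumabs_sphere_def C_def by (auto simp: PiE_iff abs_le_iff minus_le_iff) (metis empty_iff singletonD)+
  qed
  ultimately show ?thesis by (metis compact_Int_closed)
qed

text \<open>The point s does not depend on h, so several homogeneous functions can be compared at
  the same normalized point.\<close>

lemma sphere_normalize:
  assumes "sumabs n t \<noteq> 0"
  obtains s where "s \<in> sumabs_sphere n" "\<And>h. h \<in> homogeneous_cont n \<Longrightarrow> h t = sumabs n t * h s"
proof
  let ?c = "sumabs n t" let ?s = "\<lambda>i. if i \<in> {1..n} then t i / sumabs n t else 0"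
  have c: "0 < ?c" using assms sumabs_nonneg[of n t] by simp
  have "sumabs n ?s = (\<Sum>i=1..n. \<bar>t i\<bar> / ?c)" using c unfolding sumabs_def[of n ?s] by (intro sum.cong) auto
  also have "\<dots> = ?c / ?c" by (simp only: sumabs_def sum_divide_distrib)
  also have "\<dots> = 1" using c by simp
  finally show "?s \<in> sumabs_sphere n" by (simp add: sumabs_sphere_def)
  fix h assume h: "h \<in> homogeneous_cont n"
  have "h t = h (\<lambda>i. ?c * ?s i)" using c by (intro hc_cong[OF h]) auto
  then show "h t = ?c * h ?s" using hc_scale[OF h, of ?c ?s] c by simp
qed

lemma hc_zero: "h \<in> homogeneous_cont n \<Longrightarrow> sumabs n t = 0 \<Longrightarrow> h t = 0"
proof -
  assume h: "h \<in> homogeneous_cont n" and "sumabs n t = 0"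
  then have "\<forall>i\<in>{1..n}. t i = 0" by (simp add: sumabs_def sum_nonneg_eq_0_iff)
  then have "h t = h (\<lambda>i. 0 * t i)" by (intro hc_cong[OF h]) auto
  then show ?thesis using hc_scale[OF h, of 0 t] by simp
qed

text \<open>The bump at the point \<open>s\<close> of the sphere is \<open>h s\<close> times the norm minus a large multiple of the
  distance to \<open>s\<close>; finitely many bumps approximate \<open>h\<close> from below.\<close>

lemma latlin_dense:
  assumes h: "h \<in> homogeneous_cont n" and \<epsilon>: "0 < \<epsilon>"
  obtains g where "g \<in> latlin n" "\<And>t. \<bar>h t - g t\<bar> \<le> \<epsilon> * sumabs n t"
proof -
  let ?S = "sumabs_sphere n"
  \<comment> \<open>On the sphere \<open>D s\<close> is the l1 distance to s; the factor
    \<open>sumabs n t\<close> in front of s makes it positively homogeneous and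
    lattice-linear.\<close>
  define D where "D = (\<lambda>s t. \<Sum>i=1..n. \<bar>t i - sumabs n t * s i\<bar>)"
  define b where "b = (\<lambda>N s t. h s * sumabs n t - real N * D s t)"
  have bl: "b N s \<in> latlin n" for N s
  proof -
    have "(\<lambda>t. h s * sumabs n t + (- real N) * (\<Sum>i=1..n. \<bar>t i + (- s i) * sumabs n t\<bar>)) \<in> latlin n"
      by (intro latlin_add latlin_mult latlin_sum latlin_abs latlin_sumabs latlin_coord)
    then show ?thesis by (simp add: b_def[abs_def] D_def mult.commute)
  qed
  have cont: "continuous_on UNIV (b N s)" for N s
    using bl latlin_homogeneous_cont hc_continuous by blast
  have S1: "sumabs n t = 1" if "t \<in> ?S" for t using that by (simp add: sumabs_sphere_def)
  have ex: "\<exists>N. \<forall>t\<in>?S. b N s t \<le> h t + \<epsilon>" if s: "s \<in> ?S" for s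
  proof -
    define V where "V = (\<lambda>N. {t. b N s t < h t + \<epsilon>})"
    have op: "open (V N)" for N
      unfolding V_def by (intro open_Collect_less cont continuous_intros hc_continuous[OF h])
    have Dpos: "0 \<le> D s t" for t by (simp add: D_def sum_nonneg)
    \<comment> \<open>For each t some N works: either t agrees with s, or a large multiple of the
      distance beats h s - h t. Compactness then makes N uniform, since a larger N only lowers the
      bump.\<close>
    have cover: "?S \<subseteq> (\<Union>N. V N)"
    proof
      fix t assume t: "t \<in> ?S"
      show "t \<in> (\<Union>N. V N)"
      proof (cases "D s t = 0")
        case True
        then have "\<forall>i\<in>{1..n}. t i = s i" using S1[OF t] by (simp add: D_def sum_nonneg_eq_0_iff)
        then have "h t = h s" by (intro hc_cong[OF h]) auto
        then have "t \<in> V 0" using \<epsilon> S1[OF t] by (simp add: V_def b_def)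
        then show ?thesis by blast
      next
        case False
        then have "0 < D s t" using Dpos[of t] by simp
        then obtain N where "h s - h t < real N * D s t" using reals_Archimedean3 by blast
        then have "t \<in> V N" using \<epsilon> S1[OF t] by (simp add: V_def b_def)
        then show ?thesis by blast
      qed
    qed
    from cover obtain I where I: "finite I" "?S \<subseteq> (\<Union>N\<in>I. V N)"
      by (rule compactE_image[OF compact_sumabs_sphere op])
    then obtain M where M: "\<forall>N\<in>I. N \<le> M" using finite_nat_set_iff_bounded_le by auto
    have "b M s t \<le> h t + \<epsilon>" if t: "t \<in> ?S" for t
    proof -
      obtain N where N: "N \<in> I" "t \<in> V N" using I t by blast
      have "real N * D s t \<le> real M * D s t" using M N Dpos by (intro mult_right_mono) auto
      then show ?thesis using N by (simp add: V_def b_def)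
    qed
    then show ?thesis by blast
  qed
  then obtain N where N: "\<And>s t. s \<in> ?S \<Longrightarrow> t \<in> ?S \<Longrightarrow> b (N s) s t \<le> h t + \<epsilon>" by metis
  have "\<exists>g\<in>latlin n. \<forall>t\<in>?S. \<bar>h t - g t\<bar> \<le> \<epsilon>"
  proof (cases "?S = {}")
    case True then show ?thesis using latlin_zero by auto
  next
    case False
    define U where "U = (\<lambda>s. {t. h t - \<epsilon> < b (N s) s t})"
    have op: "open (U s)" for s
      unfolding U_def by (intro open_Collect_less cont continuous_intros hc_continuous[OF h])
    \<comment> \<open>At s itself the bump equals h s, so it exceeds h - \<epsilon> near s.\<close>
    have "s \<in> U s" if "s \<in> ?S" for s
      using S1[OF that] \<epsilon> by (simp add: U_def b_def D_def)
    then have "?S \<subseteq> (\<Union>s\<in>?S. U s)" by blast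
    then obtain F where F: "F \<subseteq> ?S" "finite F" "?S \<subseteq> (\<Union>s\<in>F. U s)"
      by (rule compactE_image[OF compact_sumabs_sphere op])
    then have "F \<noteq> {}" using False by auto
    then obtain g where g: "g \<in> latlin n" "\<forall>t. (\<forall>s\<in>F. b (N s) s t \<le> g t) \<and> (\<exists>s\<in>F. g t = b (N s) s t)"
      using latlin_Max[OF F(2), of "\<lambda>s. b (N s) s"] bl by blast
    have "\<bar>h t - g t\<bar> \<le> \<epsilon>" if t: "t \<in> ?S" for t
    proof -
      obtain s where s: "s \<in> F" "t \<in> U s" using F t by blast
      have "b (N s) s t \<le> g t" using s(1) g(2) by blast
      then have 1: "h t - \<epsilon> < g t" using s(2) by (simp add: U_def)
      obtain r where "r \<in> F" "g t = b (N r) r t" using g(2) by blast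
      then have "g t \<le> h t + \<epsilon>" using N F(1) t by auto
      with 1 show ?thesis by simp
    qed
    with g(1) show ?thesis by blast
  qed
  then obtain g where g: "g \<in> latlin n" "\<And>t. t \<in> ?S \<Longrightarrow> \<bar>h t - g t\<bar> \<le> \<epsilon>" by blast
  have "\<bar>h t - g t\<bar> \<le> \<epsilon> * sumabs n t" for t
  proof (cases "sumabs n t = 0")
    case True
    then show ?thesis using hc_zero[OF h] hc_zero[OF latlin_homogeneous_cont[OF g(1)]] by simp
  next
    case False
    then obtain s where s: "s \<in> ?S" "\<And>h. h \<in> homogeneous_cont n \<Longrightarrow> h t = sumabs n t * h s"
      using sphere_normalize by blast
    have "\<bar>h t - g t\<bar> = sumabs n t * \<bar>h s - g s\<bar>"
      using s(2)[OF h] s(2)[OF latlin_homogeneous_cont[OF g(1)]] sumabs_nonneg[of n t]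
      by (simp add: right_diff_distrib[symmetric] abs_mult)
    also have "\<dots> \<le> sumabs n t * \<epsilon>" using g(2)[OF s(1)] sumabs_nonneg by (intro mult_left_mono)
    finally show ?thesis by (simp add: mult.commute)
  qed
  with g(1) show ?thesis using that by blast
qed

section \<open>Representing elements and Krivine's homomorphism\<close>

context banach_lattice
begin

text \<open>Pointwise description of a value of the calculus, tested by all homomorphisms of one
  ideal. Separation makes such a y unique, so the laws of the calculus reduce to laws of real
  functions.\<close>

definition represents :: "'a \<Rightarrow> (nat \<Rightarrow> 'a) \<Rightarrow> ((nat \<Rightarrow> real) \<Rightarrow> real) \<Rightarrow> 'a \<Rightarrow> bool" where
  "represents e x g y \<longleftrightarrow> y \<in> ideal_gen e \<and> (\<forall>\<phi>\<in>lathom e. \<phi> y = g (\<lambda>i. \<phi> (x i)))"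

context
  fixes e and x :: "nat \<Rightarrow> 'a"
  assumes e: "e \<in> carrier X" "\<zero> \<sqsubseteq> e"
begin

lemma represents_zero: "represents e x (\<lambda>t. 0) \<zero>"
  using e by (simp add: represents_def lathom_zero ideal_gen_zero)

lemma represents_coord: "x i \<in> ideal_gen e \<Longrightarrow> represents e x (\<lambda>t. t i) (x i)"
  by (simp add: represents_def)

lemma represents_add: "represents e x f u \<Longrightarrow> represents e x g v \<Longrightarrow> represents e x (\<lambda>t. f t + g t) (u \<oplus> v)"
  using e by (simp add: represents_def lathom_add ideal_gen_add)

lemma represents_scale: "represents e x f u \<Longrightarrow> represents e x (\<lambda>t. a * f t) (a \<odot> u)"
  using e by (simp add: represents_def lathom_scale ideal_gen_scale)

lemma represents_max: "represents e x f u \<Longrightarrow> represents e x g v \<Longrightarrow> represents e x (\<lambda>t. max (f t) (g t)) (u \<squnion> v)"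
  using e by (simp add: represents_def lathom_join ideal_gen_join)

lemma represents_min: "represents e x f u \<Longrightarrow> represents e x g v \<Longrightarrow> represents e x (\<lambda>t. min (f t) (g t)) (u \<sqinter> v)"
  using e by (simp add: represents_def lathom_meet ideal_gen_meet)

lemma represents_unique:
  assumes "represents e x g u" "represents e x g v" shows "u = v"
proof (rule separation_eq[OF e])
  show "u \<in> ideal_gen e" "v \<in> ideal_gen e" using assms by (simp_all add: represents_def)
  show "\<phi> u = \<phi> v" if "\<phi> \<in> lathom e" for \<phi>
    using assms that unfolding represents_def by metis
qed

end

context
  fixes e and n :: nat and x :: "nat \<Rightarrow> 'a"
  assumes e: "e \<in> carrier X" "\<zero> \<sqsubseteq> e" and x: "x \<in> {1..n} \<rightarrow> ideal_gen e"
begin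

lemma krivine_hom_mono:
  assumes \<tau>: "krivine_hom X n x \<tau>" and gh: "g \<in> homogeneous_cont n" "h \<in> homogeneous_cont n"
    and le: "\<And>t. g t \<le> h t"
  shows "\<tau> g \<sqsubseteq> \<tau> h"
proof -
  have "(\<lambda>t. max (g t) (h t)) = h" using le by (auto simp: fun_eq_iff max_def)
  then have "\<tau> h = \<tau> g \<squnion> \<tau> h" using \<tau> gh unfolding krivine_hom_def by metis
  moreover have "\<tau> g \<in> carrier X" "\<tau> h \<in> carrier X" using \<tau> gh unfolding krivine_hom_def by blast+
  ultimately show ?thesis using join_left by metis
qed

lemma krivine_hom_latlin:
  assumes \<tau>: "krivine_hom X n x \<tau>" and g: "g \<in> latlin n"
  shows "represents e x g (\<tau> g)"
  using g
proof (induction rule: latlin.induct)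
  case latlin_zero
  have "\<tau> (\<lambda>t. a * f t) = a \<odot> \<tau> f \<and> \<tau> f \<in> carrier X" if "f \<in> homogeneous_cont n" for a f
    using \<tau> that unfolding krivine_hom_def by blast
  from this[OF homogeneous_cont_const0, of 0] have "\<tau> (\<lambda>t. 0) = \<zero>"
    using vs.scale_0 by (metis mult_zero_left)
  then show ?case using represents_zero[OF e] by simp
next
  case (latlin_coord i)
  then have "\<tau> (\<lambda>t. t i) = x i" using \<tau> unfolding krivine_hom_def by blast
  then show ?case using represents_coord[where x = x and i = i, OF e funcset_mem[OF x latlin_coord]] by simp
next
  case (latlin_add f g)
  then have "\<tau> (\<lambda>t. f t + g t) = \<tau> f \<oplus> \<tau> g"
    using \<tau> latlin_homogeneous_cont unfolding krivine_hom_def by blast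
  then show ?case using represents_add[OF e latlin_add.IH] by simp
next
  case (latlin_mult f a)
  then have "\<tau> (\<lambda>t. a * f t) = a \<odot> \<tau> f"
    using \<tau> latlin_homogeneous_cont unfolding krivine_hom_def by blast
  then show ?case using represents_scale[OF e latlin_mult.IH] by simp
next
  case (latlin_max f g)
  then have "\<tau> (\<lambda>t. max (f t) (g t)) = \<tau> f \<squnion> \<tau> g"
    using \<tau> latlin_homogeneous_cont unfolding krivine_hom_def by blast
  then show ?case using represents_max[OF e latlin_max.IH] by simp
qed

text \<open>The axioms in \<open>krivine_hom\<close> contain no continuity. It is automatic: h lies
  between lattice-linear functions that differ by a small multiple of \<open>sumabs n\<close>, and a
  lattice homomorphism preserves order.\<close>

lemma krivine_hom_eval:
  assumes \<tau>: "krivine_hom X n x \<tau>" and h: "h \<in> homogeneous_cont n"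
  shows "represents e x h (\<tau> h)"
proof -
  have sandwich: "\<exists>a b. a \<in> latlin n \<and> b \<in> latlin n \<and> \<tau> a \<sqsubseteq> \<tau> h \<and> \<tau> h \<sqsubseteq> \<tau> b
      \<and> (\<forall>t. a t \<le> h t \<and> h t \<le> b t \<and> b t \<le> a t + 2 * \<epsilon> * sumabs n t)" if \<epsilon>: "0 < \<epsilon>" for \<epsilon>
  proof -
    obtain g where g: "g \<in> latlin n" "\<And>t. \<bar>h t - g t\<bar> \<le> \<epsilon> * sumabs n t" using latlin_dense[OF h \<epsilon>] by blast
    define a where "a = (\<lambda>t. g t + (- \<epsilon>) * sumabs n t)"
    define b where "b = (\<lambda>t. g t + \<epsilon> * sumabs n t)"
    have ab: "a \<in> latlin n" "b \<in> latlin n"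
      unfolding a_def b_def by (intro latlin_add latlin_mult latlin_sumabs g)+
    have le: "a t \<le> h t" "h t \<le> b t" for t using g(2)[of t] unfolding a_def b_def by (simp_all add: abs_le_iff)
    have "\<tau> a \<sqsubseteq> \<tau> h" "\<tau> h \<sqsubseteq> \<tau> b"
      using le by (auto intro!: krivine_hom_mono[OF \<tau>] h latlin_homogeneous_cont ab)
    moreover have "b t \<le> a t + 2 * \<epsilon> * sumabs n t" for t by (simp add: a_def b_def)
    ultimately show ?thesis using ab le by blast
  qed
  have hc: "\<tau> h \<in> carrier X" using \<tau> h unfolding krivine_hom_def by blast
  obtain a b where "a \<in> latlin n" "b \<in> latlin n" "\<tau> a \<sqsubseteq> \<tau> h" "\<tau> h \<sqsubseteq> \<tau> b" using sandwich[of 1] by auto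
  then have I: "\<tau> h \<in> ideal_gen e"
    using krivine_hom_latlin[OF \<tau>] hc ideal_gen_interval[OF e] unfolding represents_def by blast
  have "\<phi> (\<tau> h) = h (\<lambda>i. \<phi> (x i))" if \<phi>: "\<phi> \<in> lathom e" for \<phi>
  proof -
    let ?t = "\<lambda>i. \<phi> (x i)"
    have "\<bar>\<phi> (\<tau> h) - h ?t\<bar> \<le> 0 + \<epsilon>" if \<epsilon>: "0 < \<epsilon>" for \<epsilon>
    proof -
      \<comment> \<open>The factor 2 matches the width of the sandwich; the added 1 covers the case
        where all coordinates vanish.\<close>
      define d where "d = \<epsilon> / (2 * (sumabs n ?t + 1))"
      have d: "0 < d" "2 * d * sumabs n ?t \<le> \<epsilon>"
        using \<epsilon> sumabs_nonneg[of n ?t] by (auto simp: d_def field_simps intro!: divide_pos_pos add_nonneg_pos)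
      obtain a b where ab: "a \<in> latlin n" "b \<in> latlin n" "\<tau> a \<sqsubseteq> \<tau> h" "\<tau> h \<sqsubseteq> \<tau> b"
        "\<forall>t. a t \<le> h t \<and> h t \<le> b t \<and> b t \<le> a t + 2 * d * sumabs n t" using sandwich[OF d(1)] by blast
      have "\<tau> a \<in> ideal_gen e" "\<tau> b \<in> ideal_gen e" "\<phi> (\<tau> a) = a ?t" "\<phi> (\<tau> b) = b ?t"
        using krivine_hom_latlin[OF \<tau>] ab \<phi> unfolding represents_def by blast+
      then have "a ?t \<le> \<phi> (\<tau> h)" "\<phi> (\<tau> h) \<le> b ?t"
        using lathom_mono[OF e \<phi>] I ab by metis+
      moreover have "a ?t \<le> h ?t" "h ?t \<le> b ?t" "b ?t \<le> a ?t + 2 * d * sumabs n ?t" using ab(5) by blast+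
      ultimately show ?thesis using d(2) by linarith
    qed
    then have "\<bar>\<phi> (\<tau> h) - h ?t\<bar> \<le> 0" by (rule field_le_epsilon)
    then show ?thesis by simp
  qed
  with I show ?thesis by (simp add: represents_def)
qed

lemma latlin_represented: "g \<in> latlin n \<Longrightarrow> \<exists>y. represents e x g y"
proof (induction rule: latlin.induct)
  case (latlin_coord i)
  then show ?case using represents_coord[where x = x and i = i, OF e] funcset_mem[OF x] by blast
qed (blast intro: represents_zero[OF e] represents_add[OF e] represents_scale[OF e] represents_max[OF e])+

end

text \<open>Lattice-linear approximants of h have representing elements that are Cauchy relative to
  multiples of e, hence in norm. The limit inherits the order bounds, and these carry the value of h
  to every homomorphism, none of which is assumed to be norm continuous.\<close>

lemma hc_represented:
  assumes e: "e \<in> carrier X" "\<zero> \<sqsubseteq> e"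
    and x: "\<And>i. i \<in> {1..n} \<Longrightarrow> x i \<in> carrier X \<and> x i \<sqsubseteq> e \<and> (-1) \<odot> x i \<sqsubseteq> e"
    and h: "h \<in> homogeneous_cont n"
  shows "\<exists>y. represents e x h y"
proof -
  have xI: "x i \<in> ideal_gen e" if "i \<in> {1..n}" for i
    using x[OF that] ideal_genI[OF e, of _ 1] e by (simp add: scale_one)
  have sle: "sumabs n (\<lambda>i. \<phi> (x i)) \<le> real n * \<phi> e" if \<phi>: "\<phi> \<in> lathom e" for \<phi>
  proof -
    have "\<bar>\<phi> (x i)\<bar> \<le> \<phi> e" if i: "i \<in> {1..n}" for i
    proof -
      have "\<phi> (x i) \<le> \<phi> e" "\<phi> ((-1) \<odot> x i) \<le> \<phi> e"
        using x[OF i] xI[OF i] ideal_gen_self[OF e] ideal_gen_scale[OF e]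
        by (auto intro!: lathom_mono[OF e \<phi>])
      then show ?thesis using lathom_scale[OF e \<phi> xI[OF i]] by (simp add: abs_le_iff)
    qed
    then have "sumabs n (\<lambda>i. \<phi> (x i)) \<le> (\<Sum>i=1..n. \<phi> e)" unfolding sumabs_def by (intro sum_mono)
    then show ?thesis by simp
  qed
  \<comment> \<open>The approximation error 1 / (k + 1) times the factor n from the bound of the l1
    norm of the arguments by n times the value at e.\<close>
  define c where "c = (\<lambda>k::nat. 1 / (real k + 1) * real n)"
  have cpos: "0 \<le> c k" for k by (simp add: c_def)
  have "\<exists>y\<in>ideal_gen e. \<forall>\<phi>\<in>lathom e. \<bar>\<phi> y - h (\<lambda>i. \<phi> (x i))\<bar> \<le> c k * \<phi> e" for k
  proof -
    obtain g where g: "g \<in> latlin n" "\<And>t. \<bar>h t - g t\<bar> \<le> (1 / (real k + 1)) * sumabs n t"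
      using latlin_dense[OF h, of "1 / (real k + 1)"] by auto
    have "x \<in> {1..n} \<rightarrow> ideal_gen e" using xI by blast
    then obtain y where y: "y \<in> ideal_gen e" "\<forall>\<phi>\<in>lathom e. \<phi> y = g (\<lambda>i. \<phi> (x i))"
      using latlin_represented[OF e _ g(1)] unfolding represents_def by blast
    have "\<bar>\<phi> y - h (\<lambda>i. \<phi> (x i))\<bar> \<le> c k * \<phi> e" if \<phi>: "\<phi> \<in> lathom e" for \<phi>
    proof -
      have "\<bar>\<phi> y - h (\<lambda>i. \<phi> (x i))\<bar> \<le> (1 / (real k + 1)) * sumabs n (\<lambda>i. \<phi> (x i))"
        using g(2)[of "\<lambda>i. \<phi> (x i)"] y(2) \<phi> by (simp add: abs_minus_commute)
      also have "\<dots> \<le> (1 / (real k + 1)) * (real n * \<phi> e)" by (intro mult_left_mono sle \<phi>) auto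
      finally show ?thesis by (simp add: c_def)
    qed
    then show ?thesis using y(1) by blast
  qed
  then obtain y where y: "\<And>k. y k \<in> ideal_gen e"
    and yh: "\<And>k \<phi>. \<phi> \<in> lathom e \<Longrightarrow> \<bar>\<phi> (y k) - h (\<lambda>i. \<phi> (x i))\<bar> \<le> c k * \<phi> e" by metis
  have yc: "y k \<in> carrier X" for k using y ideal_gen_carrier by blast
  have le: "y k \<sqsubseteq> y l \<oplus> (c k + c l) \<odot> e" for k l
  proof (rule separation[OF e y])
    show "y l \<oplus> (c k + c l) \<odot> e \<in> ideal_gen e"
      using e y by (intro ideal_gen_add ideal_gen_scale ideal_gen_self)
    fix \<phi> assume \<phi>: "\<phi> \<in> lathom e"
    show "\<phi> (y k) \<le> \<phi> (y l \<oplus> (c k + c l) \<odot> e)"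
      using yh[OF \<phi>, of k] yh[OF \<phi>, of l] y
      by (simp add: lathom_add[OF e \<phi>] lathom_scale[OF e \<phi>] ideal_gen_self[OF e] ideal_gen_scale[OF e]
          abs_le_iff algebra_simps)
  qed
  have diff_le: "y k \<oplus> (-1) \<odot> y l \<sqsubseteq> (c k + c l) \<odot> e" for k l
    using le[of k l] diff_le_iff yc e by simp
  have clim: "c \<longlonglongrightarrow> 0"
  proof -
    have "(\<lambda>k. 1 / (real k + 1)) \<longlonglongrightarrow> 0" using LIMSEQ_inverse_real_of_nat by (simp add: inverse_eq_divide add.commute)
    then have "(\<lambda>k. 1 / (real k + 1) * real n) \<longlonglongrightarrow> 0 * real n" by (intro tendsto_mult tendsto_const)
    then show ?thesis by (simp add: c_def[abs_def])
  qed
  have cauchy: "vnorm X (y k \<oplus> (-1) \<odot> y l) \<le> (c k + c l) * vnorm X e" for k l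
  proof -
    have "vabs X (y k \<oplus> (-1) \<odot> y l) \<sqsubseteq> (c k + c l) \<odot> e"
      unfolding vabs_def
    proof (rule join_le)
      have "(-1) \<odot> (y k \<oplus> (-1) \<odot> y l) = y l \<oplus> (-1) \<odot> y k"
        using yc by (simp add: scale_add_right neg_neg add_commute)
      then show "(-1) \<odot> (y k \<oplus> (-1) \<odot> y l) \<sqsubseteq> (c k + c l) \<odot> e" using diff_le[of l k] by (simp add: add.commute)
    qed (use yc e diff_le[of k l] in auto)
    moreover have "vabs X ((c k + c l) \<odot> e) = (c k + c l) \<odot> e"
      using e cpos by (intro vabs_eq scale_nonneg) (auto intro: add_nonneg_nonneg)
    ultimately have "vnorm X (y k \<oplus> (-1) \<odot> y l) \<le> vnorm X ((c k + c l) \<odot> e)"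
      using yc e by (intro norm_lattice) auto
    then show ?thesis using e cpos by (simp add: norm_scale)
  qed
  have "\<exists>z\<in>carrier X. (\<lambda>k. vnorm X (y k \<oplus> (-1) \<odot> z)) \<longlonglongrightarrow> 0"
  proof (rule norm_complete[OF yc], intro allI impI)
    fix \<epsilon> :: real assume \<epsilon>: "0 < \<epsilon>"
    define d where "d = \<epsilon> / (2 * (vnorm X e + 1))"
    have ne: "0 \<le> vnorm X e" using norm_nonneg e by simp
    then have d: "0 < d" using \<epsilon> by (simp add: d_def)
    then obtain N where N: "\<And>k. N \<le> k \<Longrightarrow> \<bar>c k\<bar> < d" using LIMSEQ_D[OF clim] by auto
    have "vnorm X (y k \<oplus> (-1) \<odot> y l) < \<epsilon>" if "N \<le> k" "N \<le> l" for k l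
    proof -
      have "(c k + c l) * vnorm X e \<le> (2 * d) * vnorm X e"
        using N[OF that(1)] N[OF that(2)] ne by (intro mult_right_mono) auto
      also have "\<dots> < \<epsilon>" using ne \<epsilon> by (simp add: d_def field_simps)
      finally show ?thesis using cauchy[of k l] by simp
    qed
    then show "\<exists>N. \<forall>k\<ge>N. \<forall>l\<ge>N. vnorm X (y k \<oplus> (-1) \<odot> y l) < \<epsilon>" by blast
  qed
  then obtain z where z: "z \<in> carrier X" and lim: "(\<lambda>k. vnorm X (y k \<oplus> (-1) \<odot> z)) \<longlonglongrightarrow> 0" by blast
  \<comment> \<open>The doubled constant absorbs c l, which is at most c k in the tail.\<close>
  have upper: "z \<sqsubseteq> y k \<oplus> (2 * c k) \<odot> e" for k
  proof (rule norm_limit_le[OF yc z _ lim])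
    fix l assume "k \<le> l"
    then have "c l \<le> c k" by (auto simp: c_def intro!: divide_left_mono)
    then have "(c l + c k) \<odot> e \<sqsubseteq> (2 * c k) \<odot> e" using e by (intro scale_mono_left) auto
    then have "y k \<oplus> (c l + c k) \<odot> e \<sqsubseteq> y k \<oplus> (2 * c k) \<odot> e" using yc e by (intro add_mono2) auto
    then show "y l \<sqsubseteq> y k \<oplus> (2 * c k) \<odot> e" using le_trans[OF le[of l k]] yc e by simp
  qed (use yc e in auto)
  have lower: "y k \<sqsubseteq> z \<oplus> (2 * c k) \<odot> e" for k
  proof -
    \<comment> \<open>The limit is taken in y k - y l, which tends to y k - z; an upper bound for it
      is the desired lower bound for z.\<close>
    have "(\<lambda>l. vnorm X ((y k \<oplus> (-1) \<odot> y l) \<oplus> (-1) \<odot> (y k \<oplus> (-1) \<odot> z))) \<longlonglongrightarrow> 0"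
    proof -
      have "vnorm X ((y k \<oplus> (-1) \<odot> y l) \<oplus> (-1) \<odot> (y k \<oplus> (-1) \<odot> z)) = vnorm X (y l \<oplus> (-1) \<odot> z)" for l
      proof -
        have "(y k \<oplus> (-1) \<odot> y l) \<oplus> (-1) \<odot> (y k \<oplus> (-1) \<odot> z) = (-1) \<odot> (y l \<oplus> (-1) \<odot> z)"
          using yc z by (simp add: scale_add_right vs.add_add_add_comm add_neg vs.zero_left)
        then show ?thesis using yc z norm_scale[of _ "-1"] by simp
      qed
      then show ?thesis using lim by simp
    qed
    then have "y k \<oplus> (-1) \<odot> z \<sqsubseteq> (2 * c k) \<odot> e"
    proof (rule norm_limit_le[rotated 3])
      fix l assume "k \<le> l"
      then have "c l \<le> c k" by (auto simp: c_def intro!: divide_left_mono)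
      then have "(c k + c l) \<odot> e \<sqsubseteq> (2 * c k) \<odot> e" using e by (intro scale_mono_left) auto
      then show "y k \<oplus> (-1) \<odot> y l \<sqsubseteq> (2 * c k) \<odot> e"
        using le_trans[OF diff_le[of k l]] yc e by simp
    qed (use yc z e in auto)
    then show ?thesis using diff_le_iff yc z e by simp
  qed
  have zI: "z \<in> ideal_gen e"
  proof (rule ideal_gen_interval[OF e _ _ _ upper[of 0] z])
    show "y 0 \<oplus> (-1) \<odot> (2 * c 0) \<odot> e \<in> ideal_gen e" "y 0 \<oplus> (2 * c 0) \<odot> e \<in> ideal_gen e"
      using y e by (simp_all add: ideal_gen_add ideal_gen_scale ideal_gen_self)
    show "y 0 \<oplus> (-1) \<odot> (2 * c 0) \<odot> e \<sqsubseteq> z"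
      using lower[of 0] diff_le_iff[of "y 0" "(2 * c 0) \<odot> e" z] yc e z add_commute by simp
  qed
  have "\<phi> z = h (\<lambda>i. \<phi> (x i))" if \<phi>: "\<phi> \<in> lathom e" for \<phi>
  proof -
    \<comment> \<open>Two units of c k come from the passage to the limit and one from the
      approximant.\<close>
    have b: "\<bar>\<phi> z - h (\<lambda>i. \<phi> (x i))\<bar> \<le> 3 * \<phi> e * c k" for k
    proof -
      have "\<phi> z \<le> \<phi> (y k \<oplus> (2 * c k) \<odot> e)" "\<phi> (y k) \<le> \<phi> (z \<oplus> (2 * c k) \<odot> e)"
        using upper lower zI y by (auto intro!: lathom_mono[OF e \<phi>] simp: ideal_gen_add[OF e] ideal_gen_scale[OF e] ideal_gen_self[OF e])
      then have "\<phi> z \<le> \<phi> (y k) + 2 * c k * \<phi> e" "\<phi> (y k) \<le> \<phi> z + 2 * c k * \<phi> e"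
        using zI y by (simp_all add: lathom_add[OF e \<phi>] lathom_scale[OF e \<phi>] ideal_gen_scale[OF e] ideal_gen_self[OF e])
      then show ?thesis using yh[OF \<phi>, of k] by (simp add: abs_le_iff algebra_simps)
    qed
    have "(\<lambda>k. 3 * \<phi> e * c k) \<longlonglongrightarrow> 3 * \<phi> e * 0" by (intro tendsto_mult tendsto_const clim)
    then have "\<bar>\<phi> z - h (\<lambda>i. \<phi> (x i))\<bar> \<le> 3 * \<phi> e * 0"
      using b by (intro LIMSEQ_le_const) auto
    then show ?thesis by simp
  qed
  with zI show ?thesis unfolding represents_def by blast
qed

text \<open>Any choice of representing elements satisfies the homomorphism laws, because both sides
  of each law represent the same function.\<close>

lemma krivine_hom_exists:
  assumes x: "\<And>i. i \<in> {1..n} \<Longrightarrow> x i \<in> carrier X"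
  shows "\<exists>\<tau>. krivine_hom X n x \<tau>"
proof -
  obtain e where e: "e \<in> carrier X" "\<zero> \<sqsubseteq> e" and xe: "\<And>a. a \<in> x ` {1..n} \<Longrightarrow> a \<sqsubseteq> e \<and> (-1) \<odot> a \<sqsubseteq> e"
    using common_ideal[of "x ` {1..n}"] x by blast
  have "\<exists>y. represents e x h y" if "h \<in> homogeneous_cont n" for h
    using x xe by (intro hc_represented[OF e _ that]) auto
  then obtain \<tau> where \<tau>: "\<And>h. h \<in> homogeneous_cont n \<Longrightarrow> represents e x h (\<tau> h)" by metis
  have xI: "x i \<in> ideal_gen e" if "i \<in> {1..n}" for i
    using x[OF that] xe that ideal_genI[OF e, of _ 1] e by (simp add: scale_one)
  note unique = represents_unique[OF e \<tau>]
  have "krivine_hom X n x \<tau>"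
    unfolding krivine_hom_def
  proof (intro conjI ballI allI)
    fix h assume h: "h \<in> homogeneous_cont n"
    show "\<tau> h \<in> carrier X" using \<tau>[OF h] ideal_gen_carrier unfolding represents_def by blast
    show "\<tau> (\<lambda>t. a * h t) = a \<odot> \<tau> h" for a
      by (rule unique[OF homogeneous_cont_mult[OF h] represents_scale[OF e \<tau>[OF h]]])
    fix g assume g: "g \<in> homogeneous_cont n"
    show "\<tau> (\<lambda>t. h t + g t) = \<tau> h \<oplus> \<tau> g"
      by (rule unique[OF homogeneous_cont_add[OF h g] represents_add[OF e \<tau>[OF h] \<tau>[OF g]]])
    show "\<tau> (\<lambda>t. max (h t) (g t)) = \<tau> h \<squnion> \<tau> g"
      by (rule unique[OF homogeneous_cont_max[OF h g] represents_max[OF e \<tau>[OF h] \<tau>[OF g]]])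
    show "\<tau> (\<lambda>t. min (h t) (g t)) = \<tau> h \<sqinter> \<tau> g"
      by (rule unique[OF homogeneous_cont_min[OF h g] represents_min[OF e \<tau>[OF h] \<tau>[OF g]]])
  next
    fix i assume i: "i \<in> {1..n}"
    show "\<tau> (\<lambda>t. t i) = x i"
      by (rule unique[OF homogeneous_cont_coord[OF i] represents_coord[where x = x and i = i, OF e xI[OF i]]])
  qed
  then show ?thesis by blast
qed

text \<open>Any ideal containing the arguments may be used, so that several expressions of the
  calculus can be compared through the homomorphisms of one common ideal. Uniqueness of the
  represented element makes the definite description in \<open>krivine\<close> denote.\<close>

theorem krivine_eval:
  assumes e: "e \<in> carrier X" "\<zero> \<sqsubseteq> e" and x: "x \<in> {1..n} \<rightarrow> ideal_gen e"
    and h: "h \<in> homogeneous_cont n"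
  shows "krivine X n x h \<in> ideal_gen e" and "\<phi> \<in> lathom e \<Longrightarrow> \<phi> (krivine X n x h) = h (\<lambda>i. \<phi> (x i))"
proof -
  have "x i \<in> carrier X" if "i \<in> {1..n}" for i using funcset_mem[OF x that] by (rule ideal_gen_carrier)
  then obtain \<tau> where \<tau>: "krivine_hom X n x \<tau>" using krivine_hom_exists by blast
  have eq: "\<sigma> h = \<tau> h" if \<sigma>: "krivine_hom X n x \<sigma>" for \<sigma>
    by (rule represents_unique[OF e krivine_hom_eval[OF e x \<sigma> h] krivine_hom_eval[OF e x \<tau> h]])
  have "krivine X n x h = \<tau> h" unfolding krivine_def
  proof (rule the_equality)
    show "\<exists>\<sigma>. krivine_hom X n x \<sigma> \<and> \<tau> h = \<sigma> h" using \<tau> by blast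
    show "y = \<tau> h" if "\<exists>\<sigma>. krivine_hom X n x \<sigma> \<and> y = \<sigma> h" for y using that eq by blast
  qed
  then show "krivine X n x h \<in> ideal_gen e" "\<phi> \<in> lathom e \<Longrightarrow> \<phi> (krivine X n x h) = h (\<lambda>i. \<phi> (x i))"
    using krivine_hom_eval[OF e x \<tau> h] by (auto simp: represents_def)
qed

end

section \<open>The concavification and its dual ball\<close>

lemma signed_powr_inverse: "0 < s \<Longrightarrow> signed_powr (signed_powr a s) (1 / s) = a"
  by (cases a "0::real" rule: linorder_cases) (auto simp: signed_powr_def sgn_mult abs_mult powr_powr)

lemma signed_powr_inverse': "0 < s \<Longrightarrow> signed_powr (signed_powr a (1 / s)) s = a"
  using signed_powr_inverse[of "1 / s" a] by simp

lemma signed_powr_mult: "signed_powr (a * b) s = signed_powr a s * signed_powr b s"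
  by (simp add: signed_powr_def sgn_mult abs_mult powr_mult)

lemma signed_powr_nonneg: "0 \<le> a \<Longrightarrow> signed_powr a s = a powr s"
  by (cases "a = 0") (auto simp: signed_powr_def)

text \<open>A form that shows continuity: \<open>sgn\<close> jumps at zero, whereas the powers of
  the positive and the negative part are continuous there for a positive exponent.\<close>

lemma signed_powr_eq_diff: "signed_powr a s = max a 0 powr s - max (- a) 0 powr s"
  by (cases a "0::real" rule: linorder_cases) (auto simp: signed_powr_def)

lemma continuous_on_signed_powr:
  assumes "0 < s" "continuous_on A f" shows "continuous_on A (\<lambda>x. signed_powr (f x) s)"
  unfolding signed_powr_eq_diff using assms
  by (intro continuous_on_diff continuous_on_powr' continuous_on_max continuous_on_minus continuous_on_const) auto

lemma signed_powr_0 [simp]: "signed_powr 0 s = 0"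
  by (simp add: signed_powr_def)

lemma signed_powr_1 [simp]: "signed_powr 1 s = 1"
  by (simp add: signed_powr_def)

lemma signed_powr_minus: "signed_powr (- a) s = - signed_powr a s"
  by (simp add: signed_powr_def sgn_minus)

lemma signed_powr_nonpos: "a \<le> 0 \<Longrightarrow> signed_powr a s \<le> 0"
  by (simp add: signed_powr_eq_diff)

lemma signed_powr_le: "signed_powr a s \<le> max a 0 powr s"
  unfolding signed_powr_eq_diff by simp

lemma power_mean_nonneg: "0 \<le> power_mean n p t"
  by (simp add: power_mean_def)

lemma power_mean_powr: "0 < p \<Longrightarrow> power_mean n p t powr p = (\<Sum>k=1..n. \<bar>t k\<bar> powr p)"
  by (simp add: power_mean_def powr_powr sum_nonneg)

lemma power_mean_homogeneous_cont:
  assumes p: "0 < p" shows "power_mean n p \<in> homogeneous_cont n"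
proof (rule homogeneous_contI)
  show "continuous_on UNIV (power_mean n p)"
    unfolding power_mean_def[abs_def] using p
    by (intro continuous_on_powr' continuous_on_sum continuous_on_const continuous_on_rabs continuous_on_product_coordinates)
       (auto intro: sum_nonneg)
  show "power_mean n p s = power_mean n p t" if "\<And>i. i \<in> {1..n} \<Longrightarrow> s i = t i" for s t
    using that by (simp add: power_mean_def)
  show "power_mean n p (\<lambda>i. c * t i) = c * power_mean n p t" if "0 \<le> c" for c t
  proof -
    have "(\<Sum>k=1..n. \<bar>c * t k\<bar> powr p) = c powr p * (\<Sum>k=1..n. \<bar>t k\<bar> powr p)"
      using that by (simp add: abs_mult powr_mult sum_distrib_left)
    then show ?thesis using that p by (simp add: power_mean_def powr_mult powr_powr sum_nonneg)
  qed
qed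

definition concave_sum :: "real \<Rightarrow> (nat \<Rightarrow> real) \<Rightarrow> real" where
  "concave_sum p t = signed_powr (signed_powr (t 1) p + signed_powr (t 2) p) (1 / p)"

lemma concave_sum_homogeneous_cont:
  assumes p: "0 < p" shows "concave_sum p \<in> homogeneous_cont 2"
proof (rule homogeneous_contI)
  show "continuous_on UNIV (concave_sum p)"
    unfolding concave_sum_def[abs_def] using p
    by (intro continuous_on_signed_powr continuous_on_add continuous_on_product_coordinates) auto
  show "concave_sum p s = concave_sum p t" if "\<And>i. i \<in> {1..2} \<Longrightarrow> s i = t i" for s t
    using that by (simp add: concave_sum_def)
  show "concave_sum p (\<lambda>i. c * t i) = c * concave_sum p t" if "0 \<le> c" for c t
    using p signed_powr_inverse[of p c]
    by (simp add: concave_sum_def signed_powr_mult distrib_left[symmetric])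
qed

lemma closedin_Collect_Ball:
  assumes "\<And>i. i \<in> I \<Longrightarrow> closedin T {z \<in> topspace T. Q i z}"
  shows "closedin T {z \<in> topspace T. \<forall>i\<in>I. Q i z}"
proof -
  have "{z \<in> topspace T. \<forall>i\<in>I. Q i z} = \<Inter> (insert (topspace T) ((\<lambda>i. {z \<in> topspace T. Q i z}) ` I))"
    by auto
  moreover have "closedin T (\<Inter> (insert (topspace T) ((\<lambda>i. {z \<in> topspace T. Q i z}) ` I)))"
    using assms by (intro closedin_Inter) auto
  ultimately show ?thesis by simp
qed

section \<open>Algebra and norm of the concavification\<close>

locale p_convex_lattice = banach_lattice +
  fixes p :: real
  assumes p1: "1 \<le> p" and convex: "p_convex1 X p"
begin

abbreviation Xp :: "'a normed_lattice" where "Xp \<equiv> concavification X p"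

lemma concavification_simps [simp]:
  "carrier Xp = carrier X" "le Xp = le X" "vzero Xp = vzero X"
  "vscale Xp a x = vscale X (signed_powr a (1 / p)) x" "vnorm Xp x = vnorm X x powr p"
  by (simp_all add: concavification_def)

lemma vadd_concavification: "vadd Xp x y = krivine X 2 (\<lambda>i. if i = 1 then x else y) (concave_sum p)"
  by (simp add: concavification_def concave_sum_def[abs_def])

lemma p_pos: "0 < p" using p1 by simp

context
  fixes e assumes e: "e \<in> carrier X" "\<zero> \<sqsubseteq> e"
begin

lemma conc_add_ideal: "x \<in> ideal_gen e \<Longrightarrow> y \<in> ideal_gen e \<Longrightarrow> vadd Xp x y \<in> ideal_gen e"
  unfolding vadd_concavification
  by (rule krivine_eval(1)[OF e _ concave_sum_homogeneous_cont[OF p_pos]]) auto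

lemma lathom_conc_add:
  assumes "x \<in> ideal_gen e" "y \<in> ideal_gen e" "\<phi> \<in> lathom e"
  shows "\<phi> (vadd Xp x y) = signed_powr (signed_powr (\<phi> x) p + signed_powr (\<phi> y) p) (1 / p)"
proof -
  have "\<phi> (vadd Xp x y) = concave_sum p (\<lambda>i. \<phi> (if i = 1 then x else y))"
    unfolding vadd_concavification
    by (rule krivine_eval(2)[OF e _ concave_sum_homogeneous_cont[OF p_pos] assms(3)]) (use assms in auto)
  then show ?thesis by (simp add: concave_sum_def)
qed

lemma power_mean_ideal: "x \<in> {1..n} \<rightarrow> ideal_gen e \<Longrightarrow> lattice_power_mean X n p x \<in> ideal_gen e"
  unfolding lattice_power_mean_def by (rule krivine_eval(1)[OF e _ power_mean_homogeneous_cont[OF p_pos]])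

lemma lathom_power_mean:
  "x \<in> {1..n} \<rightarrow> ideal_gen e \<Longrightarrow> \<phi> \<in> lathom e \<Longrightarrow>
     \<phi> (lattice_power_mean X n p x) = power_mean n p (\<lambda>i. \<phi> (x i))"
  unfolding lattice_power_mean_def by (rule krivine_eval(2)[OF e _ power_mean_homogeneous_cont[OF p_pos]])

text \<open>Each lattice homomorphism \<open>\<phi>\<close> turns into the functional $x \mapsto \varphi(x)^p$ (signed power), which
  is linear on the concavification.\<close>

lemma separation_eq_powr:
  assumes "x \<in> ideal_gen e" "y \<in> ideal_gen e"
    and "\<And>\<phi>. \<phi> \<in> lathom e \<Longrightarrow> signed_powr (\<phi> x) p = signed_powr (\<phi> y) p"
  shows "x = y"
  using assms(3) by (intro separation_eq[OF e assms(1,2)]) (metis signed_powr_inverse[OF p_pos])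

lemma powr_conc_add:
  "x \<in> ideal_gen e \<Longrightarrow> y \<in> ideal_gen e \<Longrightarrow> \<phi> \<in> lathom e \<Longrightarrow>
    signed_powr (\<phi> (vadd Xp x y)) p = signed_powr (\<phi> x) p + signed_powr (\<phi> y) p"
  by (simp add: lathom_conc_add signed_powr_inverse'[OF p_pos])

lemma powr_conc_scale:
  "x \<in> ideal_gen e \<Longrightarrow> \<phi> \<in> lathom e \<Longrightarrow>
    signed_powr (\<phi> (signed_powr a (1 / p) \<odot> x)) p = a * signed_powr (\<phi> x) p"
  by (simp add: lathom_scale[OF e] signed_powr_mult signed_powr_inverse'[OF p_pos])

end

lemma conc_add_closed: "x \<in> carrier X \<Longrightarrow> y \<in> carrier X \<Longrightarrow> vadd Xp x y \<in> carrier X"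
  using common_ideal'[of "{x, y}"] conc_add_ideal ideal_gen_carrier
  by (metis empty_subsetI finite.emptyI finite_insert insert_subset)

lemma power_mean_closed: "x \<in> {1..n} \<rightarrow> carrier X \<Longrightarrow> lattice_power_mean X n p x \<in> carrier X"
proof -
  assume x: "x \<in> {1..n} \<rightarrow> carrier X"
  obtain e where e: "e \<in> carrier X" "\<zero> \<sqsubseteq> e" "x ` {1..n} \<subseteq> ideal_gen e"
    using common_ideal'[of "x ` {1..n}"] x by blast
  then have "x \<in> {1..n} \<rightarrow> ideal_gen e" by blast
  then show ?thesis using power_mean_ideal[OF e(1,2)] ideal_gen_carrier by blast
qed

lemma power_mean_pos: "x \<in> {1..n} \<rightarrow> carrier X \<Longrightarrow> \<zero> \<sqsubseteq> lattice_power_mean X n p x"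
proof -
  assume x: "x \<in> {1..n} \<rightarrow> carrier X"
  obtain e where e: "e \<in> carrier X" "\<zero> \<sqsubseteq> e" "x ` {1..n} \<subseteq> ideal_gen e"
    using common_ideal'[of "x ` {1..n}"] x by blast
  then have x: "x \<in> {1..n} \<rightarrow> ideal_gen e" by blast
  show ?thesis
    by (rule separation[OF e(1,2) ideal_gen_zero[OF e(1,2)] power_mean_ideal[OF e(1,2) x]])
       (simp add: lathom_zero[OF e(1,2)] lathom_power_mean[OF e(1,2) x] power_mean_nonneg)
qed

text \<open>Each law involves at most three elements, which lie in a common principal ideal; most
  laws become identities of real numbers there after passing to signed p-th powers, and the
  remaining ones are laws of the original scalar multiplication.\<close>

lemma real_vspace_concavification: "real_vspace (carrier X) (vadd Xp) (vscale Xp) (vzero X)"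
proof -
  have eqs: "vadd Xp x \<zero> = x" "vadd Xp x (vscale Xp (-1) x) = \<zero>" "vadd Xp x y = vadd Xp y x"
    "vscale Xp (a + b) x = vadd Xp (vscale Xp a x) (vscale Xp b x)"
    "vscale Xp a (vadd Xp x y) = vadd Xp (vscale Xp a x) (vscale Xp a y)"
    "vadd Xp (vadd Xp x y) z = vadd Xp x (vadd Xp y z)"
    if xyz: "x \<in> carrier X" "y \<in> carrier X" "z \<in> carrier X" for x y z a b
  proof -
    have "finite {x, y, z}" "{x, y, z} \<subseteq> carrier X" using xyz by auto
    then obtain e where e: "e \<in> carrier X" "\<zero> \<sqsubseteq> e" and I: "{x, y, z} \<subseteq> ideal_gen e" by (rule common_ideal')
    have neg: "signed_powr (\<phi> (signed_powr (-1) (1 / p) \<odot> x)) p = - signed_powr (\<phi> x) p" if "\<phi> \<in> lathom e" for \<phi>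
      using powr_conc_scale[OF e _ that, of x "-1"] I by simp
    note simps = conc_add_ideal[OF e] ideal_gen_scale[OF e] ideal_gen_zero[OF e] powr_conc_add[OF e]
      powr_conc_scale[OF e] lathom_zero[OF e] neg
    show "vadd Xp x \<zero> = x" "vadd Xp x (vscale Xp (-1) x) = \<zero>" "vadd Xp x y = vadd Xp y x"
      "vscale Xp (a + b) x = vadd Xp (vscale Xp a x) (vscale Xp b x)"
      "vscale Xp a (vadd Xp x y) = vadd Xp (vscale Xp a x) (vscale Xp a y)"
      "vadd Xp (vadd Xp x y) z = vadd Xp x (vadd Xp y z)"
      by (rule separation_eq_powr[OF e]; use I in \<open>simp add: simps algebra_simps\<close>)+
  qed
  show ?thesis
    by standard
       ((rule eqs zero_closed conc_add_closed; assumption) | (simp add: scale_scale signed_powr_mult scale_one; fail))+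
qed

lemma power_mean_0: "lattice_power_mean X 0 p x = \<zero>"
  by (rule separation_eq[OF zero_closed le_refl power_mean_ideal ideal_gen_zero])
     (auto simp: lathom_power_mean[OF zero_closed] lathom_zero[OF zero_closed] power_mean_def)

text \<open>The power mean is an iterated concavified sum of moduli. Functionals that are additive
  on the concavification can therefore be evaluated on it.\<close>

lemma power_mean_Suc:
  assumes x: "x \<in> {1..Suc n} \<rightarrow> carrier X"
  shows "lattice_power_mean X (Suc n) p x = vadd Xp (lattice_power_mean X n p x) (vabs X (x (Suc n)))"
proof -
  obtain e where e: "e \<in> carrier X" "\<zero> \<sqsubseteq> e" "x ` {1..Suc n} \<subseteq> ideal_gen e"
    using common_ideal'[of "x ` {1..Suc n}"] x by blast
  then have xI: "x \<in> {1..Suc n} \<rightarrow> ideal_gen e" by blast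
  then have xI': "x \<in> {1..n} \<rightarrow> ideal_gen e" "x (Suc n) \<in> ideal_gen e" by auto
  note e = e(1,2)
  show ?thesis
  proof (rule separation_eq_powr[OF e power_mean_ideal[OF e xI]
        conc_add_ideal[OF e power_mean_ideal[OF e xI'(1)] ideal_gen_vabs[OF e xI'(2)]]])
    fix \<phi> assume \<phi>: "\<phi> \<in> lathom e"
    show "signed_powr (\<phi> (lattice_power_mean X (Suc n) p x)) p
      = signed_powr (\<phi> (vadd Xp (lattice_power_mean X n p x) (vabs X (x (Suc n))))) p"
      using \<phi> xI xI' e p_pos
      by (simp add: powr_conc_add power_mean_ideal ideal_gen_vabs lathom_power_mean lathom_vabs signed_powr_nonneg
          power_mean_nonneg power_mean_powr)
  qed
qed

lemma norm_pos_mono: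
  assumes "\<zero> \<sqsubseteq> x" "x \<sqsubseteq> y" "x \<in> carrier X" "y \<in> carrier X" shows "vnorm X x \<le> vnorm X y"
  using assms le_trans[of \<zero> x y] by (intro norm_lattice) (auto simp: vabs_eq)

lemma norm_vabs: "x \<in> carrier X \<Longrightarrow> vnorm X (vabs X x) = vnorm X x"
  by (intro antisym norm_lattice) (auto simp: vabs_eq vabs_nonneg)

lemma norm_power_mean:
  assumes "x \<in> {1..n} \<rightarrow> carrier X"
  shows "vnorm X (lattice_power_mean X n p x) powr p \<le> (\<Sum>k=1..n. vnorm X (x k) powr p)"
proof (cases "n = 0")
  case True then show ?thesis using norm_eq_zero[of \<zero>] p_pos by (simp add: power_mean_0)
next
  case False
  have "vnorm X (lattice_power_mean X n p x) \<le> (\<Sum>k=1..n. vnorm X (x k) powr p) powr (1 / p)"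
    using convex assms False unfolding p_convex1_def by simp
  then have "vnorm X (lattice_power_mean X n p x) powr p \<le> ((\<Sum>k=1..n. vnorm X (x k) powr p) powr (1 / p)) powr p"
    using p_pos norm_nonneg power_mean_closed[OF assms] by (intro powr_mono2) auto
  then show ?thesis using p_pos by (simp add: powr_powr sum_nonneg)
qed

text \<open>Tested by homomorphisms, the positive part of the concavified sum lies below the power
  mean of the two positive parts, and the convexity inequality controls the norm of that
  mean.\<close>

lemma conc_add_positive_part:
  assumes x: "x \<in> carrier X" and y: "y \<in> carrier X"
  shows "vnorm X (vadd Xp x y \<squnion> \<zero>) powr p \<le> vnorm X (x \<squnion> \<zero>) powr p + vnorm X (y \<squnion> \<zero>) powr p"
proof -
  define w where "w = (\<lambda>i::nat. if i = 1 then x \<squnion> \<zero> else y \<squnion> \<zero>)"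
  have w: "w \<in> {1..2} \<rightarrow> carrier X" using x y by (auto simp: w_def)
  have "finite {x, y}" "{x, y} \<subseteq> carrier X" using x y by auto
  then obtain e where e: "e \<in> carrier X" "\<zero> \<sqsubseteq> e" and "{x, y} \<subseteq> ideal_gen e" by (rule common_ideal')
  then have I: "x \<in> ideal_gen e" "y \<in> ideal_gen e" by auto
  note z = ideal_gen_zero[OF e]
  have wI: "w \<in> {1..2} \<rightarrow> ideal_gen e" using I z e by (auto simp: w_def ideal_gen_join)
  have "vadd Xp x y \<squnion> \<zero> \<sqsubseteq> lattice_power_mean X 2 p w"
  proof (rule separation[OF e])
    show "vadd Xp x y \<squnion> \<zero> \<in> ideal_gen e" using I z by (intro ideal_gen_join e conc_add_ideal)
    show "lattice_power_mean X 2 p w \<in> ideal_gen e" by (rule power_mean_ideal[OF e wI])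
    fix \<phi> assume \<phi>: "\<phi> \<in> lathom e"
    define a b where "a = \<phi> x" and "b = \<phi> y"
    define u v where "u = signed_powr a p + signed_powr b p" and "v = max a 0 powr p + max b 0 powr p"
    have uv: "u \<le> v" "0 \<le> v" unfolding u_def v_def using signed_powr_le[of a p] signed_powr_le[of b p] by simp_all
    \<comment> \<open>A negative u has a nonpositive root, so monotonicity of the power is called
      upon only for u \<ge> 0.\<close>
    have "signed_powr u (1 / p) \<le> v powr (1 / p)"
    proof (cases "0 \<le> u")
      case True
      then show ?thesis using uv p_pos by (simp add: signed_powr_nonneg powr_mono2)
    next
      case False
      then have "signed_powr u (1 / p) \<le> 0" by (intro signed_powr_nonpos) auto
      also have "0 \<le> v powr (1 / p)" by simp
      finally show ?thesis .
    qed
    moreover have "{1..2::nat} = {1, 2}" by auto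
    ultimately show "\<phi> (vadd Xp x y \<squnion> \<zero>) \<le> \<phi> (lattice_power_mean X 2 p w)"
      using I \<phi> e z unfolding lathom_power_mean[OF e wI \<phi>]
      by (simp add: lathom_join conc_add_ideal lathom_zero lathom_conc_add power_mean_def
          w_def a_def b_def u_def v_def)
  qed
  then have "vnorm X (vadd Xp x y \<squnion> \<zero>) \<le> vnorm X (lattice_power_mean X 2 p w)"
    using x y power_mean_closed[OF w] conc_add_closed[OF x y] by (intro norm_pos_mono) (auto simp: join_right)
  then have "vnorm X (vadd Xp x y \<squnion> \<zero>) powr p \<le> vnorm X (lattice_power_mean X 2 p w) powr p"
    using p_pos norm_nonneg conc_add_closed[OF x y] by (intro powr_mono2) auto
  also have "\<dots> \<le> (\<Sum>k=1..2. vnorm X (w k) powr p)" by (rule norm_power_mean[OF w])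
  also have "\<dots> = vnorm X (x \<squnion> \<zero>) powr p + vnorm X (y \<squnion> \<zero>) powr p"
    by (simp add: w_def numeral_2_eq_2)
  finally show ?thesis .
qed

lemma scale_positive_part:
  assumes "0 \<le> c" "x \<in> carrier X" shows "c \<odot> x \<squnion> \<zero> = c \<odot> (x \<squnion> \<zero>)"
proof -
  obtain e where e: "e \<in> carrier X" "\<zero> \<sqsubseteq> e" and I: "x \<in> ideal_gen e"
    using common_ideal'[of "{x}"] assms by auto
  note z = ideal_gen_zero[OF e]
  show ?thesis
    by (rule separation_eq[OF e])
       (use assms z e I in \<open>simp_all add: ideal_gen_join ideal_gen_scale lathom_join lathom_scale lathom_zero max_mult_distrib_left\<close>)
qed

section \<open>The positive dual ball: norming functionals and weak-star compactness\<close>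

abbreviation "pball \<equiv> positive_dual_ball Xp"

text \<open>The supremum in \<open>dual_norm\<close> is informative only over a set that is bounded
  above, so the continuity bound of the functional is used before it. In the concavification the
  normalizing scalar of x is the reciprocal of the p-th power of its norm.\<close>

lemma dual_unit_ball_iff:
  assumes lin: "\<psi> \<in> dual_space Xp"
  shows "dual_norm Xp \<psi> \<le> 1 \<longleftrightarrow> (\<forall>x\<in>carrier X. \<bar>\<psi> x\<bar> \<le> vnorm X x powr p)"
proof
  assume n: "dual_norm Xp \<psi> \<le> 1"
  obtain c where c: "\<forall>x\<in>carrier X. \<bar>\<psi> x\<bar> \<le> c * vnorm X x powr p" using lin by (auto simp: dual_space_def)
  have "\<bar>\<psi> x\<bar> \<le> \<bar>c\<bar>" if "x \<in> carrier X" "vnorm X x powr p \<le> 1" for x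
  proof -
    have "\<bar>\<psi> x\<bar> \<le> c * vnorm X x powr p" using c that by blast
    also have "\<dots> \<le> \<bar>c\<bar> * vnorm X x powr p" by (intro mult_right_mono) auto
    also have "\<dots> \<le> \<bar>c\<bar> * 1" using that by (intro mult_left_mono) auto
    finally show ?thesis by simp
  qed
  then have bdd: "bdd_above ((\<lambda>x. \<bar>\<psi> x\<bar>) ` {x \<in> carrier Xp. vnorm Xp x \<le> 1})"
    by (intro bdd_aboveI[of _ "\<bar>c\<bar>"]) auto
  have le1: "\<bar>\<psi> x\<bar> \<le> 1" if "x \<in> carrier X" "vnorm X x powr p \<le> 1" for x
    using n cSUP_upper[OF _ bdd, of x] that unfolding dual_norm_def by simp
  show "\<forall>x\<in>carrier X. \<bar>\<psi> x\<bar> \<le> vnorm X x powr p"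
  proof
    fix x assume x: "x \<in> carrier X"
    have hom: "\<psi> (signed_powr a (1 / p) \<odot> x) = a * \<psi> x" for a
      using lin x by (simp add: dual_space_def)
    show "\<bar>\<psi> x\<bar> \<le> vnorm X x powr p"
    proof (cases "vnorm X x = 0")
      case True
      then have "x = \<zero>" using norm_eq_zero x by simp
      then show ?thesis using hom[of 0] by (simp add: vs.scale_zero)
    next
      case False
      then have pos: "0 < vnorm X x" using norm_nonneg[OF x] by simp
      define a where "a = 1 / vnorm X x powr p"
      have a: "0 < a" using pos by (simp add: a_def)
      have "vnorm X (signed_powr a (1 / p) \<odot> x) powr p = 1"
        using x a pos p_pos
        by (simp add: norm_scale signed_powr_nonneg powr_mult powr_powr norm_nonneg) (simp add: a_def)
      then have "\<bar>a * \<psi> x\<bar> \<le> 1" using le1[of "signed_powr a (1 / p) \<odot> x"] x hom by simp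
      then show ?thesis using pos by (simp add: a_def abs_mult field_simps)
    qed
  qed
next
  have "\<zero> \<in> {x \<in> carrier Xp. vnorm Xp x \<le> 1}" using norm_eq_zero[of \<zero>] p_pos by simp
  then have ne: "{x \<in> carrier Xp. vnorm Xp x \<le> 1} \<noteq> {}" by blast
  assume "\<forall>x\<in>carrier X. \<bar>\<psi> x\<bar> \<le> vnorm X x powr p"
  then show "dual_norm Xp \<psi> \<le> 1"
    unfolding dual_norm_def by (intro cSUP_least[OF ne]) (auto intro: order_trans)
qed

text \<open>All conditions become pointwise ones on the values of the functional, each closed in the
  product topology; the norm condition no longer mentions a supremum.\<close>

lemma ball_eq:
  "pball = {\<psi> \<in> extensional (carrier X).
      (\<forall>x\<in>carrier X. \<forall>y\<in>carrier X. \<psi> (vadd Xp x y) = \<psi> x + \<psi> y)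
    \<and> (\<forall>a. \<forall>x\<in>carrier X. \<psi> (vscale Xp a x) = a * \<psi> x)
    \<and> (\<forall>x\<in>carrier X. \<bar>\<psi> x\<bar> \<le> vnorm X x powr p)
    \<and> (\<forall>x\<in>carrier X. \<zero> \<sqsubseteq> x \<longrightarrow> 0 \<le> \<psi> x)}" (is "_ = ?R")
proof (intro Set.set_eqI iffI)
  fix \<psi> assume "\<psi> \<in> pball"
  then have d: "\<psi> \<in> dual_space Xp" and n: "dual_norm Xp \<psi> \<le> 1"
    and pos: "\<forall>x\<in>carrier X. \<zero> \<sqsubseteq> x \<longrightarrow> 0 \<le> \<psi> x"
    by (auto simp: positive_dual_ball_def)
  from dual_unit_ball_iff[OF d] n have "\<forall>x\<in>carrier X. \<bar>\<psi> x\<bar> \<le> vnorm X x powr p" by simp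
  with d pos show "\<psi> \<in> ?R" unfolding dual_space_def by simp
next
  fix \<psi> assume R: "\<psi> \<in> ?R"
  then have d: "\<psi> \<in> dual_space Xp" unfolding dual_space_def by (auto intro!: exI[of _ 1])
  from R d show "\<psi> \<in> pball" unfolding positive_dual_ball_def using dual_unit_ball_iff[OF d] by simp
qed

text \<open>The majorant is the p-th power of the norm of the positive part, not of x itself. It
  vanishes at negative elements, so a linear functional below it is positive, and it stays below the
  p-th power of the norm, which gives the bound.\<close>

lemma ball_norming:
  assumes u: "u \<in> carrier X" "\<zero> \<sqsubseteq> u"
  obtains \<psi> where "\<psi> \<in> pball" "\<psi> u = vnorm X u powr p"
proof -
  interpret C: real_vspace "carrier X" "vadd Xp" "vscale Xp" "vzero X" by (rule real_vspace_concavification)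
  define P where "P = (\<lambda>x. vnorm X (x \<squnion> \<zero>) powr p)"
  have P: "C.sublin P"
  proof (rule C.sublinI)
    show "P (vadd Xp x y) \<le> P x + P y" if "x \<in> carrier X" "y \<in> carrier X" for x y
      using that unfolding P_def by (rule conc_add_positive_part)
    have "\<zero> \<squnion> \<zero> = \<zero>" using le_iff_meet[of \<zero> \<zero>] by simp
    then show "P \<zero> = 0" using norm_eq_zero[of \<zero>] p_pos by (simp add: P_def)
    fix c :: real and x assume c: "0 < c" and x: "x \<in> carrier X"
    then show "P (vscale Xp c x) \<le> c * P x"
      using p_pos
      by (simp add: P_def signed_powr_nonneg scale_positive_part norm_scale powr_mult powr_powr norm_nonneg)
  qed
  have "C.max_rel (\<lambda>x y z. False)" "C.preserves_max (\<lambda>x y z. False) P"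
    by (auto simp: C.max_rel_def C.preserves_max_def)
  from P this u(1)
  obtain L where L: "C.linear_on_V L" "\<And>x. x \<in> carrier X \<Longrightarrow> L x \<le> P x" "L u = P u"
    by (rule C.hahn_banach) blast
  have neg: "L ((-1) \<odot> x) = - L x" if "x \<in> carrier X" for x
  proof -
    have "L (vscale Xp (-1) x) = (-1) * L x" using L(1) that unfolding C.linear_on_V_def by blast
    then show ?thesis by (simp add: signed_powr_minus)
  qed
  have Ple: "P x \<le> vnorm X x powr p" if x: "x \<in> carrier X" for x
  proof -
    have "x \<squnion> \<zero> \<sqsubseteq> vabs X x" using x le_vabs vabs_nonneg by (intro join_le) auto
    then have "vnorm X (x \<squnion> \<zero>) \<le> vnorm X (vabs X x)" using x by (intro norm_pos_mono) (auto simp: join_right)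
    then show ?thesis unfolding P_def using x p_pos norm_nonneg by (intro powr_mono2) (auto simp: norm_vabs)
  qed
  have abs: "\<bar>L x\<bar> \<le> vnorm X x powr p" if x: "x \<in> carrier X" for x
    using L(2)[OF x] Ple[OF x] L(2)[of "(-1) \<odot> x"] Ple[of "(-1) \<odot> x"] x neg[OF x]
    by (simp add: norm_scale abs_le_iff)
  have pos: "0 \<le> L x" if x: "x \<in> carrier X" "\<zero> \<sqsubseteq> x" for x
  proof -
    have "(-1) \<odot> x \<sqsubseteq> \<zero>" using neg_le_iff[of x \<zero>] x by (simp add: vs.scale_zero)
    then have "(-1) \<odot> x \<squnion> \<zero> = \<zero>" using x le_iff_meet[of "(-1) \<odot> x" \<zero>] by simp
    then have "P ((-1) \<odot> x) = 0" unfolding P_def using norm_eq_zero[of \<zero>] p_pos by simp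
    then show ?thesis using L(2)[of "(-1) \<odot> x"] neg[OF x(1)] x by simp
  qed
  have lin: "L (vadd Xp x y) = L x + L y" "L (vscale Xp a x) = a * L x"
    if "x \<in> carrier X" "y \<in> carrier X" for a x y
    using L(1) that unfolding C.linear_on_V_def by blast+
  have "restrict L (carrier X) \<in> pball"
    unfolding ball_eq using lin abs pos conc_add_closed by (auto simp del: concavification_simps(4) intro!: C.scale_in)
  moreover have "P u = vnorm X u powr p"
  proof -
    have "u \<squnion> \<zero> = u" using u by (intro le_antisym join_le join_left) auto
    then show ?thesis by (simp add: P_def)
  qed
  ultimately show ?thesis using that L(3) u by simp
qed

context
  fixes \<psi> assumes \<psi>: "\<psi> \<in> pball"
begin

lemma ball_add: "x \<in> carrier X \<Longrightarrow> y \<in> carrier X \<Longrightarrow> \<psi> (vadd Xp x y) = \<psi> x + \<psi> y"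
  and ball_scale: "x \<in> carrier X \<Longrightarrow> \<psi> (vscale Xp a x) = a * \<psi> x"
  and ball_bound: "x \<in> carrier X \<Longrightarrow> \<psi> x \<le> vnorm X x powr p"
  and ball_pos: "x \<in> carrier X \<Longrightarrow> \<zero> \<sqsubseteq> x \<Longrightarrow> 0 \<le> \<psi> x"
  using \<psi> unfolding ball_eq by (auto simp: abs_le_iff)

lemma ball_vabs_nonneg: "x \<in> carrier X \<Longrightarrow> 0 \<le> \<psi> (vabs X x)"
  by (intro ball_pos) (auto simp: vabs_nonneg)

lemma ball_vabs_bound: "x \<in> carrier X \<Longrightarrow> \<psi> (vabs X x) \<le> vnorm X x powr p"
  using ball_bound[of "vabs X x"] norm_vabs by simp

lemma ball_vabs_scale: "x \<in> carrier X \<Longrightarrow> \<psi> (vabs X (c \<odot> x)) = \<bar>c\<bar> powr p * \<psi> (vabs X x)"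
proof -
  assume x: "x \<in> carrier X"
  obtain e where e: "e \<in> carrier X" "\<zero> \<sqsubseteq> e" and I: "x \<in> ideal_gen e"
    using common_ideal'[of "{x}"] x by auto
  have "vabs X (c \<odot> x) = \<bar>c\<bar> \<odot> vabs X x"
    by (rule separation_eq[OF e])
       (use e I in \<open>simp_all add: ideal_gen_vabs ideal_gen_scale lathom_vabs lathom_scale abs_mult\<close>)
  also have "\<dots> = vscale Xp (\<bar>c\<bar> powr p) (vabs X x)"
    using p_pos by (simp add: signed_powr_nonneg powr_powr)
  finally show ?thesis using ball_scale[of "vabs X x" "\<bar>c\<bar> powr p"] x by simp
qed

lemma ball_power_mean:
  "x \<in> {1..n} \<rightarrow> carrier X \<Longrightarrow> \<psi> (lattice_power_mean X n p x) = (\<Sum>k=1..n. \<psi> (vabs X (x k)))"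
proof (induction n)
  case 0
  then show ?case using ball_scale[of \<zero> 0] by (simp add: power_mean_0 vs.scale_zero)
next
  case (Suc n)
  then have "x \<in> {1..n} \<rightarrow> carrier X" "x (Suc n) \<in> carrier X" by auto
  then show ?case using Suc by (simp add: power_mean_Suc ball_add power_mean_closed)
qed

end

definition ball_topology :: "('a \<Rightarrow> real) topology" where
  "ball_topology = subtopology (weak_star_topology Xp) pball"

lemma ball_topology_eq: "ball_topology = subtopology (powertop_real (carrier X)) pball"
proof -
  have "dual_space Xp \<inter> pball = pball" by (auto simp: positive_dual_ball_def)
  then show ?thesis by (simp add: ball_topology_def weak_star_topology_def subtopology_subtopology)
qed

lemma topspace_ball: "topspace ball_topology = pball"
  unfolding ball_topology_eq by (auto simp: ball_eq PiE_def)

lemma ball_continuous: "x \<in> carrier X \<Longrightarrow> continuous_map ball_topology euclideanreal (\<lambda>\<psi>. \<psi> x)"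
  unfolding ball_topology_eq
  by (intro continuous_map_from_subtopology continuous_map_product_projection)

lemma ball_hausdorff: "Hausdorff_space ball_topology"
  unfolding ball_topology_eq by (intro Hausdorff_space_subtopology) (simp add: Hausdorff_space_product_topology)

text \<open>Banach-Alaoglu by way of Tychonoff: the ball is a closed part of the product of the
  compact intervals allowed by the norm bound.\<close>

lemma ball_compact: "compact_space ball_topology"
proof -
  let ?T = "powertop_real (carrier X)"
  have proj: "continuous_map ?T euclideanreal (\<lambda>\<psi>. \<psi> x)" if "x \<in> carrier X" for x
    using that by (rule continuous_map_product_projection)
  have eq: "closedin ?T {\<psi> \<in> topspace ?T. f \<psi> = g \<psi>}"
    if "continuous_map ?T euclideanreal f" "continuous_map ?T euclideanreal g" for f g
    using that by (intro closedin_continuous_maps_eq[of euclideanreal]) auto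
  have pos: "closedin ?T {\<psi> \<in> topspace ?T. \<zero> \<sqsubseteq> x \<longrightarrow> 0 \<le> \<psi> x}" if "x \<in> carrier X" for x
    using closedin_continuous_map_preimage[OF proj[OF that], of "{0..}"] closedin_topspace[of ?T]
    by (cases "\<zero> \<sqsubseteq> x") simp_all
  have bnd: "closedin ?T {\<psi> \<in> topspace ?T. \<bar>\<psi> x\<bar> \<le> c}" if "x \<in> carrier X" for x c
    using closedin_continuous_map_preimage[OF proj[OF that], of "{-c..c}"] by (simp add: abs_le_iff minus_le_iff conj_commute)
  have "closedin ?T (({\<psi> \<in> topspace ?T. \<forall>x\<in>carrier X. \<forall>y\<in>carrier X. \<psi> (vadd Xp x y) = \<psi> x + \<psi> y}
      \<inter> {\<psi> \<in> topspace ?T. \<forall>a\<in>UNIV. \<forall>x\<in>carrier X. \<psi> (vscale Xp a x) = a * \<psi> x})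
      \<inter> ({\<psi> \<in> topspace ?T. \<forall>x\<in>carrier X. \<bar>\<psi> x\<bar> \<le> vnorm X x powr p}
      \<inter> {\<psi> \<in> topspace ?T. \<forall>x\<in>carrier X. \<zero> \<sqsubseteq> x \<longrightarrow> 0 \<le> \<psi> x}))"
    by (intro closedin_Int closedin_Collect_Ball eq pos bnd proj continuous_map_add continuous_map_real_mult
        continuous_map_const[THEN iffD2] conc_add_closed) auto
  also have "\<dots> = pball" unfolding ball_eq by (auto simp: PiE_def)
  finally have cl: "closedin ?T pball" .
  have "compactin ?T (\<Pi>\<^sub>E x\<in>carrier X. {- (vnorm X x powr p)..vnorm X x powr p})"
    by (simp add: compactin_PiE)
  moreover have "pball \<subseteq> (\<Pi>\<^sub>E x\<in>carrier X. {- (vnorm X x powr p)..vnorm X x powr p})"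
    unfolding ball_eq by (auto simp: PiE_def abs_le_iff minus_le_iff)
  ultimately have "compactin ?T pball" using cl by (rule closed_compactin)
  then show ?thesis unfolding ball_topology_eq by (rule compact_space_subtopology)
qed

lemma ball_nonempty: "pball \<noteq> {}"
  using ball_norming[OF zero_closed le_refl[OF zero_closed]] by blast

end

section \<open>Hoelder duality for the weighted norms\<close>

text \<open>Jensen's inequality for the exponential at the logarithms of the a j; if some a j
  vanishes, the product is zero and the sum is nonnegative.\<close>

lemma weighted_am_gm:
  fixes w a :: "'i \<Rightarrow> real"
  assumes J: "finite J" and w: "\<And>j. j \<in> J \<Longrightarrow> 0 < w j" "sum w J = 1" and a: "\<And>j. j \<in> J \<Longrightarrow> 0 \<le> a j"
  shows "(\<Prod>j\<in>J. a j powr w j) \<le> (\<Sum>j\<in>J. w j * a j)"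
proof (cases "\<exists>j\<in>J. a j = 0")
  case True
  then have "(\<Prod>j\<in>J. a j powr w j) = 0" using J by (auto simp: prod_zero_iff)
  moreover have "0 \<le> (\<Sum>j\<in>J. w j * a j)" using w a by (intro sum_nonneg mult_nonneg_nonneg) (auto intro: less_imp_le)
  ultimately show ?thesis by simp
next
  case False
  then have pos: "0 < a j" if "j \<in> J" for j using a[OF that] that by (metis less_eq_real_def)
  have ne: "J \<noteq> {}" using w(2) by auto
  have "(\<Prod>j\<in>J. a j powr w j) = (\<Prod>j\<in>J. exp (w j *\<^sub>R ln (a j)))"
  proof (rule prod.cong[OF HOL.refl])
    show "a j powr w j = exp (w j *\<^sub>R ln (a j))" if "j \<in> J" for j
      using pos[OF that] by (simp add: powr_def)
  qed
  also have "\<dots> = exp (\<Sum>j\<in>J. w j *\<^sub>R ln (a j))" by (rule exp_sum[OF J, symmetric])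
  also have "\<dots> \<le> (\<Sum>j\<in>J. w j * exp (ln (a j)))"
    using w by (intro convex_on_sum[OF J ne exp_convex]) (auto intro: less_imp_le)
  also have "\<dots> = (\<Sum>j\<in>J. w j * a j)" using pos by (intro sum.cong) auto
  finally show ?thesis .
qed

text \<open>After division by the sums A j the inequality of the means holds for each k, and its
  right sides add up to one. A vanishing A j annihilates the left side.\<close>

lemma generalized_hoelder:
  fixes w :: "'i \<Rightarrow> real" and f :: "'i \<Rightarrow> 'k \<Rightarrow> real"
  assumes J: "finite J" and I: "finite I" and w: "\<And>j. j \<in> J \<Longrightarrow> 0 < w j" "sum w J = 1"
    and f: "\<And>j k. j \<in> J \<Longrightarrow> k \<in> I \<Longrightarrow> 0 \<le> f j k"
  shows "(\<Sum>k\<in>I. \<Prod>j\<in>J. f j k powr w j) \<le> (\<Prod>j\<in>J. (\<Sum>k\<in>I. f j k) powr w j)"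
proof -
  define A where "A = (\<lambda>j. \<Sum>k\<in>I. f j k)"
  have A: "0 \<le> A j" if "j \<in> J" for j using f that by (auto simp: A_def intro: sum_nonneg)
  show ?thesis
  proof (cases "\<exists>j\<in>J. A j = 0")
    case True
    then obtain j where j: "j \<in> J" "A j = 0" by blast
    then have "f j k = 0" if "k \<in> I" for k
      using f[OF j(1)] that I sum_nonneg_eq_0_iff[of I "f j"] by (simp add: A_def)
    then have "(\<Prod>j\<in>J. f j k powr w j) = 0" if "k \<in> I" for k
      using that j J by (auto simp: prod_zero_iff intro!: bexI[of _ j])
    then have "(\<Sum>k\<in>I. \<Prod>j\<in>J. f j k powr w j) = 0" by simp
    also have "0 \<le> (\<Prod>j\<in>J. A j powr w j)" by (intro prod_nonneg) auto
    finally show ?thesis by (simp add: A_def)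
  next
    case False
    then have pos: "0 < A j" if "j \<in> J" for j using A[OF that] that by (metis less_eq_real_def)
    have le: "(\<Prod>j\<in>J. f j k powr w j) \<le> (\<Prod>j\<in>J. A j powr w j) * (\<Sum>j\<in>J. w j * (f j k / A j))" if k: "k \<in> I" for k
    proof -
      have "(\<Prod>j\<in>J. f j k powr w j) = (\<Prod>j\<in>J. A j powr w j * (f j k / A j) powr w j)"
      proof (rule prod.cong[OF HOL.refl])
        show "f j k powr w j = A j powr w j * (f j k / A j) powr w j" if "j \<in> J" for j
          using pos[OF that] by (simp flip: powr_mult)
      qed
      also have "\<dots> = (\<Prod>j\<in>J. A j powr w j) * (\<Prod>j\<in>J. (f j k / A j) powr w j)" by (rule prod.distrib)
      also have "\<dots> \<le> (\<Prod>j\<in>J. A j powr w j) * (\<Sum>j\<in>J. w j * (f j k / A j))"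
        using pos f k by (intro mult_left_mono weighted_am_gm J w prod_nonneg) (auto simp: less_imp_le)
      finally show ?thesis .
    qed
    have "(\<Sum>k\<in>I. \<Prod>j\<in>J. f j k powr w j) \<le> (\<Sum>k\<in>I. (\<Prod>j\<in>J. A j powr w j) * (\<Sum>j\<in>J. w j * (f j k / A j)))"
      by (intro sum_mono le)
    also have "\<dots> = (\<Prod>j\<in>J. A j powr w j) * (\<Sum>j\<in>J. \<Sum>k\<in>I. w j * (f j k / A j))"
      by (simp add: sum_distrib_left sum.swap[of _ J I])
    also have "(\<Sum>j\<in>J. \<Sum>k\<in>I. w j * (f j k / A j)) = (\<Sum>j\<in>J. w j * (A j / A j))"
      by (simp only: A_def sum_distrib_left sum_divide_distrib)
    also have "\<dots> = sum w J"
    proof (rule sum.cong[OF HOL.refl])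
      show "w j * (A j / A j) = w j" if "j \<in> J" for j using pos[OF that] by simp
    qed
    finally show ?thesis using w(2) by (simp add: A_def)
  qed
qed

text \<open>The choice t j = 1 / I j equalizes the terms and recovers the product from the weighted
  sum. Because I j may be zero, it is made with I j + \<epsilon>, and \<epsilon> tends to
  zero.\<close>

lemma prod_powr_le_of_scaled_sums:
  fixes w I :: "'i \<Rightarrow> real"
  assumes J: "finite J" and w: "\<And>j. j \<in> J \<Longrightarrow> 0 < w j" "sum w J = 1" and I: "\<And>j. j \<in> J \<Longrightarrow> 0 \<le> I j"
    and K: "0 \<le> K"
    and scaled: "\<And>t. (\<And>j. j \<in> J \<Longrightarrow> 0 < t j) \<Longrightarrow> (\<Prod>j\<in>J. t j powr w j) * N \<le> K * (\<Sum>j\<in>J. w j * (t j * I j))"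
  shows "N \<le> K * (\<Prod>j\<in>J. I j powr w j)"
proof -
  have eps: "N \<le> K * (\<Prod>j\<in>J. (I j + \<epsilon>) powr w j)" if \<epsilon>: "0 < \<epsilon>" for \<epsilon>
  proof -
    define t where "t = (\<lambda>j. 1 / (I j + \<epsilon>))"
    have pos: "0 < I j + \<epsilon>" if "j \<in> J" for j using I[OF that] \<epsilon> by simp
    define P where "P = (\<Prod>j\<in>J. (I j + \<epsilon>) powr w j)"
    have P: "0 < P" unfolding P_def using pos by (intro prod_pos) (auto simp: less_imp_neq[symmetric])
    have "(\<Sum>j\<in>J. w j * (t j * I j)) \<le> (\<Sum>j\<in>J. w j * 1)"
      using pos I w(1) \<epsilon> by (intro sum_mono mult_left_mono) (auto simp: t_def less_imp_le)
    also have "\<dots> = 1" using w by simp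
    finally have "K * (\<Sum>j\<in>J. w j * (t j * I j)) \<le> K * 1" using K by (rule mult_left_mono)
    then have "(\<Prod>j\<in>J. t j powr w j) * N \<le> K"
      using scaled[of t] pos by (simp add: t_def)
    moreover have "(\<Prod>j\<in>J. t j powr w j) = 1 / P"
      by (simp add: t_def P_def powr_divide prod_dividef)
    ultimately have "N \<le> K * P" using P by (simp add: field_simps)
    then show ?thesis by (simp only: P_def)
  qed
  \<comment> \<open>Positive weights make the powers continuous at zero, so the limit is legitimate
    even when some I j vanishes.\<close>
  have "((\<lambda>\<epsilon>. K * (\<Prod>j\<in>J. (I j + \<epsilon>) powr w j)) \<longlongrightarrow> K * (\<Prod>j\<in>J. (I j + 0) powr w j)) (at_right 0)"
    using w(1) I
    by (intro tendsto_mult tendsto_const tendsto_prod tendsto_powr' tendsto_add tendsto_ident_at)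
       (auto simp: eventually_at_right_less[THEN eventually_mono] intro!: disjI2 eventually_mono[OF eventually_at_right_less])
  then have "N \<le> K * (\<Prod>j\<in>J. (I j + 0) powr w j)"
    by (rule tendsto_lowerbound) (auto intro!: eventually_mono[OF eventually_at_right_less] eps)
  then show ?thesis by simp
qed

lemma multilinear_scale:
  assumes T: "multilinear_op m X T" and X: "\<And>j. j \<in> {1..m} \<Longrightarrow> vector_lattice (X j)"
    and x: "\<And>j. j \<in> {1..m} \<Longrightarrow> x j \<in> carrier (X j)"
  shows "T (\<lambda>j\<in>{1..m}. c j \<odot>\<^bsub>X j\<^esub> x j) = (\<Prod>j=1..m. c j) *\<^sub>R T (\<lambda>j\<in>{1..m}. x j)"
proof -
  \<comment> \<open>In z i the first i coordinates are scaled, so consecutive families differ in a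
    single coordinate, as multilinearity requires.\<close>
  define z where "z = (\<lambda>i. \<lambda>j\<in>{1..m}. if j \<le> i then c j \<odot>\<^bsub>X j\<^esub> x j else x j)"
  have zc: "z i \<in> (\<Pi>\<^sub>E j\<in>{1..m}. carrier (X j))" for i
    using x X by (auto simp: z_def vector_lattice.scale_closed)
  have step: "T (z i) = (\<Prod>j=1..i. c j) *\<^sub>R T (z 0)" if "i \<le> m" for i
    using that
  proof (induction i)
    case (Suc i)
    then have j: "Suc i \<in> {1..m}" by simp
    have 1: "z (Suc i) = (z i)(Suc i := c (Suc i) \<odot>\<^bsub>X (Suc i)\<^esub> x (Suc i))"
      and 2: "z i = (z i)(Suc i := x (Suc i))"
      using j by (auto simp: z_def fun_eq_iff le_Suc_eq)
    have "T (z (Suc i)) = c (Suc i) *\<^sub>R T ((z i)(Suc i := x (Suc i)))"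
      unfolding 1 using T zc j x[OF j] unfolding multilinear_op_def by blast
    also have "\<dots> = c (Suc i) *\<^sub>R T (z i)" by (simp only: 2[symmetric])
    finally show ?case using Suc by simp
  qed simp
  have "z m = (\<lambda>j\<in>{1..m}. c j \<odot>\<^bsub>X j\<^esub> x j)" "z 0 = (\<lambda>j\<in>{1..m}. x j)"
    by (auto simp: z_def fun_eq_iff)
  then show ?thesis using step[of m] by simp
qed

section \<open>Duality between weighted norms and weak sums\<close>

context p_convex_lattice
begin

context
  fixes q :: real and n :: nat and x
  assumes pq: "p \<le> q" and n: "1 \<le> n" and x: "x \<in> {1..n} \<rightarrow> carrier X"
begin

definition weighted_norm :: "(nat \<Rightarrow> real) \<Rightarrow> real" where
  "weighted_norm \<beta> = vnorm X (lattice_power_mean X n p (\<lambda>k. \<beta> k \<odot> x k))"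

text \<open>The dual counterpart of \<open>weighted_norm\<close>: its supremum over the ball is the
  q-th power of the supremum of \<open>weighted_norm\<close> over \<open>betas\<close>. The two
  halves are \<open>weak_sum_le_weighted_sup\<close> and \<open>weighted_sup_approx\<close>.\<close>

definition weak_sum :: "('a \<Rightarrow> real) \<Rightarrow> real" where
  "weak_sum \<psi> = (\<Sum>k=1..n. \<psi> (vabs X (x k)) powr (q / p))"

abbreviation "betas \<equiv> lr_ball n (gap_exponent p q)"

lemma q_pos: "0 < q" using pq p_pos by simp

lemma weak_sum_nonneg: "0 \<le> weak_sum \<psi>"
  by (simp add: weak_sum_def sum_nonneg)

lemma x_closed: "k \<in> {1..n} \<Longrightarrow> x k \<in> carrier X"
  by (rule funcset_mem[OF x])

lemma weighted_closed: "(\<lambda>k. \<beta> k \<odot> x k) \<in> {1..n} \<rightarrow> carrier X"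
  using x_closed by (intro funcsetI scale_closed)

lemma weighted_norm_nonneg: "0 \<le> weighted_norm \<beta>"
  unfolding weighted_norm_def by (intro norm_nonneg power_mean_closed weighted_closed)

lemma gap_less:
  assumes "p < q"
  shows "gap_exponent p q = ereal (1 / (1 / p - 1 / q))" "0 < 1 / p - 1 / q"
proof -
  show "0 < 1 / p - 1 / q" using assms p_pos by (simp add: field_simps)
  then show "gap_exponent p q = ereal (1 / (1 / p - 1 / q))"
    unfolding gap_exponent_def one_ereal_def by (subst ereal_divide) auto
qed

lemma gap_eq: "p = q \<Longrightarrow> gap_exponent p q = \<infinity>"
  unfolding gap_exponent_def by (simp add: divide_ereal_def zero_ereal_def[symmetric])

lemma ball_weighted:
  assumes "\<psi> \<in> pball"
  shows "\<psi> (lattice_power_mean X n p (\<lambda>k. \<beta> k \<odot> x k)) = (\<Sum>k=1..n. \<bar>\<beta> k\<bar> powr p * \<psi> (vabs X (x k)))"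
  unfolding ball_power_mean[OF assms weighted_closed]
  by (intro sum.cong HOL.refl ball_vabs_scale[OF assms] x_closed)

text \<open>Hoelder with weights p / r and p / q, which sum to one by the choice of r. For p = q the
  exponent r is infinite and the bound by 1 on all coefficients replaces it.\<close>

lemma ball_weighted_le:
  assumes \<psi>: "\<psi> \<in> pball" and \<beta>: "\<beta> \<in> betas"
  shows "\<psi> (lattice_power_mean X n p (\<lambda>k. \<beta> k \<odot> x k)) \<le> weak_sum \<psi> powr (p / q)"
proof -
  define a where "a = (\<lambda>k. \<psi> (vabs X (x k)))"
  have a: "0 \<le> a k" if "k \<in> {1..n}" for k
    unfolding a_def using that by (intro ball_vabs_nonneg[OF \<psi>] x_closed)
  have "(\<Sum>k=1..n. \<bar>\<beta> k\<bar> powr p * a k) \<le> weak_sum \<psi> powr (p / q)"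
  proof (cases "p = q")
    case True
    have "\<bar>\<beta> k\<bar> \<le> 1" if "k \<in> {1..n}" for k
    proof -
      have "Max ((\<lambda>k. \<bar>\<beta> k\<bar>) ` {1..n}) \<le> 1" using \<beta> gap_eq[OF True] by (simp add: lr_ball_def lr_norm_def)
      moreover have "\<bar>\<beta> k\<bar> \<le> Max ((\<lambda>k. \<bar>\<beta> k\<bar>) ` {1..n})" using that by (intro Max_ge) auto
      ultimately show ?thesis by simp
    qed
    then have "(\<Sum>k=1..n. \<bar>\<beta> k\<bar> powr p * a k) \<le> (\<Sum>k=1..n. 1 * a k)"
      using a p_pos by (intro sum_mono mult_right_mono) (auto intro: powr_le1)
    also have "\<dots> = weak_sum \<psi>" unfolding weak_sum_def using a True p_pos by (simp add: a_def)
    finally show ?thesis using True p_pos weak_sum_nonneg by simp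
  next
    case False
    with pq have less: "p < q" by simp
    define r where "r = 1 / (1 / p - 1 / q)"
    have r: "0 < r" "p / r + p / q = 1" using gap_less(2)[OF less] p_pos by (auto simp: r_def field_simps)
    have "power_mean n r \<beta> \<le> 1" using \<beta> gap_less(1)[OF less] by (simp add: lr_ball_def lr_norm_def r_def)
    then have "power_mean n r \<beta> powr r \<le> 1" using r power_mean_nonneg by (intro powr_le1) auto
    then have B: "(\<Sum>k=1..n. \<bar>\<beta> k\<bar> powr r) \<le> 1" using r by (simp add: power_mean_powr)
    \<comment> \<open>The two factors are indexed by \<open>bool\<close> so that the inequality for
      finite families applies.\<close>
    define w where "w = (\<lambda>b::bool. if b then p / r else p / q)"
    define f where "f = (\<lambda>(b::bool) k. if b then \<bar>\<beta> k\<bar> powr r else a k powr (q / p))"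
    have "(\<Sum>k=1..n. \<bar>\<beta> k\<bar> powr p * a k) = (\<Sum>k=1..n. \<Prod>b\<in>UNIV. f b k powr w b)"
      using a r p_pos q_pos by (intro sum.cong) (auto simp: UNIV_bool f_def w_def powr_powr)
    also have "\<dots> \<le> (\<Prod>b\<in>UNIV. (\<Sum>k=1..n. f b k) powr w b)"
      using r p_pos q_pos by (intro generalized_hoelder) (auto simp: UNIV_bool w_def f_def)
    also have "\<dots> = (\<Sum>k=1..n. \<bar>\<beta> k\<bar> powr r) powr (p / r) * weak_sum \<psi> powr (p / q)"
      by (simp add: UNIV_bool f_def w_def weak_sum_def a_def)
    also have "\<dots> \<le> 1 * weak_sum \<psi> powr (p / q)"
      using B r p_pos by (intro mult_right_mono powr_le1) (auto simp: abs_of_nonneg sum_nonneg)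
    finally show ?thesis by simp
  qed
  then show ?thesis unfolding ball_weighted[OF \<psi>] a_def .
qed

text \<open>The functional that norms the weighted power mean does it, by the Hoelder bound. It
  depends on \<beta>, so passing to the supremum over \<beta> takes a further argument.\<close>

lemma weighted_norm_le_weak_sum:
  assumes \<beta>: "\<beta> \<in> betas"
  obtains \<psi> where "\<psi> \<in> pball" "weighted_norm \<beta> powr q \<le> weak_sum \<psi>"
proof -
  obtain \<psi> where \<psi>: "\<psi> \<in> pball" and eq: "\<psi> (lattice_power_mean X n p (\<lambda>k. \<beta> k \<odot> x k)) = weighted_norm \<beta> powr p"
    using ball_norming[OF power_mean_closed[OF weighted_closed] power_mean_pos[OF weighted_closed]]
    unfolding weighted_norm_def by metis
  have "weighted_norm \<beta> powr p \<le> weak_sum \<psi> powr (p / q)" using ball_weighted_le[OF \<psi> \<beta>] eq by simp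
  then have "(weighted_norm \<beta> powr p) powr (q / p) \<le> (weak_sum \<psi> powr (p / q)) powr (q / p)"
    using p_pos q_pos by (intro powr_mono2) auto
  then show ?thesis using that[OF \<psi>] p_pos q_pos weak_sum_nonneg by (simp add: powr_powr)
qed

lemma weak_sum_bounded:
  assumes "\<psi> \<in> pball" shows "weak_sum \<psi> \<le> (\<Sum>k=1..n. (vnorm X (x k) powr p) powr (q / p))"
  unfolding weak_sum_def
proof (rule sum_mono)
  fix k assume k: "k \<in> {1..n}"
  show "\<psi> (vabs X (x k)) powr (q / p) \<le> (vnorm X (x k) powr p) powr (q / p)"
    using p_pos q_pos ball_vabs_nonneg[OF assms x_closed[OF k]] ball_vabs_bound[OF assms x_closed[OF k]]
    by (intro powr_mono2) auto
qed

text \<open>The supremum over \<open>betas\<close> is taken in the reals and means something only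
  with this bound, which the norming functionals supply.\<close>

lemma weighted_norm_bdd: "bdd_above (weighted_norm ` betas)"
proof (rule bdd_aboveI2)
  fix \<beta> assume "\<beta> \<in> betas"
  then obtain \<psi> where "\<psi> \<in> pball" "weighted_norm \<beta> powr q \<le> weak_sum \<psi>" by (rule weighted_norm_le_weak_sum)
  then have "weighted_norm \<beta> powr q \<le> (\<Sum>k=1..n. (vnorm X (x k) powr p) powr (q / p))"
    using weak_sum_bounded by force
  then have "(weighted_norm \<beta> powr q) powr (1 / q) \<le> (\<Sum>k=1..n. (vnorm X (x k) powr p) powr (q / p)) powr (1 / q)"
    using q_pos by (intro powr_mono2) auto
  then show "weighted_norm \<beta> \<le> (\<Sum>k=1..n. (vnorm X (x k) powr p) powr (q / p)) powr (1 / q)"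
    using q_pos weighted_norm_nonneg by (simp add: powr_powr)
qed

lemma betas_zero: "(\<lambda>k\<in>{1..n}. 0) \<in> betas"
proof (cases "p = q")
  case True
  have "(\<lambda>k. \<bar>(\<lambda>k\<in>{1..n}. 0::real) k\<bar>) ` {1..n} = {0}" using n by (auto simp: image_def)
  then show ?thesis using gap_eq[OF True] by (simp add: lr_ball_def lr_norm_def)
next
  case False
  with pq have "p < q" by simp
  then show ?thesis using gap_less by (simp add: lr_ball_def lr_norm_def power_mean_def)
qed

lemma weighted_sup_nonneg: "0 \<le> (SUP \<beta>\<in>betas. weighted_norm \<beta>)"
  using cSUP_upper[OF betas_zero weighted_norm_bdd] weighted_norm_nonneg order_trans by blast

text \<open>The extremal case of Hoelder: \<beta> is chosen so that equality holds for the given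
  functional, whose norm bound then compares the sum with the norm of the weighted mean.\<close>

lemma weak_sum_le_weighted_sup:
  assumes \<psi>: "\<psi> \<in> pball"
  shows "weak_sum \<psi> \<le> (SUP \<beta>\<in>betas. weighted_norm \<beta>) powr q"
proof (cases "weak_sum \<psi> = 0")
  case True then show ?thesis by simp
next
  case False
  define S where "S = weak_sum \<psi>"
  have S: "0 < S" using False weak_sum_nonneg[of \<psi>] by (simp add: S_def)
  define a where "a = (\<lambda>k. \<psi> (vabs X (x k)))"
  have a: "0 \<le> a k" if "k \<in> {1..n}" for k
    unfolding a_def using that by (intro ball_vabs_nonneg[OF \<psi>] x_closed)
  define b where "b = (\<lambda>k. a k powr (q / p))"
  have Sb: "S = (\<Sum>k=1..n. b k)" by (simp add: S_def weak_sum_def b_def a_def)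
  have ab: "a k = b k powr (p / q)" if "k \<in> {1..n}" for k
    using a[OF that] p_pos q_pos by (simp add: b_def powr_powr)
  have "\<exists>\<beta>\<in>betas. (\<Sum>k=1..n. \<bar>\<beta> k\<bar> powr p * a k) = S powr (p / q)"
  proof (cases "p = q")
    case True
    have "(\<lambda>k. \<bar>(\<lambda>k\<in>{1..n}. 1::real) k\<bar>) ` {1..n} = {1}" using n by (auto simp: image_def)
    then have "(\<lambda>k\<in>{1..n}. 1) \<in> betas" using gap_eq[OF True] by (simp add: lr_ball_def lr_norm_def)
    moreover have "(\<Sum>k=1..n. \<bar>(\<lambda>k\<in>{1..n}. 1::real) k\<bar> powr p * a k) = S powr (p / q)"
      using True a S p_pos by (simp add: Sb b_def)
    ultimately show ?thesis by blast
  next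
    case False
    with pq have less: "p < q" by simp
    define r where "r = 1 / (1 / p - 1 / q)"
    have r: "0 < r" "p / r + p / q = 1" using gap_less(2)[OF less] p_pos by (auto simp: r_def field_simps)
    \<comment> \<open>The r-th roots of the proportions b k / S have r-norm one and realize
      equality.\<close>
    define \<beta> where "\<beta> = (\<lambda>k\<in>{1..n}. (b k / S) powr (1 / r))"
    have b0: "0 \<le> b k" for k by (simp add: b_def)
    have "(\<Sum>k=1..n. \<bar>\<beta> k\<bar> powr r) = (\<Sum>k=1..n. b k / S)"
      using r S b0 by (intro sum.cong) (auto simp: \<beta>_def powr_powr)
    also have "\<dots> = S / S" unfolding Sb by (rule sum_divide_distrib[symmetric])
    also have "\<dots> = 1" using S by simp
    finally have "power_mean n r \<beta> = 1" by (simp add: power_mean_def)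
    then have "\<beta> \<in> betas" using gap_less(1)[OF less] by (simp add: lr_ball_def lr_norm_def r_def \<beta>_def)
    moreover have "(\<Sum>k=1..n. \<bar>\<beta> k\<bar> powr p * a k) = (\<Sum>k=1..n. S powr (p / q) * (b k / S))"
    proof (rule sum.cong[OF HOL.refl])
      fix k assume k: "k \<in> {1..n}"
      have "b k powr (p / q) = (S * (b k / S)) powr (p / q)" using S by simp
      also have "\<dots> = S powr (p / q) * (b k / S) powr (p / q)" by (rule powr_mult)
      finally have "\<bar>\<beta> k\<bar> powr p * a k = S powr (p / q) * ((b k / S) powr (p / r) * (b k / S) powr (p / q))"
        using k ab[OF k] by (simp add: \<beta>_def powr_powr)
      also have "(b k / S) powr (p / r) * (b k / S) powr (p / q) = b k / S"
        using r(2) b0[of k] S by (simp add: powr_add[symmetric])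
      finally show "\<bar>\<beta> k\<bar> powr p * a k = S powr (p / q) * (b k / S)" .
    qed
    moreover have "\<dots> = S powr (p / q) * (S / S)"
      unfolding sum_distrib_left[symmetric] sum_divide_distrib[symmetric] Sb[symmetric] by (rule HOL.refl)
    moreover have "\<dots> = S powr (p / q)" using S by simp
    ultimately show ?thesis by metis
  qed
  then obtain \<beta> where \<beta>: "\<beta> \<in> betas" "(\<Sum>k=1..n. \<bar>\<beta> k\<bar> powr p * a k) = S powr (p / q)" by blast
  have "S powr (p / q) \<le> weighted_norm \<beta> powr p"
    using ball_bound[OF \<psi> power_mean_closed[OF weighted_closed], of \<beta>] \<beta>(2)
    unfolding ball_weighted[OF \<psi>] a_def weighted_norm_def by simp
  also have "\<dots> \<le> (SUP \<beta>\<in>betas. weighted_norm \<beta>) powr p"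
    using cSUP_upper[OF \<beta>(1) weighted_norm_bdd] weighted_norm_nonneg p_pos by (intro powr_mono2) auto
  finally have "(S powr (p / q)) powr (q / p) \<le> ((SUP \<beta>\<in>betas. weighted_norm \<beta>) powr p) powr (q / p)"
    using p_pos q_pos by (intro powr_mono2) auto
  then show ?thesis using S p_pos q_pos by (simp add: powr_powr S_def)
qed

lemma weighted_sup_approx:
  assumes \<delta>: "0 < \<delta>"
  obtains \<psi> where "\<psi> \<in> pball" "(SUP \<beta>\<in>betas. weighted_norm \<beta>) powr q \<le> weak_sum \<psi> + \<delta>"
proof -
  let ?W = "SUP \<beta>\<in>betas. weighted_norm \<beta>"
  have "\<exists>\<psi>\<in>pball. ?W powr q \<le> weak_sum \<psi> + \<delta>"
  proof (rule ccontr)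
    assume neg: "\<not> (\<exists>\<psi>\<in>pball. ?W powr q \<le> weak_sum \<psi> + \<delta>)"
    define M where "M = ?W powr q - \<delta>"
    have le: "weighted_norm \<beta> powr q \<le> M" if \<beta>: "\<beta> \<in> betas" for \<beta>
    proof -
      obtain \<psi> where "\<psi> \<in> pball" "weighted_norm \<beta> powr q \<le> weak_sum \<psi>" using weighted_norm_le_weak_sum[OF \<beta>] .
      moreover then have "weak_sum \<psi> < M" using neg by (auto simp: M_def not_le)
      ultimately show ?thesis by simp
    qed
    have M: "0 \<le> M" using le[OF betas_zero] by (smt (verit) powr_ge_zero)
    have "weighted_norm \<beta> \<le> M powr (1 / q)" if \<beta>: "\<beta> \<in> betas" for \<beta>
    proof -
      have "(weighted_norm \<beta> powr q) powr (1 / q) \<le> M powr (1 / q)"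
        using le[OF \<beta>] q_pos by (intro powr_mono2) auto
      then show ?thesis using q_pos weighted_norm_nonneg by (simp add: powr_powr)
    qed
    then have "?W \<le> M powr (1 / q)" using betas_zero by (intro cSUP_least) auto
    then have "?W powr q \<le> (M powr (1 / q)) powr q" using weighted_sup_nonneg q_pos by (intro powr_mono2) auto
    then have "?W powr q \<le> M" using M q_pos by (simp add: powr_powr)
    then show False using \<delta> by (simp add: M_def)
  qed
  then show ?thesis using that by blast
qed

lemmas weak_sum_le_sup = weak_sum_le_weighted_sup[unfolded weak_sum_def weighted_norm_def]
lemmas weak_sum_approx_sup = weighted_sup_approx[unfolded weak_sum_def weighted_norm_def]
lemmas weighted_norm_sup_nonneg = weighted_sup_nonneg[unfolded weighted_norm_def]

end

text \<open>Truncation at zero gives a function continuous on the whole line, and it changes nothing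
  on the ball because its members are nonnegative at moduli.\<close>

lemma ball_powr_continuous:
  assumes u: "u \<in> carrier X" and s: "0 < s"
  shows "continuous_map ball_topology euclideanreal (\<lambda>\<psi>. \<psi> (vabs X u) powr s)"
proof -
  have c: "continuous_on UNIV (\<lambda>t::real. max t 0 powr s)"
    using s by (intro continuous_on_powr' continuous_on_max continuous_on_id continuous_on_const) auto
  have "continuous_map ball_topology euclideanreal ((\<lambda>t::real. max t 0 powr s) \<circ> (\<lambda>\<psi>. \<psi> (vabs X u)))"
    using ball_continuous[of "vabs X u"] u c by (intro continuous_map_compose[where X'=euclideanreal]) auto
  then show ?thesis
    by (rule continuous_map_eq) (use u ball_vabs_nonneg in \<open>auto simp: topspace_ball\<close>)
qed

lemma ball_powr_scale:
  assumes "\<psi> \<in> pball" "u \<in> carrier X" "0 < c"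
  shows "\<psi> (vabs X (c \<odot> u)) powr s = c powr (p * s) * \<psi> (vabs X u) powr s"
  using assms by (simp add: ball_vabs_scale powr_mult powr_powr)

end

section \<open>The domination theorem\<close>

lemma le_of_powr_le: "0 < s \<Longrightarrow> 0 \<le> b \<Longrightarrow> a powr s \<le> b powr s \<Longrightarrow> a \<le> (b::real)"
  using powr_less_mono2[of s b a] by linarith

locale p_convex_multilinear =
  fixes m :: nat and p q :: "nat \<Rightarrow> real" and X :: "nat \<Rightarrow> 'a normed_lattice"
    and T :: "(nat \<Rightarrow> 'a) \<Rightarrow> 'b::real_normed_vector"
  assumes m: "m \<ge> 1"
    and pq: "\<And>j. j \<in> {1..m} \<Longrightarrow> 1 \<le> p j \<and> p j \<le> q j"
    and BL: "\<And>j. j \<in> {1..m} \<Longrightarrow> banach_lattice (X j)"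
    and PC: "\<And>j. j \<in> {1..m} \<Longrightarrow> p_convex1 (X j) (p j)"
    and multilinear: "multilinear_op m X T"
begin

lemma pcl: "j \<in> {1..m} \<Longrightarrow> p_convex_lattice (X j) (p j)"
  using pq BL PC by (intro p_convex_lattice.intro p_convex_lattice_axioms.intro) auto

lemma scale_in_carrier: "j \<in> {1..m} \<Longrightarrow> u \<in> carrier (X j) \<Longrightarrow> c \<odot>\<^bsub>X j\<^esub> u \<in> carrier (X j)"
  using BL by (simp add: banach_lattice_def vector_lattice.scale_closed)

abbreviation "K j \<equiv> subtopology (weak_star_topology (concavification (X j) (p j)))
                       (positive_dual_ball (concavification (X j) (p j)))"

lemma topspace_K: "j \<in> {1..m} \<Longrightarrow> topspace (K j) = positive_dual_ball (concavification (X j) (p j))"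
  and compact_K: "j \<in> {1..m} \<Longrightarrow> compact_space (K j)"
  and hausdorff_K: "j \<in> {1..m} \<Longrightarrow> Hausdorff_space (K j)"
  and continuous_K: "j \<in> {1..m} \<Longrightarrow> u \<in> carrier (X j) \<Longrightarrow> 0 < s \<Longrightarrow>
      continuous_map (K j) euclideanreal (\<lambda>\<psi>. \<psi> (vabs (X j) u) powr s)"
  using p_convex_lattice.topspace_ball[OF pcl] p_convex_lattice.ball_compact[OF pcl]
    p_convex_lattice.ball_hausdorff[OF pcl] p_convex_lattice.ball_powr_continuous[OF pcl]
  by (simp_all add: p_convex_lattice.ball_topology_def[OF pcl])

definition Q :: real where "Q = 1 / (\<Sum>j=1..m. 1 / q j)"
text \<open>Since 1 / Q is the sum of the 1 / q j, these numbers add up to one; they are the weights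
  that combine the factors in Hoelder's inequality and in the inequality of the means.\<close>

definition w :: "nat \<Rightarrow> real" where "w j = Q / q j"

lemma pj_pos: "j \<in> {1..m} \<Longrightarrow> 0 < p j" and qj_pos: "j \<in> {1..m} \<Longrightarrow> 0 < q j"
  using pq by force+

lemma Q_pos: "0 < Q"
  unfolding Q_def using qj_pos m by (intro divide_pos_pos sum_pos) auto

lemma w_pos: "j \<in> {1..m} \<Longrightarrow> 0 < w j"
  using Q_pos qj_pos by (simp add: w_def)

lemma w_sum: "(\<Sum>j=1..m. w j) = 1"
proof -
  have "(\<Sum>j=1..m. w j) = Q * (\<Sum>j=1..m. 1 / q j)" by (simp add: w_def sum_distrib_left)
  then show ?thesis using Q_pos by (simp add: Q_def)
qed

lemma prod_powr_Q: "(\<Prod>j=1..m. a j powr (1 / q j)) powr Q = (\<Prod>j=1..m. a j powr w j)"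
  by (simp add: prod_powr_distrib powr_powr w_def)

definition W :: "nat \<Rightarrow> nat \<Rightarrow> (nat \<Rightarrow> 'a) \<Rightarrow> real" where
  "W j n x = (SUP \<beta>\<in>lr_ball n (gap_exponent (p j) (q j)).
                 vnorm (X j) (lattice_power_mean (X j) n (p j) (\<lambda>k. \<beta> k \<odot>\<^bsub>X j\<^esub> x k)))"

lemma W_nonneg: "j \<in> {1..m} \<Longrightarrow> 1 \<le> n \<Longrightarrow> x \<in> {1..n} \<rightarrow> carrier (X j) \<Longrightarrow> 0 \<le> W j n x"
  unfolding W_def using pq by (intro p_convex_lattice.weighted_norm_sup_nonneg[OF pcl]) auto

lemma weak_sum_le_W:
  "j \<in> {1..m} \<Longrightarrow> 1 \<le> n \<Longrightarrow> x \<in> {1..n} \<rightarrow> carrier (X j) \<Longrightarrow> \<psi> \<in> topspace (K j) \<Longrightarrow>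
    (\<Sum>k=1..n. \<psi> (vabs (X j) (x k)) powr (q j / p j)) \<le> W j n x powr q j"
  unfolding W_def using pq topspace_K by (intro p_convex_lattice.weak_sum_le_sup[OF pcl]) auto

lemma W_le_weak_sum:
  assumes j: "j \<in> {1..m}" and "1 \<le> n" "x \<in> {1..n} \<rightarrow> carrier (X j)" "0 < \<delta>"
  shows "\<exists>\<psi>\<in>topspace (K j). W j n x powr q j \<le> (\<Sum>k=1..n. \<psi> (vabs (X j) (x k)) powr (q j / p j)) + \<delta>"
proof -
  have "p j \<le> q j" using pq j by simp
  from p_convex_lattice.weak_sum_approx_sup[OF pcl[OF j] this assms(2-4)] show ?thesis
    unfolding W_def topspace_K[OF j] by blast
qed

lemma prod_W_powr: 
  shows "(\<Prod>j=1..m. (W j n (x j) powr q j) powr w j) = (\<Prod>j=1..m. W j n (x j)) powr Q"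
  unfolding prod_powr_distrib
proof (rule prod.cong[OF HOL.refl])
  show "(W j n (x j) powr q j) powr w j = W j n (x j) powr Q" if "j \<in> {1..m}" for j
    using qj_pos[OF that] by (simp add: powr_powr w_def)
qed

lemma strongly_concave_iff:
  "strongly_concave m p q X T \<longleftrightarrow> (\<exists>C>0. \<forall>n\<ge>1. \<forall>x. (\<forall>j\<in>{1..m}. x j \<in> {1..n} \<rightarrow> carrier (X j)) \<longrightarrow>
     (\<Sum>k=1..n. norm (T (\<lambda>j\<in>{1..m}. x j k)) powr Q) powr (1 / Q) \<le> C * (\<Prod>j=1..m. W j n (x j)))"
  unfolding strongly_concave_def Let_def Q_def[symmetric] W_def Pi_iff by (rule HOL.refl)

text \<open>For each factor the sum over k goes inside the integral, where the duality estimate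
  bounds it on the whole ball; total mass one preserves the bound. Hoelder with the weights
  \<open>w\<close> then combines the factors.\<close>

lemma strongly_concave_if_dominated:
  assumes C: "0 < C" and \<nu>: "\<And>j. j \<in> {1..m} \<Longrightarrow> regular_borel_prob (K j) (\<nu> j)"
    and dom: "\<And>x. x \<in> (\<Pi>\<^sub>E j\<in>{1..m}. carrier (X j)) \<Longrightarrow>
      norm (T x) \<le> C * (\<Prod>j=1..m. (\<integral>\<phi>. \<phi> (vabs (X j) (x j)) powr (q j / p j) \<partial>\<nu> j) powr (1 / q j))"
  shows "strongly_concave m p q X T"
  unfolding strongly_concave_iff
proof (intro exI conjI allI impI)
  show "0 < C" by (rule C)
  fix n :: nat and x assume n: "1 \<le> n" and x: "\<forall>j\<in>{1..m}. x j \<in> {1..n} \<rightarrow> carrier (X j)"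
  define I where "I = (\<lambda>j k. \<integral>\<phi>. \<phi> (vabs (X j) (x j k)) powr (q j / p j) \<partial>\<nu> j)"
  define P where "P = (\<Prod>j=1..m. W j n (x j))"
  have P: "0 \<le> P" unfolding P_def using W_nonneg n x by (intro prod_nonneg) auto
  have I: "0 \<le> I j k" for j k by (simp add: I_def)
  have xc: "x j k \<in> carrier (X j)" if "j \<in> {1..m}" "k \<in> {1..n}" for j k using x that by (meson Pi_mem)
  have sumI: "(\<Sum>k=1..n. I j k) \<le> W j n (x j) powr q j" if j: "j \<in> {1..m}" for j
  proof -
    interpret prob_space "\<nu> j" using \<nu>[OF j] by (simp add: regular_borel_prob_def)
    have s: "0 < q j / p j" using pj_pos qj_pos j by simp
    have int: "integrable (\<nu> j) (\<lambda>\<phi>. \<phi> (vabs (X j) (x j k)) powr (q j / p j))" if "k \<in> {1..n}" for k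
      using regular_borel_continuous_integrable[OF \<nu>[OF j] compact_K[OF j] continuous_K[OF j xc[OF j that] s]] .
    have "(\<Sum>k=1..n. I j k) = (\<integral>\<phi>. (\<Sum>k=1..n. \<phi> (vabs (X j) (x j k)) powr (q j / p j)) \<partial>\<nu> j)"
      unfolding I_def by (rule Bochner_Integration.integral_sum[symmetric]) (rule int)
    also have "\<dots> \<le> W j n (x j) powr q j"
    proof (rule integral_le_const)
      show "integrable (\<nu> j) (\<lambda>\<phi>. \<Sum>k=1..n. \<phi> (vabs (X j) (x j k)) powr (q j / p j))"
        by (rule Bochner_Integration.integrable_sum) (rule int)
      show "AE \<phi> in \<nu> j. (\<Sum>k=1..n. \<phi> (vabs (X j) (x j k)) powr (q j / p j)) \<le> W j n (x j) powr q j"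
        using \<nu>[OF j] x j n by (intro AE_I2 weak_sum_le_W) (auto simp: regular_borel_prob_def)
    qed
    finally show ?thesis .
  qed
  have "norm (T (\<lambda>j\<in>{1..m}. x j k)) powr Q \<le> C powr Q * (\<Prod>j=1..m. I j k powr w j)" if k: "k \<in> {1..n}" for k
  proof -
    have "norm (T (\<lambda>j\<in>{1..m}. x j k)) \<le> C * (\<Prod>j=1..m. I j k powr (1 / q j))"
    proof -
      have "(\<lambda>j\<in>{1..m}. x j k) \<in> (\<Pi>\<^sub>E j\<in>{1..m}. carrier (X j))" using xc k by auto
      from dom[OF this] show ?thesis unfolding I_def by (simp cong: prod.cong_simp)
    qed
    then have "norm (T (\<lambda>j\<in>{1..m}. x j k)) powr Q \<le> (C * (\<Prod>j=1..m. I j k powr (1 / q j))) powr Q"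
      using Q_pos by (intro powr_mono2) auto
    then show ?thesis by (simp only: powr_mult prod_powr_Q)
  qed
  then have "(\<Sum>k=1..n. norm (T (\<lambda>j\<in>{1..m}. x j k)) powr Q) \<le> (\<Sum>k=1..n. C powr Q * (\<Prod>j=1..m. I j k powr w j))"
    by (rule sum_mono)
  also have "\<dots> = C powr Q * (\<Sum>k=1..n. \<Prod>j=1..m. I j k powr w j)" by (simp add: sum_distrib_left)
  also have "\<dots> \<le> C powr Q * (\<Prod>j=1..m. (\<Sum>k=1..n. I j k) powr w j)"
    using w_pos w_sum I by (intro mult_left_mono generalized_hoelder) auto
  also have "\<dots> \<le> C powr Q * (\<Prod>j=1..m. (W j n (x j) powr q j) powr w j)"
    using sumI w_pos I by (intro mult_left_mono prod_mono conjI powr_mono2) (auto intro: sum_nonneg less_imp_le)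
  also have "\<dots> = (C * P) powr Q"
    using prod_W_powr[of n x] by (simp add: P_def powr_mult)
  finally have "(\<Sum>k=1..n. norm (T (\<lambda>j\<in>{1..m}. x j k)) powr Q) powr (1 / Q) \<le> ((C * P) powr Q) powr (1 / Q)"
    using Q_pos by (intro powr_mono2) (auto intro: sum_nonneg)
  then show "(\<Sum>k=1..n. norm (T (\<lambda>j\<in>{1..m}. x j k)) powr Q) powr (1 / Q) \<le> C * (\<Prod>j=1..m. W j n (x j))"
    using Q_pos C P by (simp add: powr_powr P_def)
qed

section \<open>The cone of defect functions\<close>

definition Z :: "(nat \<Rightarrow> 'a \<Rightarrow> real) set" where
  "Z = (\<Pi>\<^sub>E j\<in>{1..m}. topspace (K j))"

lemma Z_mem:
  assumes "z \<in> Z" "j \<in> {1..m}" shows "z j \<in> positive_dual_ball (concavification (X j) (p j))"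
  using PiE_mem[OF assms(1)[unfolded Z_def] assms(2)] topspace_K[OF assms(2)] by simp

definition G :: "nat \<Rightarrow> 'a \<Rightarrow> (nat \<Rightarrow> 'a \<Rightarrow> real) \<Rightarrow> real" where
  "G j u z = z j (vabs (X j) u) powr (q j / p j)"

lemma G_bounded:
  assumes j: "j \<in> {1..m}" and u: "u \<in> carrier (X j)"
  shows "G j u \<in> bounded_functions Z"
proof -
  have "\<bar>G j u z\<bar> \<le> (vnorm (X j) u powr p j) powr (q j / p j)" if z: "z \<in> Z" for z
  proof -
    have "z j (vabs (X j) u) \<le> vnorm (X j) u powr p j" "0 \<le> z j (vabs (X j) u)"
      using p_convex_lattice.ball_vabs_bound[OF pcl[OF j] Z_mem[OF z j] u]
        p_convex_lattice.ball_vabs_nonneg[OF pcl[OF j] Z_mem[OF z j] u] .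
    then show ?thesis using pj_pos[OF j] qj_pos[OF j] by (auto simp: G_def intro: powr_mono2)
  qed
  then show ?thesis unfolding bounded_functions_def by blast
qed

text \<open>The p j-th power raised to q j / p j is homogeneous of degree q j in u, which explains
  the root 1 / q j.\<close>

lemma G_scale:
  assumes "j \<in> {1..m}" "u \<in> carrier (X j)" "z \<in> Z" "0 < t"
  shows "G j ((t powr (1 / q j)) \<odot>\<^bsub>X j\<^esub> u) z = t * G j u z"
  using p_convex_lattice.ball_powr_scale[OF pcl[OF assms(1)] Z_mem[OF assms(3,1)] assms(2), of "t powr (1 / q j)" "q j / p j"]
    assms(4) pj_pos[OF assms(1)] qj_pos[OF assms(1)]
  by (simp add: G_def powr_powr)

lemma T_scale:
  assumes x: "\<And>j. j \<in> {1..m} \<Longrightarrow> x j \<in> carrier (X j)" and t: "\<And>j. j \<in> {1..m} \<Longrightarrow> 0 < t j"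
  shows "norm (T (\<lambda>j\<in>{1..m}. (t j powr (1 / q j)) \<odot>\<^bsub>X j\<^esub> x j)) powr Q
    = (\<Prod>j=1..m. t j powr w j) * norm (T (\<lambda>j\<in>{1..m}. x j)) powr Q"
proof -
  have vl: "vector_lattice (X j)" if "j \<in> {1..m}" for j using BL[OF that] by (simp add: banach_lattice_def)
  have "norm (T (\<lambda>j\<in>{1..m}. (t j powr (1 / q j)) \<odot>\<^bsub>X j\<^esub> x j))
      = (\<Prod>j=1..m. t j powr (1 / q j)) * norm (T (\<lambda>j\<in>{1..m}. x j))"
    using multilinear_scale[OF multilinear vl x, of "\<lambda>j. t j powr (1 / q j)"] by (simp add: abs_prod)
  then show ?thesis by (simp only: powr_mult prod_powr_Q)
qed

text \<open>Written as a sum with a negative coefficient, so that the closure rules for sums and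
  multiples apply as they stand. For n = 0 it is the zero function.\<close>

definition defect :: "real \<Rightarrow> nat \<Rightarrow> (nat \<Rightarrow> nat \<Rightarrow> 'a) \<Rightarrow> (nat \<Rightarrow> 'a \<Rightarrow> real) \<Rightarrow> real" where
  "defect C n x z = (\<Sum>k=1..n. norm (T (\<lambda>j\<in>{1..m}. x j k)) powr Q
      + (- (C powr Q)) * (\<Sum>j=1..m. w j * G j (x j k) z))"

text \<open>The inequality of the means turns the product of the W j into a sum, so the point z can
  be chosen factor by factor, each coordinate nearly reaching its own supremum.\<close>

lemma defect_small:
  assumes C: "0 < C" and \<epsilon>: "0 < \<epsilon>" and x: "\<And>j. j \<in> {1..m} \<Longrightarrow> x j \<in> {1..n} \<rightarrow> carrier (X j)"
    and concave: "1 \<le> n \<Longrightarrow> (\<Sum>k=1..n. norm (T (\<lambda>j\<in>{1..m}. x j k)) powr Q) powr (1 / Q) \<le> C * (\<Prod>j=1..m. W j n (x j))"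
  shows "\<exists>z\<in>Z. defect C n x z \<le> \<epsilon>"
proof (cases "n = 0")
  case True
  have "topspace (K j) \<noteq> {}" if "j \<in> {1..m}" for j
    using p_convex_lattice.ball_nonempty[OF pcl[OF that]] topspace_K[OF that] by simp
  then have "Z \<noteq> {}" by (simp add: Z_def PiE_eq_empty_iff)
  then show ?thesis using True \<epsilon> by (auto simp: defect_def intro: less_imp_le)
next
  case False
  then have n: "1 \<le> n" by simp
  define D where "D = C powr Q"
  have D: "0 < D" using C by (simp add: D_def)
  define S where "S = (\<lambda>j \<psi>. \<Sum>k=1..n. \<psi> (vabs (X j) (x j k)) powr (q j / p j))"
  \<comment> \<open>The weights add up to one, so an error \<epsilon> / D in every factor becomes
    \<epsilon> after multiplication by D.\<close>
  have "\<exists>\<psi>\<in>topspace (K j). W j n (x j) powr q j \<le> S j \<psi> + \<epsilon> / D" if "j \<in> {1..m}" for j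
    unfolding S_def using W_le_weak_sum[OF that n x[OF that]] \<epsilon> D by simp
  then obtain \<psi> where \<psi>: "\<And>j. j \<in> {1..m} \<Longrightarrow> \<psi> j \<in> topspace (K j)"
    "\<And>j. j \<in> {1..m} \<Longrightarrow> W j n (x j) powr q j \<le> S j (\<psi> j) + \<epsilon> / D" by metis
  define z where "z = (\<lambda>j\<in>{1..m}. \<psi> j)"
  have z: "z \<in> Z" using \<psi>(1) by (simp add: z_def Z_def)
  define N where "N = (\<Sum>k=1..n. norm (T (\<lambda>j\<in>{1..m}. x j k)) powr Q)"
  have N: "0 \<le> N" by (simp add: N_def sum_nonneg)
  have P: "0 \<le> (\<Prod>j=1..m. W j n (x j))" using W_nonneg n x by (intro prod_nonneg) auto
  have "N = (N powr (1 / Q)) powr Q" using N Q_pos by (simp add: powr_powr)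
  also have "\<dots> \<le> (C * (\<Prod>j=1..m. W j n (x j))) powr Q"
    using concave[OF n] Q_pos unfolding N_def by (intro powr_mono2) auto
  also have "\<dots> = D * (\<Prod>j=1..m. (W j n (x j) powr q j) powr w j)"
    using prod_W_powr[of n x] by (simp add: powr_mult D_def)
  also have "\<dots> \<le> D * (\<Sum>j=1..m. w j * W j n (x j) powr q j)"
    using D w_pos w_sum by (intro mult_left_mono weighted_am_gm) auto
  also have "\<dots> \<le> D * (\<Sum>j=1..m. w j * (S j (\<psi> j) + \<epsilon> / D))"
    using D w_pos \<psi>(2) by (intro mult_left_mono sum_mono) (auto intro: less_imp_le)
  also have "\<dots> = D * (\<Sum>j=1..m. w j * S j (\<psi> j)) + \<epsilon>"
  proof -
    have "(\<Sum>j=1..m. w j * (S j (\<psi> j) + \<epsilon> / D)) = (\<Sum>j=1..m. w j * S j (\<psi> j)) + (\<Sum>j=1..m. w j) * (\<epsilon> / D)"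
      by (simp only: distrib_left sum.distrib sum_distrib_right)
    then show ?thesis using D by (simp only: w_sum distrib_left) simp
  qed
  finally have N_le: "N \<le> D * (\<Sum>j=1..m. w j * S j (\<psi> j)) + \<epsilon>" .
  have "(\<Sum>k=1..n. \<Sum>j=1..m. w j * G j (x j k) z) = (\<Sum>j=1..m. \<Sum>k=1..n. w j * G j (x j k) z)"
    by (rule sum.swap)
  also have "\<dots> = (\<Sum>j=1..m. w j * S j (\<psi> j))"
  proof (rule sum.cong[OF HOL.refl])
    show "(\<Sum>k=1..n. w j * G j (x j k) z) = w j * S j (\<psi> j)" if "j \<in> {1..m}" for j
      using that by (simp add: S_def G_def z_def sum_distrib_left)
  qed
  finally have "defect C n x z = N + (- D) * (\<Sum>j=1..m. w j * S j (\<psi> j))"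
    by (simp only: defect_def sum.distrib sum_distrib_left[symmetric] N_def D_def)
  then show ?thesis using N_le z by (intro bexI[of _ z]) auto
qed

lemma defect_bounded:
  assumes "\<And>j. j \<in> {1..m} \<Longrightarrow> x j \<in> {1..n} \<rightarrow> carrier (X j)"
  shows "defect C n x \<in> bounded_functions Z"
  unfolding defect_def[abs_def]
  by (intro bounded_functions_sum bounded_functions_add bounded_functions_const bounded_functions_scale G_bounded)
     (assumption | rule funcset_mem[OF assms])+

text \<open>Concatenating the finite families adds their defects, so these functions are closed
  under addition.\<close>

lemma defect_append:
  "defect C n x z + defect C n' x' z
    = defect C (n + n') (\<lambda>j k. if k \<le> n then x j k else x' j (k - n)) z"
proof -
  have split: "(\<Sum>k=1..n+n'. h k) = (\<Sum>k=1..n. h k) + (\<Sum>k=1..n'. h (k + n))" for h :: "nat \<Rightarrow> real"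
  proof -
    have "(\<Sum>k=1..n+n'. h k) = (\<Sum>k=1..n. h k) + (\<Sum>k=n+1..n+n'. h k)" by (rule sum.ub_add_nat) simp
    also have "(\<Sum>k=n+1..n+n'. h k) = (\<Sum>k=1..n'. h (k + n))"
      using sum.shift_bounds_cl_nat_ivl[of h 1 n n'] by (simp add: add.commute)
    finally show ?thesis .
  qed
  show ?thesis unfolding defect_def split by (intro arg_cong2[where f="(+)"] sum.cong) auto
qed

text \<open>Scaling the j-th variable by the power 1 / q j of c multiplies both parts by c: the
  operator part through the product of the \<open>c powr w j\<close>, whose exponents sum to
  one.\<close>

lemma defect_scale:
  assumes x: "\<And>j. j \<in> {1..m} \<Longrightarrow> x j \<in> {1..n} \<rightarrow> carrier (X j)" and c: "0 < c" and z: "z \<in> Z"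
  shows "c * defect C n x z = defect C n (\<lambda>j k. (c powr (1 / q j)) \<odot>\<^bsub>X j\<^esub> x j k) z"
  unfolding defect_def sum_distrib_left[of c]
proof (rule sum.cong[OF HOL.refl])
  fix k assume k: "k \<in> {1..n}"
  have xc: "x j k \<in> carrier (X j)" if "j \<in> {1..m}" for j using x[OF that] k by (rule funcset_mem)
  have "(\<Prod>j=1..m. c powr w j) = c"
    using c w_sum powr_sum[of c w "{1..m}"] by simp
  then have T: "norm (T (\<lambda>j\<in>{1..m}. (c powr (1 / q j)) \<odot>\<^bsub>X j\<^esub> x j k)) powr Q
      = c * norm (T (\<lambda>j\<in>{1..m}. x j k)) powr Q"
    using T_scale[of "\<lambda>j. x j k" "\<lambda>j. c"] xc c by simp
  have G: "(\<Sum>j=1..m. w j * G j ((c powr (1 / q j)) \<odot>\<^bsub>X j\<^esub> x j k) z) = c * (\<Sum>j=1..m. w j * G j (x j k) z)"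
    unfolding sum_distrib_left
  proof (rule sum.cong[OF HOL.refl])
    show "w j * G j ((c powr (1 / q j)) \<odot>\<^bsub>X j\<^esub> x j k) z = c * (w j * G j (x j k) z)" if "j \<in> {1..m}" for j
      using G_scale[OF that xc[OF that] z c] by simp
  qed
  show "c * (norm (T (\<lambda>j\<in>{1..m}. x j k)) powr Q + - (C powr Q) * (\<Sum>j=1..m. w j * G j (x j k) z))
    = norm (T (\<lambda>j\<in>{1..m}. (c powr (1 / q j)) \<odot>\<^bsub>X j\<^esub> x j k)) powr Q
      + - (C powr Q) * (\<Sum>j=1..m. w j * G j ((c powr (1 / q j)) \<odot>\<^bsub>X j\<^esub> x j k) z)"
    unfolding T G by (simp add: algebra_simps)
qed

lemma mean_exists:
  assumes C: "0 < C"
    and concave: "\<And>n x. 1 \<le> n \<Longrightarrow> \<forall>j\<in>{1..m}. x j \<in> {1..n} \<rightarrow> carrier (X j) \<Longrightarrow>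
      (\<Sum>k=1..n. norm (T (\<lambda>j\<in>{1..m}. x j k)) powr Q) powr (1 / Q) \<le> C * (\<Prod>j=1..m. W j n (x j))"
  shows "\<exists>L. positive_mean Z L \<and> (\<forall>x. (\<forall>j\<in>{1..m}. x j \<in> carrier (X j)) \<longrightarrow>
      norm (T (\<lambda>j\<in>{1..m}. x j)) powr Q \<le> C powr Q * (\<Sum>j=1..m. w j * L (G j (x j))))"
proof -
  \<comment> \<open>Agreement is asked for on Z alone, since the scaling identity for defects is
    available only at points of Z.\<close>
  define F where "F = {f. \<exists>n x. (\<forall>j\<in>{1..m}. x j \<in> {1..n} \<rightarrow> carrier (X j)) \<and> (\<forall>z\<in>Z. f z = defect C n x z)}"
  have FI: "f \<in> F" if "\<And>j. j \<in> {1..m} \<Longrightarrow> x j \<in> {1..n} \<rightarrow> carrier (X j)" "\<And>z. z \<in> Z \<Longrightarrow> f z = defect C n x z"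
    for f n x unfolding F_def using that by blast
  have FE: "\<exists>n x. (\<forall>j\<in>{1..m}. x j \<in> {1..n} \<rightarrow> carrier (X j)) \<and> (\<forall>z\<in>Z. f z = defect C n x z)" if "f \<in> F" for f
    using that unfolding F_def by blast
  have 1: "F \<subseteq> bounded_functions Z"
  proof
    fix f assume "f \<in> F"
    then obtain n x where "\<forall>j\<in>{1..m}. x j \<in> {1..n} \<rightarrow> carrier (X j)" "\<forall>z\<in>Z. f z = defect C n x z"
      using FE by blast
    then show "f \<in> bounded_functions Z" using defect_bounded[of x n C] by (simp add: bounded_functions_def)
  qed
  have 2: "(\<lambda>z. 0) \<in> F" by (rule FI[of _ 0]) (auto simp: defect_def)
  have 3: "(\<lambda>z. f z + g z) \<in> F" if fg: "f \<in> F" "g \<in> F" for f g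
  proof -
    obtain n x where x: "\<forall>j\<in>{1..m}. x j \<in> {1..n} \<rightarrow> carrier (X j)" "\<forall>z\<in>Z. f z = defect C n x z"
      using FE[OF fg(1)] by blast
    obtain n' x' where x': "\<forall>j\<in>{1..m}. x' j \<in> {1..n'} \<rightarrow> carrier (X j)" "\<forall>z\<in>Z. g z = defect C n' x' z"
      using FE[OF fg(2)] by blast
    show ?thesis
    proof (rule FI)
      fix j assume j: "j \<in> {1..m}"
      show "(\<lambda>k. if k \<le> n then x j k else x' j (k - n)) \<in> {1..n + n'} \<rightarrow> carrier (X j)"
      proof (rule funcsetI)
        fix k assume k: "k \<in> {1..n + n'}"
        show "(if k \<le> n then x j k else x' j (k - n)) \<in> carrier (X j)"
        proof (cases "k \<le> n")
          case True
          then show ?thesis using funcset_mem[OF x(1)[rule_format, OF j], of k] k by simp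
        next
          case False
          then have "k - n \<in> {1..n'}" using k by auto
          then show ?thesis using funcset_mem[OF x'(1)[rule_format, OF j]] False by simp
        qed
      qed
    next
      show "f z + g z = defect C (n + n') (\<lambda>j k. if k \<le> n then x j k else x' j (k - n)) z" if "z \<in> Z" for z
        using x(2) x'(2) that by (simp add: defect_append)
    qed
  qed
  have 4: "(\<lambda>z. c * f z) \<in> F" if c: "0 < c" and f: "f \<in> F" for c f
  proof -
    obtain n x where x: "\<forall>j\<in>{1..m}. x j \<in> {1..n} \<rightarrow> carrier (X j)" "\<forall>z\<in>Z. f z = defect C n x z"
      using FE[OF f] by blast
    show ?thesis
    proof (rule FI)
      show "(\<lambda>k. (c powr (1 / q j)) \<odot>\<^bsub>X j\<^esub> x j k) \<in> {1..n} \<rightarrow> carrier (X j)" if "j \<in> {1..m}" for j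
        using x(1) that scale_in_carrier by (auto simp: Pi_iff)
      show "c * f z = defect C n (\<lambda>j k. (c powr (1 / q j)) \<odot>\<^bsub>X j\<^esub> x j k) z" if "z \<in> Z" for z
        using x c that defect_scale[of x n c z C] by simp
    qed
  qed
  have 5: "\<exists>z\<in>Z. f z \<le> e" if f: "f \<in> F" and e: "0 < e" for f e
  proof -
    obtain n x where x: "\<forall>j\<in>{1..m}. x j \<in> {1..n} \<rightarrow> carrier (X j)" "\<forall>z\<in>Z. f z = defect C n x z"
      using FE[OF f] by blast
    have "\<exists>z\<in>Z. defect C n x z \<le> e"
      by (rule defect_small[OF C e _ concave]) (use x in blast)+
    then show ?thesis using x(2) by auto
  qed
  obtain L where L: "positive_mean Z L" and neg: "\<And>f. f \<in> F \<Longrightarrow> L f \<le> 0"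
  proof (rule positive_mean_nonpositive_on_cone[OF 1 2])
    show "(\<lambda>z. f z + g z) \<in> F" if "f \<in> F" "g \<in> F" for f g using that by (rule 3)
    show "(\<lambda>z. c * f z) \<in> F" if "0 < c" "f \<in> F" for c f using that by (rule 4)
    show "\<exists>z\<in>Z. f z \<le> e" if "f \<in> F" "0 < e" for f e using that by (rule 5)
    fix L assume "positive_mean Z L" "\<And>f. f \<in> F \<Longrightarrow> L f \<le> 0"
    then show thesis by (rule that)
  qed
  have "norm (T (\<lambda>j\<in>{1..m}. x j)) powr Q \<le> C powr Q * (\<Sum>j=1..m. w j * L (G j (x j)))"
    if xc: "\<forall>j\<in>{1..m}. x j \<in> carrier (X j)" for x
  proof -
    have x: "x j \<in> carrier (X j)" if "j \<in> {1..m}" for j using xc that by blast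
    define N where "N = norm (T (\<lambda>j\<in>{1..m}. x j)) powr Q"
    have b: "(\<lambda>z. w j * G j (x j) z) \<in> bounded_functions Z" if "j \<in> {1..m}" for j
      by (intro bounded_functions_scale G_bounded that x)
    have bs: "(\<lambda>z. \<Sum>j=1..m. w j * G j (x j) z) \<in> bounded_functions Z" by (rule bounded_functions_sum) (rule b)
    \<comment> \<open>A family with a single term is enough to read off the pointwise estimate; the
      factor 1 displays the constant as a multiple, ready for linearity.\<close>
    have "(\<lambda>z. N * 1 + (- (C powr Q)) * (\<Sum>j=1..m. w j * G j (x j) z)) \<in> F"
      by (rule FI[of "\<lambda>j k. x j" 1]) (use x in \<open>auto simp: defect_def N_def\<close>)
    then have "L (\<lambda>z. N * 1 + (- (C powr Q)) * (\<Sum>j=1..m. w j * G j (x j) z)) \<le> 0" by (rule neg)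
    also have "L (\<lambda>z. N * 1 + (- (C powr Q)) * (\<Sum>j=1..m. w j * G j (x j) z))
      = L (\<lambda>z. N * 1) + L (\<lambda>z. (- (C powr Q)) * (\<Sum>j=1..m. w j * G j (x j) z))"
      by (rule positive_mean_add[OF L bounded_functions_const bounded_functions_scale[OF bs]])
    also have "L (\<lambda>z. N * 1) = N * L (\<lambda>z. 1)" by (rule positive_mean_scale[OF L bounded_functions_const])
    also have "L (\<lambda>z. 1) = 1" using L unfolding positive_mean_def by blast
    also have "L (\<lambda>z. (- (C powr Q)) * (\<Sum>j=1..m. w j * G j (x j) z))
      = (- (C powr Q)) * L (\<lambda>z. \<Sum>j=1..m. w j * G j (x j) z)"
      by (rule positive_mean_scale[OF L bs])
    also have "L (\<lambda>z. \<Sum>j=1..m. w j * G j (x j) z) = (\<Sum>j=1..m. L (\<lambda>z. w j * G j (x j) z))"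
      by (rule positive_mean_sum[OF L b])
    also have "\<dots> = (\<Sum>j=1..m. w j * L (G j (x j)))"
      by (intro sum.cong HOL.refl positive_mean_scale[OF L] G_bounded x)
    finally show ?thesis by (simp add: N_def)
  qed
  with L show ?thesis by blast
qed

text \<open>Only functions of a single coordinate occur in the estimate for the mean, so its
  marginals suffice and no measure on the product is built. Replacing the marginals by the measures
  only enlarges the right side.\<close>

lemma dominated_if_strongly_concave:
  assumes "strongly_concave m p q X T"
  obtains C \<nu> where "0 < C" "\<And>j. j \<in> {1..m} \<Longrightarrow> regular_borel_prob (K j) (\<nu> j)"
    "\<And>x. x \<in> (\<Pi>\<^sub>E j\<in>{1..m}. carrier (X j)) \<Longrightarrow>
      norm (T x) \<le> C * (\<Prod>j=1..m. (\<integral>\<phi>. \<phi> (vabs (X j) (x j)) powr (q j / p j) \<partial>\<nu> j) powr (1 / q j))"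
proof -
  obtain C where C: "0 < C" and concave: "\<And>n x. 1 \<le> n \<Longrightarrow> \<forall>j\<in>{1..m}. x j \<in> {1..n} \<rightarrow> carrier (X j) \<Longrightarrow>
      (\<Sum>k=1..n. norm (T (\<lambda>j\<in>{1..m}. x j k)) powr Q) powr (1 / Q) \<le> C * (\<Prod>j=1..m. W j n (x j))"
    using assms unfolding strongly_concave_iff by blast
  obtain L where L: "positive_mean Z L"
    and dom: "\<And>x. \<forall>j\<in>{1..m}. x j \<in> carrier (X j) \<Longrightarrow>
      norm (T (\<lambda>j\<in>{1..m}. x j)) powr Q \<le> C powr Q * (\<Sum>j=1..m. w j * L (G j (x j)))"
    using mean_exists[OF C concave] by blast
  define Lj where "Lj = (\<lambda>j g. L (\<lambda>z. g (z j)))"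
  define \<nu> where "\<nu> = (\<lambda>j. compact_mean.borel_ext (K j) (Lj j))"
  have cm: "compact_mean (K j) (Lj j)" if j: "j \<in> {1..m}" for j
  proof
    show "positive_mean (topspace (K j)) (Lj j)"
      unfolding Lj_def by (rule positive_mean_compose[OF L]) (use j in \<open>auto simp: Z_def\<close>)
    show "compact_space (K j)" by (rule compact_K[OF j])
    show "Hausdorff_space (K j)" by (rule hausdorff_K[OF j])
  qed
  have reg: "regular_borel_prob (K j) (\<nu> j)" if "j \<in> {1..m}" for j
    unfolding \<nu>_def by (rule compact_mean.regular_borel_ext[OF cm[OF that]])
  define I where "I = (\<lambda>j u. \<integral>\<phi>. \<phi> (vabs (X j) u) powr (q j / p j) \<partial>\<nu> j)"
  have I0: "0 \<le> I j u" for j u by (simp add: I_def)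
  have LI: "L (G j u) \<le> I j u" if j: "j \<in> {1..m}" and u: "u \<in> carrier (X j)" for j u
  proof -
    have "0 < q j / p j" using pj_pos qj_pos j by simp
    from compact_mean.mean_le_integral[OF cm[OF j] continuous_K[OF j u this]]
    show ?thesis by (simp add: Lj_def G_def[abs_def] I_def \<nu>_def)
  qed
  have I_scale: "I j ((t powr (1 / q j)) \<odot>\<^bsub>X j\<^esub> u) = t * I j u"
    if j: "j \<in> {1..m}" and u: "u \<in> carrier (X j)" and t: "0 < t" for j u t
  proof -
    have "space (\<nu> j) = positive_dual_ball (concavification (X j) (p j))"
      using reg[OF j] topspace_K[OF j] by (simp add: regular_borel_prob_def)
    then have "I j ((t powr (1 / q j)) \<odot>\<^bsub>X j\<^esub> u) = (\<integral>\<phi>. t * \<phi> (vabs (X j) u) powr (q j / p j) \<partial>\<nu> j)"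
      unfolding I_def using p_convex_lattice.ball_powr_scale[OF pcl[OF j] _ u] t pj_pos[OF j] qj_pos[OF j]
      by (intro Bochner_Integration.integral_cong HOL.refl) (simp add: powr_powr)
    then show ?thesis by (simp add: I_def)
  qed
  have "norm (T x) \<le> C * (\<Prod>j=1..m. I j (x j) powr (1 / q j))" if x: "x \<in> (\<Pi>\<^sub>E j\<in>{1..m}. carrier (X j))" for x
  proof -
    have xc: "x j \<in> carrier (X j)" if "j \<in> {1..m}" for j using x that by (auto simp: PiE_iff)
    have xr: "(\<lambda>j\<in>{1..m}. x j) = x" using x by (rule PiE_restrict)
    have dom': "norm (T (\<lambda>j\<in>{1..m}. y j)) powr Q \<le> C powr Q * (\<Sum>j=1..m. w j * I j (y j))"
      if y: "\<forall>j\<in>{1..m}. y j \<in> carrier (X j)" for y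
    proof -
      have "(\<Sum>j=1..m. w j * L (G j (y j))) \<le> (\<Sum>j=1..m. w j * I j (y j))"
        using LI y w_pos by (intro sum_mono mult_left_mono) (auto intro: less_imp_le)
      then have "C powr Q * (\<Sum>j=1..m. w j * L (G j (y j))) \<le> C powr Q * (\<Sum>j=1..m. w j * I j (y j))"
        by (rule mult_left_mono) simp
      with dom[OF y] show ?thesis by (rule order_trans)
    qed
    \<comment> \<open>The sum estimate holds for all rescaled variables; both sides scale
      explicitly, and the best scaling yields the product.\<close>
    have "norm (T x) powr Q \<le> C powr Q * (\<Prod>j=1..m. I j (x j) powr w j)"
    proof (rule prod_powr_le_of_scaled_sums)
      fix t :: "nat \<Rightarrow> real" assume t: "\<And>j. j \<in> {1..m} \<Longrightarrow> 0 < t j"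
      have "(\<Prod>j=1..m. t j powr w j) * norm (T x) powr Q
          = norm (T (\<lambda>j\<in>{1..m}. (t j powr (1 / q j)) \<odot>\<^bsub>X j\<^esub> x j)) powr Q"
        using T_scale[OF xc t] xr by simp
      also have "\<dots> \<le> C powr Q * (\<Sum>j=1..m. w j * I j ((t j powr (1 / q j)) \<odot>\<^bsub>X j\<^esub> x j))"
        by (intro dom' ballI scale_in_carrier xc)
      also have "(\<Sum>j=1..m. w j * I j ((t j powr (1 / q j)) \<odot>\<^bsub>X j\<^esub> x j)) = (\<Sum>j=1..m. w j * (t j * I j (x j)))"
        using I_scale xc t by (intro sum.cong) auto
      finally show "(\<Prod>j=1..m. t j powr w j) * norm (T x) powr Q \<le> C powr Q * (\<Sum>j=1..m. w j * (t j * I j (x j)))" .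
    next
      show "0 < w j" if "j \<in> {1..m}" for j using that by (rule w_pos)
      show "sum w {1..m} = 1" by (rule w_sum)
    qed (simp_all add: I0)
    also have "\<dots> = (C * (\<Prod>j=1..m. I j (x j) powr (1 / q j))) powr Q"
      by (simp only: powr_mult prod_powr_Q)
    finally have le: "norm (T x) powr Q \<le> (C * (\<Prod>j=1..m. I j (x j) powr (1 / q j))) powr Q" .
    have "0 \<le> C * (\<Prod>j=1..m. I j (x j) powr (1 / q j))"
      using C by (intro mult_nonneg_nonneg prod_nonneg) auto
    then show ?thesis using le by (rule le_of_powr_le[OF Q_pos])
  qed
  then show ?thesis using that[OF C reg] by (simp add: I_def)
qed

end

theorem theorem3p2:
  fixes m :: nat
    and p q :: "nat \<Rightarrow> real"
    and X :: "nat \<Rightarrow> 'a normed_lattice"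
    and T :: "(nat \<Rightarrow> 'a) \<Rightarrow> 'b::banach"
  assumes "m \<ge> 1"
    and "\<And>j. j \<in> {1..m} \<Longrightarrow> 1 \<le> p j \<and> p j \<le> q j"
    and "\<And>j. j \<in> {1..m} \<Longrightarrow> banach_lattice (X j)"
    and "\<And>j. j \<in> {1..m} \<Longrightarrow> p_convex1 (X j) (p j)"
    and "multilinear_op m X T"
  shows "strongly_concave m p q X T \<longleftrightarrow>
    (\<exists>C>0. \<exists>\<nu> :: nat \<Rightarrow> ('a \<Rightarrow> real) measure.
      (\<forall>j\<in>{1..m}.
        regular_borel_prob
          (subtopology (weak_star_topology (concavification (X j) (p j)))
                       (positive_dual_ball (concavification (X j) (p j))))
          (\<nu> j))
      \<and> (\<forall>x \<in> (\<Pi>\<^sub>E j\<in>{1..m}. carrier (X j)).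
          norm (T x) \<le> C * (\<Prod>j=1..m.
            (\<integral>\<phi>. \<phi> (vabs (X j) (x j)) powr (q j / p j) \<partial>\<nu> j) powr (1 / q j))))"
proof -
  interpret p_convex_multilinear m p q X T by (rule p_convex_multilinear.intro) (fact assms)+
  show ?thesis
  proof (rule iffI, goal_cases)
    case 1
    then obtain C \<nu> where "0 < C" "\<And>j. j \<in> {1..m} \<Longrightarrow> regular_borel_prob (K j) (\<nu> j)"
      "\<And>x. x \<in> (\<Pi>\<^sub>E j\<in>{1..m}. carrier (X j)) \<Longrightarrow>
        norm (T x) \<le> C * (\<Prod>j=1..m. (\<integral>\<phi>. \<phi> (vabs (X j) (x j)) powr (q j / p j) \<partial>\<nu> j) powr (1 / q j))"
      by (rule dominated_if_strongly_concave) blast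
    then show ?case by (intro exI[of _ C] exI[of _ \<nu>] conjI ballI)
  next
    case 2
    then show ?case using strongly_concave_if_dominated by blast
  qed
qed

end
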